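(* Let $p\ge 1$ be an integer, $J,L$ nonzero natural numbers, $\mu\in\mathbb R$ (positive or negative), and let $V^j=V(\alpha^j,\beta^j,\infty,\mu)$, $S_l=S(\alpha_l,\beta_l,\eta_0)$, $V_l^j(\eta)=V(\alpha_l^j,\beta_l^j,r_0,\mu|\eta|)$ ($j=1,\dots,J$, $l=1,\dots,L$) be a good coherent covering of fineness $\delta$. Let $\tilde r_0>r_0$ and $\tilde\mu>\mu$ and put $\tilde V_l^j(\eta)=V(\alpha_l^j-2\delta,\beta_l^j+2\delta,\tilde r_0,\tilde\mu|\eta|)$. Suppose there exist bounded holomorphic functions $y_l^j(x,\eta)$ defined for $\eta\in S_l$, $x\in\tilde V_l^j(\eta)$, and constants $A,B,C>0$ such that (indices $j$ taken mod $J$, indices $l$ mod $L$) $$|y_{l+1}^j(x,\eta)-y_l^j(x,\eta)|\le C\exp\Big(-\frac{A}{|\eta|^p}\Big)\quad\text{if }\eta\in S_l\cap S_{l+1},\ x\in\tilde V_l^j(\eta)\cap\tilde V_{l+1}^j(\eta),$$ $$|y_l^{j+1}(x,\eta)-y_l^j(x,\eta)|\le C\exp\Big(-B\Big|\frac x\eta\Big|^p\Big)\quad\text{if }\eta\in S_l,\ x\in\tilde V_l^j(\eta)\cap\tilde V_l^{j+1}(\eta).$$ Then the restrictions of the functions $y_l^j$ to the set of $(x,\eta)$ with $\eta\in S_l$, $x\in V_l^j(\eta)$ admit Gevrey combined asymptotic expansions of order $\frac1p$. Precisely, put $\tilde A=\min(A,Br_0^p)$. There exist a sequence $(a_n)_{n\in\mathbb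 N}$ in $\mathcal H(r_0)$, for each $j$ a sequence $(g_n^j)_{n\in\mathbb N}$ in $\mathcal G(V^j)$, and a constant $\tilde C$ such that for all $j,l$, all $\eta\in S_l$, all $x\in V_l^j(\eta)$ and all integers $N>0$ $$\Big|y_l^j(x,\eta)-\sum_{n=0}^{N-1}\Big(a_n(x)+g_n^j\big(\tfrac x\eta\big)\Big)\eta^n\Big|\le\tilde C\,\tilde A^{-N/p}\,\Gamma\big(\tfrac Np+1\big)|\eta|^N.$$ Moreover the sequences $(g_n^j)_{n}$ have compatible Gevrey asymptotic expansions of order $\frac1p$ at infinity of type $(\tilde A^{-1/p},B^{-1/p})$ with coefficients independent of $j$: there exist complex numbers $(g_{nm})_{n,m\in\mathbb N}$ and a constant $\tilde C$ such that for all $M,n\in\mathbb N$, $j\in\{1,\dots,J\}$ and $X\in V^j$ $$|X|^M\Big|g_n^j(X)-\sum_{m=1}^{M-1}g_{nm}X^{-m}\Big|\le\tilde C\,\tilde A^{-n/p}B^{-M/p}\,\Gamma\big(\tfrac{M+n}p+1\big).$$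
   Context: $D(0,r)\subset\mathbb C$ is the open disc of centre $0$, radius $r$. For $\alpha<\beta$, $0<r\le\infty$: $S(\alpha,\beta,r)=\{x\in\mathbb C:0<|x|<r,\ \alpha<\arg x<\beta\}$. Quasi-sectors: for $\mu>0$, $V(\alpha,\beta,r,\mu)=\{x\in\mathbb C:(0<|x|<r,\ \alpha<\arg x<\beta)\text{ or }|x|<\mu\}$; for $\mu<0$, $V(\alpha,\beta,r,\mu)=\{x\in\mathbb C:-\mu<|x|<r,\ \alpha<\arg x<\beta\}$; for $\mu=0$ it is $S(\alpha,\beta,r)$. It is understood that $\eta_0$ is small enough that $|\mu|\eta_0<r_0$ and $|\tilde\mu|\eta_0<\tilde r_0$. $\mathcal H(r_0)$: bounded holomorphic functions on $D(0,r_0)$. $\mathcal G(V)$, for an infinite quasi-sector $V$: bounded holomorphic functions $g$ on $V$ with an asymptotic expansion $g(X)\sim\sum_{\nu\ge1}g_\nu X^{-\nu}$ as $V\ni X\to\infty$, i.e. for every $N$ there is $C_N$ with $|g(X)-\sum_{\nu=1}^{N-1}g_\nu X^{-\nu}|\le C_N|X|^{-N}$ on $V$. Good coherent covering. Put $C(\sigma,\rho)=\{x\in\mathbb C:\sigma<|x|<\rho\}$ (for $\sigma<0$ this is $D(0,\rho)$). The collection $V^j,S_l,V_l^j(\eta)$ is a good coherent covering if: (i) the $V^j=V(\alpha^j,\beta^j,\infty,\mu)$ form a good covering of $C(-\mu,\infty)$, i.e. their union is $C(-\mu,\infty)$ and $V^j\cap V^m$ is bounded when $j\notin\{m-1,m,m+1\}$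 mod $J$ (arguments ordered so that $\alpha^j<\beta^{j-1}<\alpha^{j+1}$, with $\alpha^{J+1}=\alpha^1+2\pi$); (ii) the $S_l=S(\alpha_l,\beta_l,\eta_0)$ form a good covering of $D(0,\eta_0)\setminus\{0\}$: their union is $D(0,\eta_0)\setminus\{0\}$ and $S_l\cap S_m=\emptyset$ when $l\notin\{m-1,m,m+1\}$ mod $L$; (iii) there is $\delta$ with $\max_l(\beta_l-\alpha_l)\le\delta<\frac12\min\{\beta^1-\alpha^2,\dots,\beta^{J-1}-\alpha^J,\beta^J-\alpha^1-2\pi\}$, and $V_l^j(\eta)=V(\alpha_l^j,\beta_l^j,r_0,\mu|\eta|)$ with $\alpha_l^j=\alpha^j+\varphi_l+\delta$, $\beta_l^j=\beta^j+\varphi_l-\delta$, $\varphi_l=(\alpha_l+\beta_l)/2$. The fineness is $\max_l(\beta_l-\alpha_l)$; in the claim the fineness $\delta$ is also the $\delta$ used in (iii). Gevrey combined asymptotic expansion of order $\frac1p$ of a holomorphic $y(x,\eta)$ ($\eta\in S_l$, $x\in V_l^j(\eta)$): a formal expression $\sum_{n\ge0}(a_n(x)+g_n(\frac x\eta))\eta^n$, $a_n\in\mathcal H(r_0)$, $g_n\in\mathcal G(V^j)$, $g_n(X)\sim\sum_{m\geq 1} g_{nm}X^{-m}$, for which there are $C,L_1,L_2>0$ with, for all $n,M,N$: $\sup_{|x|<r_0}|a_n(x)|\le CL_1^n\Gamma(\frac np+1)$; $|X|^M|g_n(X)-\sum_{m=1}^{M-1}g_{nm}X^{-m}|\le CL_1^nL_2^M\Gamma(\frac{M+n}p+1)$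 on $V^j$; and $|y(x,\eta)-\sum_{n<N}(a_n(x)+g_n(\frac x\eta))\eta^n|\le CL_1^N\Gamma(\frac Np+1)|\eta|^N$. The second family of inequalities is what is called "compatible Gevrey expansions of order $\frac1p$ of type $(L_1,L_2)$". *)

theory Defs
  imports "HOL-Complex_Analysis.Complex_Analysis" "HOL-Number_Theory.Cong"
begin

text \<open>Sectors and quasi-sectors are subsets of the complex plane: \<open>\<alpha> < arg x < \<beta>\<close> means that
  \<^emph>\<open>some\<close> determination of the argument lies between \<open>\<alpha>\<close> and \<open>\<beta>\<close>, so \<open>\<alpha>\<close> and \<open>\<beta>\<close> matter only
  up to a common multiple of \<open>2\<pi>\<close>, and an opening larger than \<open>2\<pi>\<close> gives all nonzero points.\<close>

definition arg_between :: "real \<Rightarrow> real \<Rightarrow> complex \<Rightarrow> bool" where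
  "arg_between \<alpha> \<beta> x \<longleftrightarrow>
     (\<exists>\<theta>. \<alpha> < \<theta> \<and> \<theta> < \<beta> \<and> x = complex_of_real (cmod x) * cis \<theta>)"

definition sector :: "real \<Rightarrow> real \<Rightarrow> ereal \<Rightarrow> complex set" where
  "sector \<alpha> \<beta> r = {x. 0 < cmod x \<and> ereal (cmod x) < r \<and> arg_between \<alpha> \<beta> x}"

definition quasi_sector :: "real \<Rightarrow> real \<Rightarrow> ereal \<Rightarrow> real \<Rightarrow> complex set" where
  "quasi_sector \<alpha> \<beta> r \<mu> =
     (if \<mu> > 0 then {x. (0 < cmod x \<and> ereal (cmod x) < r \<and> arg_between \<alpha> \<beta> x) \<or> cmod x < \<mu>}
      else if \<mu> < 0 then {x. - \<mu> < cmod x \<and> ereal (cmod x) < r \<and> arg_between \<alpha> \<beta> x}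
      else sector \<alpha> \<beta> r)"

definition annulus :: "real \<Rightarrow> ereal \<Rightarrow> complex set" where
  "annulus \<sigma> \<rho> = {x. \<sigma> < cmod x \<and> ereal (cmod x) < \<rho>}"

text \<open>Cyclic indices run through \<open>1, \<dots>, J\<close>. A finite sequence of angles is continued beyond \<open>J\<close>
  by adding \<open>2\<pi>\<close> for every full turn, so that \<open>angle_ext J \<alpha> (J + 1) = \<alpha> 1 + 2\<pi>\<close>.\<close>

definition cyc_succ :: "nat \<Rightarrow> nat \<Rightarrow> nat" where
  "cyc_succ J j = j mod J + 1"

definition cyc_near :: "nat \<Rightarrow> nat \<Rightarrow> nat \<Rightarrow> bool" where
  "cyc_near J j m \<longleftrightarrow> (\<exists>d\<in>{-1, 0, 1}. [int j = int m + d] (mod int J))"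

definition angle_ext :: "nat \<Rightarrow> (nat \<Rightarrow> real) \<Rightarrow> nat \<Rightarrow> real" where
  "angle_ext J \<alpha> k = \<alpha> ((k - 1) mod J + 1) + 2 * pi * real ((k - 1) div J)"

text \<open>The ordering \<open>\<alpha>\<^sup>j < \<beta>\<^sup>j\<^sup>-\<^sup>1 < \<alpha>\<^sup>j\<^sup>+\<^sup>1\<close> is written below with \<open>j\<close> shifted by one.\<close>

definition good_covering_V :: "nat \<Rightarrow> (nat \<Rightarrow> real) \<Rightarrow> (nat \<Rightarrow> real) \<Rightarrow> real \<Rightarrow> bool" where
  "good_covering_V J \<alpha> \<beta> \<mu> \<longleftrightarrow>
     (\<forall>j\<in>{1..J}. \<alpha> j < \<beta> j) \<and>
     (\<forall>j\<in>{1..J}. angle_ext J \<alpha> (j + 1) < \<beta> j \<and> \<beta> j < angle_ext J \<alpha> (j + 2)) \<and>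
     (\<Union>j\<in>{1..J}. quasi_sector (\<alpha> j) (\<beta> j) \<infinity> \<mu>) = annulus (- \<mu>) \<infinity> \<and>
     (\<forall>j\<in>{1..J}. \<forall>m\<in>{1..J}. \<not> cyc_near J j m \<longrightarrow>
        bounded (quasi_sector (\<alpha> j) (\<beta> j) \<infinity> \<mu> \<inter> quasi_sector (\<alpha> m) (\<beta> m) \<infinity> \<mu>))"

definition good_covering_S :: "nat \<Rightarrow> (nat \<Rightarrow> real) \<Rightarrow> (nat \<Rightarrow> real) \<Rightarrow> real \<Rightarrow> bool" where
  "good_covering_S L \<alpha> \<beta> \<eta>0 \<longleftrightarrow>
     (\<forall>l\<in>{1..L}. \<alpha> l < \<beta> l) \<and>
     (\<Union>l\<in>{1..L}. sector (\<alpha> l) (\<beta> l) \<eta>0) = ball 0 \<eta>0 - {0} \<and>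
     (\<forall>l\<in>{1..L}. \<forall>m\<in>{1..L}. \<not> cyc_near L l m \<longrightarrow>
        sector (\<alpha> l) (\<beta> l) \<eta>0 \<inter> sector (\<alpha> m) (\<beta> m) \<eta>0 = {})"

definition fineness :: "nat \<Rightarrow> (nat \<Rightarrow> real) \<Rightarrow> (nat \<Rightarrow> real) \<Rightarrow> real" where
  "fineness L \<alpha> \<beta> = Max ((\<lambda>l. \<beta> l - \<alpha> l) ` {1..L})"

text \<open>In the next definitions \<open>\<alpha>V, \<beta>V\<close> are the angles of the \<open>V\<^sup>j\<close> and \<open>\<alpha>S, \<beta>S\<close> those of the \<open>S\<^sub>l\<close>.\<close>

definition good_coherent_covering ::
  "nat \<Rightarrow> nat \<Rightarrow> (nat \<Rightarrow> real) \<Rightarrow> (nat \<Rightarrow> real) \<Rightarrow> (nat \<Rightarrow> real) \<Rightarrow> (nat \<Rightarrow> real)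
    \<Rightarrow> real \<Rightarrow> real \<Rightarrow> real \<Rightarrow> bool" where
  "good_coherent_covering J L \<alpha>V \<beta>V \<alpha>S \<beta>S \<mu> \<eta>0 \<delta> \<longleftrightarrow>
     good_covering_V J \<alpha>V \<beta>V \<mu> \<and>
     good_covering_S L \<alpha>S \<beta>S \<eta>0 \<and>
     fineness L \<alpha>S \<beta>S \<le> \<delta> \<and>
     \<delta> < 1 / 2 * Min ((\<lambda>j. \<beta>V j - angle_ext J \<alpha>V (j + 1)) ` {1..J})"

definition bisecting_angle :: "(nat \<Rightarrow> real) \<Rightarrow> (nat \<Rightarrow> real) \<Rightarrow> nat \<Rightarrow> real" where
  "bisecting_angle \<alpha>S \<beta>S l = (\<alpha>S l + \<beta>S l) / 2"

definition alpha_jl ::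
  "(nat \<Rightarrow> real) \<Rightarrow> (nat \<Rightarrow> real) \<Rightarrow> (nat \<Rightarrow> real) \<Rightarrow> real \<Rightarrow> nat \<Rightarrow> nat \<Rightarrow> real" where
  "alpha_jl \<alpha>V \<alpha>S \<beta>S \<delta> j l = \<alpha>V j + bisecting_angle \<alpha>S \<beta>S l + \<delta>"

definition beta_jl ::
  "(nat \<Rightarrow> real) \<Rightarrow> (nat \<Rightarrow> real) \<Rightarrow> (nat \<Rightarrow> real) \<Rightarrow> real \<Rightarrow> nat \<Rightarrow> nat \<Rightarrow> real" where
  "beta_jl \<beta>V \<alpha>S \<beta>S \<delta> j l = \<beta>V j + bisecting_angle \<alpha>S \<beta>S l - \<delta>"

definition fibred :: "complex set \<Rightarrow> (complex \<Rightarrow> complex set) \<Rightarrow> (complex \<times> complex) set" where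
  "fibred S W = {(x, \<eta>). \<eta> \<in> S \<and> x \<in> W \<eta>}"

text \<open>Holomorphy in two variables is complex Frechet differentiability.\<close>

definition holomorphic2_on :: "(complex \<times> complex \<Rightarrow> complex) \<Rightarrow> (complex \<times> complex) set \<Rightarrow> bool"
  (infixl \<open>holomorphic2'_on\<close> 50) where
  "f holomorphic2_on D \<longleftrightarrow>
     (\<forall>z\<in>D. \<exists>a b. (f has_derivative (\<lambda>(h, k). a * h + b * k)) (at z within D))"

definition H_space :: "real \<Rightarrow> (complex \<Rightarrow> complex) set" where
  "H_space r = {a. a holomorphic_on ball 0 r \<and> bounded (a ` ball 0 r)}"

text \<open>The remainder estimate is multiplied by \<open>\<bar>X\<bar>\<^sup>N\<close>: if \<open>0 \<in> V\<close>, it imposes nothing at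
  \<open>X = 0\<close> for \<open>N \<ge> 1\<close>, whereas the form with \<open>\<bar>X\<bar>\<^sup>-\<^sup>N\<close> would force \<open>g 0 = 0\<close> since \<open>1 / 0 = 0\<close>.\<close>

definition has_expansion_at_infinity ::
  "(complex \<Rightarrow> complex) \<Rightarrow> complex set \<Rightarrow> (nat \<Rightarrow> complex) \<Rightarrow> bool" where
  "has_expansion_at_infinity g V c \<longleftrightarrow>
     (\<forall>N. \<exists>K. \<forall>X\<in>V. cmod X ^ N * cmod (g X - (\<Sum>\<nu>\<in>{1..<N}. c \<nu> / X ^ \<nu>)) \<le> K)"

definition G_space :: "complex set \<Rightarrow> (complex \<Rightarrow> complex) set" where
  "G_space V = {g. g holomorphic_on V \<and> bounded (g ` V) \<and> (\<exists>c. has_expansion_at_infinity g V c)}"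

text \<open>Here \<open>S\<close>, \<open>W\<close>, \<open>V\<close> stand for \<open>S\<^sub>l\<close>, \<open>\<eta> \<mapsto> V\<^sub>l\<^sup>j(\<eta>)\<close>, \<open>V\<^sup>j\<close>, and \<open>c n m\<close> for \<open>g\<^sub>n\<^sub>m\<close>.\<close>

definition gevrey_combined_expansion ::
  "nat \<Rightarrow> real \<Rightarrow> complex set \<Rightarrow> complex set \<Rightarrow> (complex \<Rightarrow> complex set)
    \<Rightarrow> (complex \<Rightarrow> complex \<Rightarrow> complex) \<Rightarrow> (nat \<Rightarrow> complex \<Rightarrow> complex)
    \<Rightarrow> (nat \<Rightarrow> complex \<Rightarrow> complex) \<Rightarrow> bool" where
  "gevrey_combined_expansion p r0 V S W y a g \<longleftrightarrow>
     (\<lambda>(x, \<eta>). y x \<eta>) holomorphic2_on fibred S W \<and>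
     (\<forall>n. a n \<in> H_space r0) \<and>
     (\<forall>n. g n \<in> G_space V) \<and>
     (\<exists>c. (\<forall>n. has_expansion_at_infinity (g n) V (c n)) \<and>
       (\<exists>C>0. \<exists>L1>0. \<exists>L2>0.
         (\<forall>n. \<forall>x\<in>ball 0 r0. cmod (a n x) \<le> C * L1 ^ n * Gamma (real n / real p + 1)) \<and>
         (\<forall>n M. \<forall>X\<in>V. cmod X ^ M * cmod (g n X - (\<Sum>m\<in>{1..<M}. c n m / X ^ m))
            \<le> C * L1 ^ n * L2 ^ M * Gamma (real (M + n) / real p + 1)) \<and>
         (\<forall>N. \<forall>\<eta>\<in>S. \<forall>x\<in>W \<eta>. cmod (y x \<eta> - (\<Sum>n<N. (a n x + g n (x / \<eta>)) * \<eta> ^ n))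
            \<le> C * L1 ^ N * Gamma (real N / real p + 1) * cmod \<eta> ^ N)))"

end

theory Submission
  imports Defs
begin

text \<open>
  Everything rests on the Cauchy--Heine argument of Ramis and Sibuya: functions on a cyclic family of
  sectors with exponentially small differences have a common Gevrey expansion. The argument is run on
  concentric circles, along which one switches between the members of the family at finitely many
  fixed directions; the switches contribute integrals of the differences along radii, and incomplete
  Gamma functions bound these with the exact type.

  Put \<open>x = \<eta>X\<close>. The Cauchy transform \<open>f\<close> of \<open>y(\<cdot>, \<eta>)\<close> over a circle of radius slightly above
  \<open>r0\<close> is holomorphic in \<open>x\<close> and depends on \<open>l\<close> only up to \<open>O(exp(-A'/|\<eta>|^p))\<close>, so Ramis--Sibuya in \<open>\<eta>\<close>
  gives the \<open>a_n\<close>. For fixed \<open>X\<close>, Ramis--Sibuya in \<open>\<eta>\<close> for \<open>y - f\<close> gives the \<open>g_n(X)\<close>; when \<open>X\<close> is so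
  large that \<open>\<eta>X\<close> leaves the disc, \<open>y - f\<close> is continued by minus the Cauchy transform over a smaller circle,
  which keeps all bounds uniform in \<open>X\<close>. Finally the differences of the \<open>g_n\<close> in \<open>j\<close> are the coefficients
  of a function of size \<open>exp(-max(A'/|\<eta>|^p, B|X|^p))\<close>, and Ramis--Sibuya in \<open>1/X\<close> yields the common
  expansions at infinity, whose constant terms are moved from the \<open>g_n\<close> to the \<open>a_n\<close>.
\<close>

section \<open>Integrals over circles with piecewise integrands\<close>

text \<open>The number \<open>A' = min A (B * r0 ^ p)\<close> arises on circles |w| = r with r0 < r
  < r0': there the hypothesis in j gives exp(-B|w/\<eta>|^p) \<le> exp(-B r0^p/|\<eta>|^p), so all
  differences, in j as in l, are O(exp(-A'/|\<eta>|^p)). The types come out exact because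
  integrating exp(-A/r^p) against dr/r^(n+1) gives A^(-n/p) Gamma(n/p)/p without loss, and geometric
  factors from fixed radii are dominated by Gamma(n/p + 1). The main obstacle is uniformity in X:
  y(\<eta>X, \<eta>) exists only for |\<eta>| < r0'/|X|, and coefficients read off on a disc of that
  radius R carry a factor R^(-n), hence |X|^n. The continuation beyond |\<eta>| = const/|X| removes
  it for the g_n themselves; for their differences in j it is instead paid by exp(-B|X|^p). A second
  obstacle is that the Cauchy kernel at z is large at a switch in a direction close to that of z.
  The selection of branches therefore depends on z. Two selections give moments that differ by a
  flat function of the radius, so the limits at radius 0, which yield the coefficients,
  agree.\<close>

definition node :: "nat \<Rightarrow> nat \<Rightarrow> real" where
  "node K m = 2 * pi * real m / real K"

text \<open>The integral of \<open>G du / (i u)\<close> over \<open>|u| = r\<close>, where \<open>G\<close> is the branch \<open>G m\<close> on the \<open>m\<close>-th of \<open>K\<close> equal arcs.\<close>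
definition circ_sum :: "nat \<Rightarrow> (nat \<Rightarrow> complex \<Rightarrow> complex) \<Rightarrow> real \<Rightarrow> complex" where
  "circ_sum K G r = (\<Sum>m<K. integral {node K m..node K (Suc m)} (\<lambda>\<theta>. G m (of_real r * cis \<theta>)))"

lemma has_vector_derivative_cis: "(cis has_vector_derivative \<i> * cis x) (at x within A)"
proof -
  have "((\<lambda>x. exp (\<i> * of_real x)) has_vector_derivative (\<i> * exp (\<i> * of_real x))) (at x within A)"
    by (rule has_vector_derivative_real_field[THEN has_vector_derivative_at_within]) (auto intro!: derivative_eq_intros)
  thus ?thesis by (simp add: cis_conv_exp[abs_def])
qed

text \<open>The function F'(r e^(i\<theta>)) e^(i\<theta>) is the r-derivative of F along a ray and,
  after multiplication by i r, the \<theta>-derivative along an arc. Integrating it over the polar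
  rectangle in both orders gives the two sides.\<close>

lemma arc_annulus:
  fixes F :: "complex \<Rightarrow> complex"
  assumes hol: "F holomorphic_on U" and op: "open U"
    and sub: "\<And>r \<theta>. r \<in> {a..b} \<Longrightarrow> \<theta> \<in> {s..t} \<Longrightarrow> of_real r * cis \<theta> \<in> U"
    and ab: "0 < a" "a \<le> b" and st: "s \<le> t"
  shows "integral {s..t} (\<lambda>\<theta>. F (of_real b * cis \<theta>)) - integral {s..t} (\<lambda>\<theta>. F (of_real a * cis \<theta>))
       = integral {a..b} (\<lambda>r. (F (of_real r * cis t) - F (of_real r * cis s)) / (\<i> * of_real r))"
proof -
  have dF: "(F has_field_derivative deriv F z) (at z)" if "z \<in> U" for z
    using hol op that by (simp add: holomorphic_derivI)
  have cF: "continuous_on U F" using hol by (rule holomorphic_on_imp_continuous_on)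
  have cD: "continuous_on U (deriv F)"
    using hol op holomorphic_deriv holomorphic_on_imp_continuous_on by blast
  have cont: "continuous_on (cbox (s,a) (t,b)) (\<lambda>(\<theta>,r). deriv F (of_real r * cis \<theta>) * cis \<theta>)"
    unfolding split_beta
    by (intro continuous_intros continuous_on_compose2[OF cD]) (auto intro!: sub)
  have i1: "integral {a..b} (\<lambda>r. deriv F (of_real r * cis \<theta>) * cis \<theta>)
      = F (of_real b * cis \<theta>) - F (of_real a * cis \<theta>)" if "\<theta> \<in> {s..t}" for \<theta>
  proof (rule integral_unique, rule fundamental_theorem_of_calculus[OF ab(2)])
    fix r assume r: "r \<in> {a..b}"
    have "((\<lambda>r. of_real r * cis \<theta>) has_vector_derivative cis \<theta>) (at r)"
      by (auto intro!: derivative_eq_intros simp: scaleR_conv_of_real)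
    from field_vector_diff_chain_at[OF this dF[OF sub[OF r that]]]
    show "((\<lambda>r. F (of_real r * cis \<theta>)) has_vector_derivative deriv F (of_real r * cis \<theta>) * cis \<theta>) (at r within {a..b})"
      by (simp add: o_def mult.commute has_vector_derivative_at_within)
  qed
  have i2: "integral {s..t} (\<lambda>\<theta>. deriv F (of_real r * cis \<theta>) * cis \<theta>)
      = (F (of_real r * cis t) - F (of_real r * cis s)) / (\<i> * of_real r)" if r: "r \<in> {a..b}" for r
  proof -
    have r0: "r \<noteq> 0" using that ab by auto
    have "((\<lambda>\<theta>. deriv F (of_real r * cis \<theta>) * cis \<theta> * (\<i> * of_real r)) has_integral
        F (of_real r * cis t) - F (of_real r * cis s)) {s..t}"
    proof (rule fundamental_theorem_of_calculus[OF st])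
      fix \<theta> assume th: "\<theta> \<in> {s..t}"
      have "((\<lambda>\<theta>. of_real r * cis \<theta>) has_vector_derivative of_real r * (\<i> * cis \<theta>)) (at \<theta>)"
        by (rule has_vector_derivative_mult_right has_vector_derivative_cis)+
      from field_vector_diff_chain_at[OF this dF[OF sub[OF r th]]]
      show "((\<lambda>\<theta>. F (of_real r * cis \<theta>)) has_vector_derivative deriv F (of_real r * cis \<theta>) * cis \<theta> * (\<i> * of_real r)) (at \<theta> within {s..t})"
        by (simp add: o_def mult_ac has_vector_derivative_at_within)
    qed
    from has_integral_divide[OF this, of "\<i> * of_real r"] show ?thesis
      using r0 by (simp add: integral_unique)
  qed
  have int: "(\<lambda>\<theta>. F (of_real c * cis \<theta>)) integrable_on {s..t}" if "c \<in> {a..b}" for c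
    by (rule integrable_continuous_real, intro continuous_on_compose2[OF cF] continuous_intros) (auto intro!: sub that)
  have "integral {s..t} (\<lambda>\<theta>. F (of_real b * cis \<theta>)) - integral {s..t} (\<lambda>\<theta>. F (of_real a * cis \<theta>))
      = integral {s..t} (\<lambda>\<theta>. F (of_real b * cis \<theta>) - F (of_real a * cis \<theta>))"
    using ab by (intro integral_diff[symmetric] int) auto
  also have "\<dots> = integral {s..t} (\<lambda>\<theta>. integral {a..b} (\<lambda>r. deriv F (of_real r * cis \<theta>) * cis \<theta>))"
    by (intro integral_cong i1[symmetric])
  also have "\<dots> = integral {a..b} (\<lambda>r. integral {s..t} (\<lambda>\<theta>. deriv F (of_real r * cis \<theta>) * cis \<theta>))"
    using integral_swap_continuous[OF cont] by simp
  also have "\<dots> = integral {a..b} (\<lambda>r. (F (of_real r * cis t) - F (of_real r * cis s)) / (\<i> * of_real r))"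
    by (intro integral_cong i2)
  finally show ?thesis .
qed

section \<open>Linearity and bounds for piecewise circle integrals\<close>

lemma node_0 [simp]: "node K 0 = 0" and node_self: "K > 0 \<Longrightarrow> node K K = 2 * pi"
  and node_mono: "m \<le> n \<Longrightarrow> node K m \<le> node K n"
  by (auto simp: node_def divide_right_mono)

lemma node_Suc_le: "node K m \<le> node K (Suc m)" by (simp add: node_mono)

lemma node_step: "node K (Suc m) - node K m = 2 * pi / real K"
  by (simp add: node_def diff_divide_distrib[symmetric] ring_distribs)

lemma circ_sum_cong:
  assumes "\<And>m \<theta>. m < K \<Longrightarrow> \<theta> \<in> {node K m..node K (Suc m)} \<Longrightarrow>
      G m (of_real r * cis \<theta>) = H m (of_real r * cis \<theta>)"
  shows "circ_sum K G r = circ_sum K H r"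
  unfolding circ_sum_def by (intro sum.cong refl integral_cong assms) auto

definition arc_cont :: "nat \<Rightarrow> (nat \<Rightarrow> complex \<Rightarrow> complex) \<Rightarrow> real \<Rightarrow> bool" where
  "arc_cont K G r \<longleftrightarrow> (\<forall>m<K. continuous_on {node K m..node K (Suc m)} (\<lambda>\<theta>. G m (of_real r * cis \<theta>)))"

lemma circ_sum_add:
  "arc_cont K G r \<Longrightarrow> arc_cont K H r \<Longrightarrow> circ_sum K (\<lambda>m u. G m u + H m u) r = circ_sum K G r + circ_sum K H r"
  unfolding circ_sum_def arc_cont_def
  by (subst sum.distrib[symmetric], intro sum.cong refl integral_add integrable_continuous_real) auto

lemma circ_sum_diff:
  "arc_cont K G r \<Longrightarrow> arc_cont K H r \<Longrightarrow> circ_sum K (\<lambda>m u. G m u - H m u) r = circ_sum K G r - circ_sum K H r"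
  unfolding circ_sum_def arc_cont_def
  by (subst sum_subtractf[symmetric], intro sum.cong refl integral_diff integrable_continuous_real) auto

lemma circ_sum_cmult: "circ_sum K (\<lambda>m u. c * G m u) r = c * circ_sum K G r"
  unfolding circ_sum_def sum_distrib_left by (intro sum.cong refl integral_mult_right)

lemma arc_cont_sum: "finite A \<Longrightarrow> (\<And>i. i \<in> A \<Longrightarrow> arc_cont K (G i) r) \<Longrightarrow> arc_cont K (\<lambda>m u. \<Sum>i\<in>A. G i m u) r"
  unfolding arc_cont_def by (intro allI impI continuous_on_sum) auto

lemma circ_sum_zero [simp]: "circ_sum K (\<lambda>m u. 0) r = 0"
  by (simp add: circ_sum_def)

lemma circ_sum_sum:
  assumes "finite A" "\<And>i. i \<in> A \<Longrightarrow> arc_cont K (G i) r"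
  shows "circ_sum K (\<lambda>m u. \<Sum>i\<in>A. G i m u) r = (\<Sum>i\<in>A. circ_sum K (G i) r)"
  using assms
proof (induction A rule: finite_induct)
  case (insert x F)
  have "arc_cont K (\<lambda>m u. \<Sum>i\<in>F. G i m u) r" using insert by (intro arc_cont_sum) auto
  then show ?case using insert by (simp add: circ_sum_add)
qed simp

lemma circ_sum_norm_le:
  assumes K: "K > 0" and c: "arc_cont K G r"
    and b: "\<And>m \<theta>. m < K \<Longrightarrow> \<theta> \<in> {node K m..node K (Suc m)} \<Longrightarrow> norm (G m (of_real r * cis \<theta>)) \<le> Q"
  shows "norm (circ_sum K G r) \<le> 2 * pi * Q"
proof -
  have "norm (circ_sum K G r) \<le> (\<Sum>m<K. norm (integral {node K m..node K (Suc m)} (\<lambda>\<theta>. G m (of_real r * cis \<theta>))))"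
    unfolding circ_sum_def by (rule norm_sum)
  also have "\<dots> \<le> (\<Sum>m<K. Q * (2 * pi / real K))"
  proof (rule sum_mono)
    fix m assume m: "m \<in> {..<K}"
    have "norm (integral {node K m..node K (Suc m)} (\<lambda>\<theta>. G m (of_real r * cis \<theta>))) \<le> Q * (node K (Suc m) - node K m)"
      by (rule integral_bound) (use m b c node_Suc_le in \<open>auto simp: arc_cont_def\<close>)
    thus "norm (integral {node K m..node K (Suc m)} (\<lambda>\<theta>. G m (of_real r * cis \<theta>))) \<le> Q * (2 * pi / real K)"
      by (simp add: node_step)
  qed
  also have "\<dots> = 2 * pi * Q" using K by simp
  finally show ?thesis .
qed

lemma arc_cont_holomorphic:
  assumes "\<And>m. m < K \<Longrightarrow> G m holomorphic_on U m"
    and "\<And>m \<theta>. m < K \<Longrightarrow> \<theta> \<in> {node K m..node K (Suc m)} \<Longrightarrow> of_real r * cis \<theta> \<in> U m"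
  shows "arc_cont K G r"
  unfolding arc_cont_def
  using assms by (intro allI impI continuous_on_compose2[OF holomorphic_on_imp_continuous_on[OF assms(1)]] continuous_intros) auto

text \<open>On each arc Cauchy's theorem leaves two radial integrals; those of neighbouring arcs cancel up to
  the jump of \<open>G\<close>.\<close>
lemma circ_sum_annulus_le:
  assumes K: "K > 0" and ab: "0 < a" "a \<le> b"
    and hol: "\<And>m. m < K \<Longrightarrow> G m holomorphic_on U m" and op: "\<And>m. m < K \<Longrightarrow> open (U m)"
    and sub: "\<And>m r \<theta>. m < K \<Longrightarrow> r \<in> {a..b} \<Longrightarrow> \<theta> \<in> {node K m..node K (Suc m)} \<Longrightarrow> of_real r * cis \<theta> \<in> U m"
    and d: "\<And>m r. m < K \<Longrightarrow> r \<in> {a..b} \<Longrightarrow>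
        norm (G m (of_real r * cis (node K (Suc m))) - G (Suc m mod K) (of_real r * cis (node K (Suc m)))) \<le> d r"
    and cd: "continuous_on {a..b} d"
  shows "norm (circ_sum K G b - circ_sum K G a) \<le> real K * integral {a..b} (\<lambda>r. d r / r)"
proof -
  define P where "P m r = G m (of_real r * cis (node K (Suc m))) / (\<i> * of_real r)" for m r
  define Q where "Q m r = G m (of_real r * cis (node K m)) / (\<i> * of_real r)" for m r
  \<comment> \<open>\<open>Q'\<close> takes the branch index modulo K, so that
    \<open>Q' K = Q' 0\<close>: the direction \<open>node K K\<close> is \<open>node K 0\<close>
    after a full turn. This closes the circle in the index shift below.\<close>
  define Q' where "Q' m r = G (m mod K) (of_real r * cis (node K m)) / (\<i> * of_real r)" for m r
  have cG: "continuous_on (U m) (G m)" if "m < K" for m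
    using hol[OF that] by (rule holomorphic_on_imp_continuous_on)
  have iP: "P m integrable_on {a..b}" if "m < K" for m
    unfolding P_def using that ab
    by (intro integrable_continuous_real continuous_intros continuous_on_compose2[OF cG[OF that]]) (auto intro!: sub simp: node_Suc_le)
  have iQ: "Q m integrable_on {a..b}" if "m < K" for m
    unfolding Q_def using that ab
    by (intro integrable_continuous_real continuous_intros continuous_on_compose2[OF cG[OF that]]) (auto intro!: sub simp: node_Suc_le)
  have cK: "cis (node K K) = 1" using K by (simp add: node_self)
  have QK: "Q' K r = Q' 0 r" for r using K by (simp add: Q'_def cK)
  have QQ': "Q m = Q' m" if "m < K" for m using that by (simp add: Q_def[abs_def] Q'_def[abs_def])
  have iQ': "Q' m integrable_on {a..b}" if "m \<le> K" for m
  proof (cases "m = K")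
    case True
    have "Q' K = Q 0" using QK QQ'[OF K] by auto
    thus ?thesis using True iQ[OF K] by simp
  qed (use that iQ QQ' in force)
  have "circ_sum K G b - circ_sum K G a = (\<Sum>m<K. integral {a..b} (\<lambda>r. P m r - Q m r))"
    unfolding circ_sum_def sum_subtractf[symmetric]
  proof (intro sum.cong refl)
    fix m assume "m \<in> {..<K}"
    hence m: "m < K" by simp
    show "integral {node K m..node K (Suc m)} (\<lambda>\<theta>. G m (of_real b * cis \<theta>)) -
         integral {node K m..node K (Suc m)} (\<lambda>\<theta>. G m (of_real a * cis \<theta>)) = integral {a..b} (\<lambda>r. P m r - Q m r)"
      using arc_annulus[OF hol[OF m] op[OF m] sub[OF m] ab node_Suc_le]
      by (simp add: P_def Q_def diff_divide_distrib)
  qed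
  also have "\<dots> = (\<Sum>m<K. integral {a..b} (P m) - integral {a..b} (Q' m))"
    by (intro sum.cong refl) (simp add: QQ' integral_diff iP iQ')
  also have "\<dots> = (\<Sum>m<K. integral {a..b} (P m)) - (\<Sum>m<K. integral {a..b} (Q' m))"
    by (rule sum_subtractf)
  also have "(\<Sum>m<K. integral {a..b} (Q' m)) = (\<Sum>m<K. integral {a..b} (Q' (Suc m)))"
  proof -
    have "(\<Sum>m<Suc K. integral {a..b} (Q' m)) = integral {a..b} (Q' 0) + (\<Sum>m<K. integral {a..b} (Q' (Suc m)))"
      by (rule sum.lessThan_Suc_shift)
    moreover have "Q' K = Q' 0" using QK by auto
    ultimately show ?thesis by simp
  qed
  also have "(\<Sum>m<K. integral {a..b} (P m)) - (\<Sum>m<K. integral {a..b} (Q' (Suc m)))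
      = (\<Sum>m<K. integral {a..b} (\<lambda>r. P m r - Q' (Suc m) r))"
    by (subst sum_subtractf[symmetric], intro sum.cong refl integral_diff[symmetric] iP iQ') auto
  also have "norm \<dots> \<le> (\<Sum>m<K. integral {a..b} (\<lambda>r. d r / r))"
  proof (rule sum_norm_le, rule integral_norm_bound_integral)
    fix m assume m: "m \<in> {..<K}"
    show "(\<lambda>r. P m r - Q' (Suc m) r) integrable_on {a..b}"
      using m by (intro integrable_diff iP iQ') auto
    show "(\<lambda>r. d r / r) integrable_on {a..b}"
      using ab by (intro integrable_continuous_real continuous_intros cd) auto
    fix r assume r: "r \<in> {a..b}"
    have "norm (P m r - Q' (Suc m) r) = norm (G m (of_real r * cis (node K (Suc m))) - G (Suc m mod K) (of_real r * cis (node K (Suc m)))) / r"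
      unfolding P_def Q'_def diff_divide_distrib[symmetric] using r ab by (simp add: norm_divide norm_mult)
    also have "\<dots> \<le> d r / r" using d[of m r] r m ab by (intro divide_right_mono) auto
    finally show "norm (P m r - Q' (Suc m) r) \<le> d r / r" .
  qed
  finally show ?thesis by simp
qed

text \<open>A kernel given by one global formula has no jumps, so \<open>circ_sum_annulus_le\<close>
  applies with d = 0 as long as the annulus avoids |z|.\<close>

lemma circ_sum_kernel_const:
  assumes K: "K > 0" and ab: "0 < a" "a \<le> b" and z: "norm z < a \<or> b < norm z"
  shows "circ_sum K (\<lambda>m u. u / (u - z)) b = circ_sum K (\<lambda>m u. u / (u - z)) a"
proof -
  have "norm (circ_sum K (\<lambda>m u. u / (u - z)) b - circ_sum K (\<lambda>m u. u / (u - z)) a) \<le> real K * integral {a..b} (\<lambda>r. 0 / r)"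
    by (rule circ_sum_annulus_le[OF K ab, where U="\<lambda>_. - {z}"])
       (use z ab in \<open>auto intro!: holomorphic_intros simp: norm_mult\<close>)
  thus ?thesis by simp
qed

lemma circ_sum_const:
  fixes c :: complex
  assumes "K > 0" shows "circ_sum K (\<lambda>m u. c) r = 2 * pi * c"
proof -
  have "circ_sum K (\<lambda>m u. c) r = (\<Sum>m<K. of_real (2 * pi / real K) * c)"
    unfolding circ_sum_def
    by (intro sum.cong refl) (simp add: node_Suc_le node_step[unfolded diff_eq_eq] scaleR_conv_of_real)
  thus ?thesis using assms by simp
qed

text \<open>By constancy in the radius the value can be computed at an extreme radius: for |z| < r
  the kernel tends to 1 as the radius grows, for |z| > r it tends to 0 as the radius
  shrinks.\<close>

lemma circ_sum_kernel:
  assumes K: "K > 0" and r: "r > 0"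
  shows "norm z < r \<Longrightarrow> circ_sum K (\<lambda>m u. u / (u - z)) r = 2 * pi"
    and "r < norm z \<Longrightarrow> circ_sum K (\<lambda>m u. u / (u - z)) r = 0"
proof -
  have ac: "arc_cont K (\<lambda>m u. u / (u - z)) b" if "b > 0" "b \<noteq> norm z" for b
    by (rule arc_cont_holomorphic[where U="\<lambda>_. - {z}"]) (use that in \<open>auto intro!: holomorphic_intros simp: norm_mult\<close>)
  have ac1: "arc_cont K (\<lambda>m u. c) b" for b c by (simp add: arc_cont_def)
  {
    assume z: "norm z < r"
    let ?d = "circ_sum K (\<lambda>m u. u / (u - z)) r - 2 * pi"
    have le: "norm ?d \<le> 2 * pi * (norm z / (b - norm z))" if b: "b \<ge> r" for b
    proof -
      have "?d = circ_sum K (\<lambda>m u. u / (u - z) - 1) b"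
        using circ_sum_diff[OF ac[of b] ac1[of 1 b]] circ_sum_kernel_const[OF K r b disjI1[OF z]] b z r
          circ_sum_const[OF K, of 1]
        by simp
      also have "norm \<dots> \<le> 2 * pi * (norm z / (b - norm z))"
      proof (rule circ_sum_norm_le[OF K])
        show "arc_cont K (\<lambda>m u. u / (u - z) - 1) b"
          by (rule arc_cont_holomorphic[where U="\<lambda>_. - {z}"]) (use b r z in \<open>auto intro!: holomorphic_intros simp: norm_mult\<close>)
        fix m \<theta>
        let ?u = "complex_of_real b * cis \<theta>"
        have nu: "norm ?u = b" using b r by (simp add: norm_mult)
        have ne: "?u \<noteq> z" using nu b z by auto
        have "norm (?u / (?u - z) - 1) = norm z / norm (?u - z)"
          using ne by (simp add: field_simps flip: norm_divide)
        also have "\<dots> \<le> norm z / (b - norm z)"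
          using norm_triangle_ineq2[of ?u z] nu b z by (intro divide_left_mono mult_pos_pos) auto
        finally show "norm (?u / (?u - z) - 1) \<le> norm z / (b - norm z)" .
      qed
      finally show ?thesis .
    qed
    have "((\<lambda>b. 2 * pi * (norm z / (b - norm z))) \<longlongrightarrow> 2 * pi * 0) at_top"
    proof (intro tendsto_intros tendsto_divide_0[OF tendsto_const] filterlim_at_top_imp_at_infinity)
      show "filterlim (\<lambda>b. b - norm z) at_top at_top"
        using filterlim_tendsto_add_at_top[OF tendsto_const filterlim_ident, of "- norm z"] by simp
    qed
    hence "norm ?d \<le> 2 * pi * 0"
      by (rule tendsto_lowerbound) (use le in \<open>auto simp: eventually_at_top_linorder\<close>)
    thus "circ_sum K (\<lambda>m u. u / (u - z)) r = 2 * pi" by simp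
  }
  {
    assume z: "r < norm z"
    let ?d = "circ_sum K (\<lambda>m u. u / (u - z)) r"
    have le: "norm ?d \<le> 2 * pi * (b / (norm z - b))" if b: "0 < b" "b \<le> r" for b
    proof -
      have "?d = circ_sum K (\<lambda>m u. u / (u - z)) b"
        using circ_sum_kernel_const[OF K b] z by simp
      also have "norm \<dots> \<le> 2 * pi * (b / (norm z - b))"
      proof (rule circ_sum_norm_le[OF K ac])
        fix m \<theta>
        let ?u = "complex_of_real b * cis \<theta>"
        have nu: "norm ?u = b" using b r by (simp add: norm_mult)
        have ne: "?u \<noteq> z" using nu b z by auto
        show "norm (?u / (?u - z)) \<le> b / (norm z - b)"
          unfolding norm_divide nu using norm_triangle_ineq2[of z ?u] nu b z
          by (intro divide_left_mono mult_pos_pos) (auto simp: norm_minus_commute)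
      qed (use b z in auto)
      finally show ?thesis .
    qed
    have "((\<lambda>b. 2 * pi * (b / (norm z - b))) \<longlongrightarrow> 2 * pi * (0 / (norm z - 0))) (at_right 0)"
      using z r by (intro tendsto_intros) auto
    hence "norm ?d \<le> 2 * pi * (0 / (norm z - 0))"
      by (rule tendsto_lowerbound) (use le r in \<open>auto simp: eventually_at_right_field intro!: exI[of _ r]\<close>)
    thus "circ_sum K (\<lambda>m u. u / (u - z)) r = 0" by simp
  }
qed

section \<open>Coverings by cones and the Ramis--Sibuya theorem\<close>

lemma cis_add_2pi_int: "cis (x + 2 * pi * of_int k) = cis x"
  by (simp add: cis_mult[symmetric] complex_eq_iff cos_int_2pin sin_int_2pin)

text \<open>Converts the cosine condition of \<open>adapted\<close>, which is blind to the choice of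
  the argument, into nearness of angles: reduce x to [-pi, pi], where cos decreases strictly in the
  absolute value.\<close>

lemma cos_gt_imp_near:
  fixes x g :: real
  assumes "cos g < cos x" "0 \<le> g" "g \<le> pi"
  shows "\<exists>k::int. \<bar>x + 2 * pi * of_int k\<bar> < g"
proof -
  define k where "k = - \<lfloor>(x + pi) / (2 * pi)\<rfloor>"
  define y where "y = x + 2 * pi * of_int k"
  have f1: "of_int \<lfloor>(x + pi) / (2 * pi)\<rfloor> \<le> (x + pi) / (2 * pi)" "(x + pi) / (2 * pi) < of_int \<lfloor>(x + pi) / (2 * pi)\<rfloor> + 1"
    by linarith+
  from f1(1) have "of_int \<lfloor>(x + pi) / (2 * pi)\<rfloor> * (2 * pi) \<le> x + pi"
    by (subst (asm) pos_le_divide_eq) auto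
  moreover from f1(2) have "x + pi < (of_int \<lfloor>(x + pi) / (2 * pi)\<rfloor> + 1) * (2 * pi)"
    by (subst (asm) pos_divide_less_eq) auto
  ultimately have y: "\<bar>y\<bar> \<le> pi" unfolding y_def k_def by (simp add: algebra_simps abs_le_iff)
  have "cos \<bar>y\<bar> = cos x"
    using cis_add_2pi_int[of x k] unfolding y_def complex_eq_iff cis.sel by (metis abs_of_neg abs_of_nonneg cos_minus linorder_not_le)
  hence "cos g < cos \<bar>y\<bar>" using assms by simp
  hence "\<bar>y\<bar> < g" using y assms by (subst (asm) cos_mono_less_eq) auto
  thus ?thesis unfolding y_def by blast
qed

text \<open>Law of cosines; completing the square in t leaves (r sin g)^2, the squared distance of a
  point to a ray at angle g. The bound is free of t, hence of |z| when the ray carries z.\<close>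

lemma norm_cis_diff_ge:
  fixes r t :: real
  assumes "cos (\<alpha> - \<theta>) \<le> cos g" "0 \<le> cos g" "0 \<le> sin g" "0 \<le> r" "0 \<le> t"
  shows "r * sin g \<le> norm (of_real r * cis \<alpha> - of_real t * cis \<theta>)"
proof (rule power2_le_imp_le)
  have ring: "(r * c - t * c')\<^sup>2 + (r * s - t * s')\<^sup>2
      = r\<^sup>2 * (s\<^sup>2 + c\<^sup>2) + t\<^sup>2 * (s'\<^sup>2 + c'\<^sup>2) - 2 * r * t * (c * c' + s * s')" for c c' s s' :: real
    by (simp add: power2_eq_square algebra_simps)
  have "(norm (of_real r * cis \<alpha> - of_real t * cis \<theta>))\<^sup>2 = (r * cos \<alpha> - t * cos \<theta>)\<^sup>2 + (r * sin \<alpha> - t * sin \<theta>)\<^sup>2"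
    by (simp add: cmod_power2)
  also have "\<dots> = r\<^sup>2 * ((sin \<alpha>)\<^sup>2 + (cos \<alpha>)\<^sup>2) + t\<^sup>2 * ((sin \<theta>)\<^sup>2 + (cos \<theta>)\<^sup>2) - 2 * r * t * cos (\<alpha> - \<theta>)"
    unfolding cos_diff by (rule ring)
  also have "\<dots> = r\<^sup>2 + t\<^sup>2 - 2 * (r * t) * cos (\<alpha> - \<theta>)" by simp
  also have "\<dots> \<ge> r\<^sup>2 + t\<^sup>2 - 2 * (r * t) * cos g"
    using mult_left_mono[OF assms(1), of "2 * (r * t)"] assms by simp
  moreover have "r\<^sup>2 + t\<^sup>2 - 2 * (r * t) * cos g = (r * sin g)\<^sup>2 + (t - r * cos g)\<^sup>2"
  proof -
    have "(r * s)\<^sup>2 + (t - r * c)\<^sup>2 = r\<^sup>2 * (s\<^sup>2 + c\<^sup>2) + t\<^sup>2 - 2 * (r * t) * c" for s c :: real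
      by (simp add: power2_eq_square algebra_simps)
    from this[of "sin g" "cos g"]
    show ?thesis by simp
  qed
  ultimately show "(r * sin g)\<^sup>2 \<le> (norm (of_real r * cis \<alpha> - of_real t * cis \<theta>))\<^sup>2"
    using zero_le_power2[of "t - r * cos g"] by linarith
qed simp

lemma cis_eq_imp: "cis x = cis y \<Longrightarrow> \<exists>k::int. x = y + 2 * pi * of_int k"
proof -
  assume "cis x = cis y"
  hence "cis (x - y) = 1" by (simp add: cis_divide[symmetric])
  hence "cos (x - y) = 1" by (simp add: complex_eq_iff)
  then obtain k :: int where "x - y = of_int k * 2 * pi" using cos_one_2pi_int by blast
  thus ?thesis by (intro exI[of _ k]) (simp add: algebra_simps)
qed

text \<open>The coefficients of the Ramis-Sibuya theorem arise from limits of moments over shrinking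
  circles; this provides these limits together with a rate. Along \<rho>/(k+1) the values form a
  Cauchy sequence.\<close>

lemma lipschitz_limit_0:
  fixes f :: "real \<Rightarrow> complex"
  assumes "\<rho> > 0" "\<And>a b. 0 < a \<Longrightarrow> a \<le> b \<Longrightarrow> b \<le> \<rho> \<Longrightarrow> norm (f b - f a) \<le> C * (b - a)"
  shows "\<exists>L. \<forall>e\<in>{0<..\<rho>}. norm (f e - L) \<le> C * e"
proof -
  have C0: "C \<ge> 0" using assms(2)[of "\<rho>/2" \<rho>] assms(1) norm_ge_zero[of "f \<rho> - f (\<rho>/2)"]
    by (smt (verit) field_sum_of_halves mult_neg_pos)
  define s where "s k = \<rho> / real (Suc k)" for k
  have s0: "0 < s k" "s k \<le> \<rho>" for k using assms(1) by (auto simp: s_def field_simps)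
  have slim: "s \<longlonglongrightarrow> 0" unfolding s_def by (rule LIMSEQ_Suc) (rule lim_const_over_n)
  have le: "norm (f a - f b) \<le> C * (a + b)" if "a \<in> {0<..\<rho>}" "b \<in> {0<..\<rho>}" for a b
  proof -
    have "norm (f a - f b) \<le> C * \<bar>a - b\<bar>"
      using assms(2)[of a b] assms(2)[of b a] that by (cases "a \<le> b") (auto simp: norm_minus_commute)
    also have "\<dots> \<le> C * (a + b)" using that C0 by (intro mult_left_mono) auto
    finally show ?thesis .
  qed
  have "Cauchy (\<lambda>k. f (s k))"
  proof (rule metric_CauchyI)
    fix e :: real assume e: "e > 0"
    have "(\<lambda>k. C * s k) \<longlonglongrightarrow> C * 0" by (intro tendsto_intros slim)
    hence "\<forall>\<^sub>F k in sequentially. C * s k < e / 2" using e by (intro order_tendstoD) auto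
    then obtain M where M: "\<And>k. k \<ge> M \<Longrightarrow> C * s k < e / 2" by (auto simp: eventually_sequentially)
    have "dist (f (s m)) (f (s n)) < e" if "m \<ge> M" "n \<ge> M" for m n
      using le[of "s m" "s n"] s0 M[OF that(1)] M[OF that(2)] by (simp add: dist_norm algebra_simps)
    thus "\<exists>M. \<forall>m\<ge>M. \<forall>n\<ge>M. dist (f (s m)) (f (s n)) < e" by blast
  qed
  then obtain L where L: "(\<lambda>k. f (s k)) \<longlonglongrightarrow> L" using Cauchy_convergent convergent_def by blast
  show ?thesis
  proof (intro exI[of _ L] ballI)
    fix e assume e: "e \<in> {0<..\<rho>}"
    have "(\<lambda>k. norm (f e - f (s k))) \<longlonglongrightarrow> norm (f e - L)" by (intro tendsto_intros L)
    moreover have "(\<lambda>k. C * (e + s k)) \<longlonglongrightarrow> C * (e + 0)" by (intro tendsto_intros slim)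
    ultimately show "norm (f e - L) \<le> C * e"
      using LIMSEQ_le[of _ _ "\<lambda>k. C * (e + s k)" "C * (e + 0)"] le e s0 by (metis (no_types, lifting) add.right_neutral greaterThanAtMost_iff)
  qed
qed

lemma le_of_linear_error:
  fixes x y c :: real
  assumes "e0 > 0" "\<And>e. 0 < e \<Longrightarrow> e < e0 \<Longrightarrow> x \<le> y + c * e"
  shows "x \<le> y"
proof -
  have "((\<lambda>e. y + c * e) \<longlongrightarrow> y + c * 0) (at_right 0)" by (intro tendsto_intros)
  hence "x \<le> y + c * 0"
    by (rule tendsto_lowerbound) (use assms in \<open>auto simp: eventually_at_right_field intro!: exI[of _ e0]\<close>)
  thus ?thesis by simp
qed

section \<open>Covers of the punctured plane by cones and selections of branches\<close>

locale cone_cover =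
  fixes I :: "nat set" and U :: "nat \<Rightarrow> complex set" and K :: nat
  assumes K4: "K \<ge> 4"
    and open_U: "\<And>i. i \<in> I \<Longrightarrow> open (U i)"
    and cone_U: "\<And>i u r. i \<in> I \<Longrightarrow> u \<in> U i \<Longrightarrow> r > 0 \<Longrightarrow> of_real r * u \<in> U i"
    and zero_U: "\<And>i. i \<in> I \<Longrightarrow> 0 \<notin> U i"
    and cover_U: \<comment> \<open>a Lebesgue number: each of the arcs of angle \<open>8\<pi>/K\<close> lies in a single cone\<close>
      "\<And>s. \<exists>i\<in>I. \<forall>t\<in>{s..s + 8 * pi / real K}. cis t \<in> U i"
begin

text \<open>A lower bound for |u - z|/|u| at a switch u of a selection adapted to the direction of
  z, by \<open>norm_cis_diff_ge\<close>; it depends on the cover only.\<close>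

definition gap :: real where "gap = sin (2 * pi / real K)"

definition admissible :: "(nat \<Rightarrow> nat) \<Rightarrow> bool" where
  "admissible s \<longleftrightarrow> (\<forall>m<K. s m \<in> I \<and> (\<forall>t\<in>{node K m..node K (Suc m)}. cis t \<in> U (s m)))"

text \<open>All switches of the selection \<open>s\<close> keep an angular distance of at least \<open>2\<pi>/K\<close> from the direction
  \<open>\<theta>\<close>, so that the Cauchy kernel at a point in this direction is harmless there.\<close>
definition adapted :: "(nat \<Rightarrow> nat) \<Rightarrow> real \<Rightarrow> nat \<Rightarrow> bool" where
  "adapted s \<theta> i \<longleftrightarrow> admissible s \<and> i \<in> I \<and> cis \<theta> \<in> U i \<and>
     (\<forall>m<K. (\<exists>t\<in>{node K m..node K (Suc m)}. cis t = cis \<theta>) \<longrightarrow> s m = i) \<and>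
     (\<forall>m<K. s m \<noteq> s (Suc m mod K) \<longrightarrow> cos (node K (Suc m) - \<theta>) \<le> cos (2 * pi / real K))"

lemma K_pos: "K > 0" using K4 by simp

lemma step_le: "2 * pi / real K \<le> pi / 2"
  using K4 by (simp add: field_simps)

lemma gap_pos: "gap > 0"
proof -
  have "0 < 2 * pi / real K" using K_pos by simp
  thus ?thesis unfolding gap_def using step_le pi_gt_zero by (intro sin_gt_zero) linarith+
qed

lemma cos_step_nonneg: "cos (2 * pi / real K) \<ge> 0"
proof -
  have "0 < 2 * pi / real K" using K_pos by simp
  thus ?thesis using step_le pi_gt_zero by (intro cos_ge_zero) linarith+
qed

lemma polar_in_U: "i \<in> I \<Longrightarrow> cis t \<in> U i \<Longrightarrow> r > 0 \<Longrightarrow> of_real r * cis t \<in> U i"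
  using cone_U by blast

lemma ex_admissible: "\<exists>s. admissible s"
proof -
  have "\<exists>i. i \<in> I \<and> (\<forall>t\<in>{node K m..node K (Suc m)}. cis t \<in> U i)" for m
  proof -
    have "node K (Suc m) \<le> node K m + 8 * pi / real K" using node_step[of K m] by (simp add: field_simps divide_right_mono)
    moreover obtain i where "i \<in> I" "\<forall>t\<in>{node K m..node K m + 8 * pi / real K}. cis t \<in> U i" using cover_U by blast
    ultimately show ?thesis by fastforce
  qed
  thus ?thesis unfolding admissible_def by metis
qed

lemma ex_adapted: "\<exists>s i. adapted s \<theta> i"
proof -
  obtain s0 where s0: "admissible s0" using ex_admissible by blast
  define h where "h = 2 * pi / real K"
  have h0: "h > 0" using K_pos by (simp add: h_def)
  \<comment> \<open>The arc of angle 8 pi / K in \<open>cover_U\<close> has length 4h and is centred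
    at \<theta>. An arc between two nodes has length h, so each one that comes within h of \<theta>
    stays inside this window.\<close>
  obtain i where i: "i \<in> I" "\<And>t. t \<in> {\<theta> - 2 * h..\<theta> + 2 * h} \<Longrightarrow> cis t \<in> U i"
    using cover_U[of "\<theta> - 2 * h"] by (auto simp: h_def)
  \<comment> \<open>Any admissible selection, overridden by i wherever possible: arcs near \<theta>
    all carry i, so no switch occurs within h of \<theta>.\<close>
  define s where "s m = (if \<forall>t\<in>{node K m..node K (Suc m)}. cis t \<in> U i then i else s0 m)" for m
  have adm: "admissible s" using s0 i by (auto simp: admissible_def s_def)
  have near: "s m = i" if "\<bar>t + 2 * pi * of_int k - \<theta>\<bar> \<le> h" "t \<in> {node K m..node K (Suc m)}" for m t and k :: int
  proof -
    have "cis x \<in> U i" if x: "x \<in> {node K m..node K (Suc m)}" for x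
    proof -
      have "\<bar>x - t\<bar> \<le> h" using x \<open>t \<in> _\<close> node_step[of K m] by (auto simp: h_def abs_le_iff)
      hence "x + 2 * pi * of_int k \<in> {\<theta> - 2 * h..\<theta> + 2 * h}" using \<open>\<bar>t + _ - \<theta>\<bar> \<le> h\<close> by auto
      thus ?thesis using i(2) cis_add_2pi_int by metis
    qed
    thus ?thesis by (auto simp: s_def)
  qed
  have "s m = i" if mt: "m < K" "t \<in> {node K m..node K (Suc m)}" "cis t = cis \<theta>" for m t
  proof -
    obtain k :: int where "t = \<theta> + 2 * pi * of_int k" using cis_eq_imp[OF mt(3)] by blast
    thus ?thesis using near[of t "-k" m] mt h0 by simp
  qed
  moreover have "cos (node K (Suc m) - \<theta>) \<le> cos (2 * pi / real K)" if m: "m < K" and ne: "s m \<noteq> s (Suc m mod K)" for m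
  proof (rule ccontr)
    assume "\<not> ?thesis"
    then obtain k :: int where k: "\<bar>node K (Suc m) - \<theta> + 2 * pi * of_int k\<bar> < h"
      using cos_gt_imp_near[of "2 * pi / real K" "node K (Suc m) - \<theta>"] step_le h0 by (auto simp: h_def)
    have "s m = i" by (rule near[of "node K (Suc m)" k]) (use k node_Suc_le in \<open>auto simp: algebra_simps\<close>)
    moreover have "s (Suc m mod K) = i"
    \<comment> \<open>After the last node the next arc starts at angle 0 instead of 2 pi, hence the
      shift from k to k + 1.\<close>
    proof (cases "Suc m = K")
      case True
      have "node K K = 2 * pi" using K_pos by (rule node_self)
      thus ?thesis using True k node_Suc_le[of K 0] by (intro near[of 0 "k + 1"]) (auto simp: algebra_simps)
    next
      case False
      hence "Suc m mod K = Suc m" using m by simp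
      thus ?thesis using k node_Suc_le[of K "Suc m"] by (intro near[of "node K (Suc m)" k]) (auto simp: algebra_simps)
    qed
    ultimately show False using ne by simp
  qed
  moreover have "cis \<theta> \<in> U i" using i(2) h0 by simp
  ultimately show ?thesis unfolding adapted_def using adm i(1) by blast
qed

lemma admissible_arc: "admissible s \<Longrightarrow> m < K \<Longrightarrow> r > 0 \<Longrightarrow> t \<in> {node K m..node K (Suc m)} \<Longrightarrow> of_real r * cis t \<in> U (s m)"
  unfolding admissible_def using polar_in_U by blast

lemma admissible_in: "admissible s \<Longrightarrow> m < K \<Longrightarrow> s m \<in> I"
  unfolding admissible_def by blast

lemma admissible_next:
  assumes "admissible s" "m < K" "r > 0"
  shows "of_real r * cis (node K (Suc m)) \<in> U (s (Suc m mod K))"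
proof (cases "Suc m = K")
  case True
  have "node K K = 2 * pi" using K_pos by (rule node_self)
  thus ?thesis using True admissible_arc[OF assms(1) K_pos assms(3), of 0] node_Suc_le[of K 0] by simp
next
  case False
  thus ?thesis using admissible_arc[OF assms(1), of "Suc m" r "node K (Suc m)"] node_Suc_le[of K "Suc m"] assms by simp
qed

text \<open>If the family were a single holomorphic function, the n-th moment would be 2 pi times
  its n-th Laurent coefficient, the same for all radii. Only the jumps at the switches make it
  depend on the radius.\<close>

lemma moment_annulus_le:
  assumes s: "admissible s" and ab: "0 < a" "a \<le> b" "a' < a" "b < b'"
    and hol: "\<And>i. i \<in> I \<Longrightarrow> F i holomorphic_on U i \<inter> {u. a' < norm u \<and> norm u < b'}"
    and diff: "\<And>i j u. i \<in> I \<Longrightarrow> j \<in> I \<Longrightarrow> u \<in> U i \<Longrightarrow> u \<in> U j \<Longrightarrow> a \<le> norm u \<Longrightarrow> norm u \<le> b \<Longrightarrow> norm (F i u - F j u) \<le> D (norm u)"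
    and cD: "continuous_on {a..b} D"
  shows "norm (circ_sum K (\<lambda>m u. F (s m) u / u ^ n) b - circ_sum K (\<lambda>m u. F (s m) u / u ^ n) a)
    \<le> real K * integral {a..b} (\<lambda>r. D r / r ^ (n + 1))"
proof -
  have op: "open {u::complex. a' < norm u \<and> norm u < b'}"
    by (intro open_Collect_conj open_Collect_less continuous_intros)
  have "norm (circ_sum K (\<lambda>m u. F (s m) u / u ^ n) b - circ_sum K (\<lambda>m u. F (s m) u / u ^ n) a)
    \<le> real K * integral {a..b} (\<lambda>r. (D r / r ^ n) / r)"
  proof (rule circ_sum_annulus_le[OF K_pos ab(1,2), where U="\<lambda>m. U (s m) \<inter> {u. a' < norm u \<and> norm u < b'}"])
    fix m assume m: "m < K"
    have "0 \<notin> U (s m)" using m admissible_in[OF s] zero_U by blast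
    then show "(\<lambda>u. F (s m) u / u ^ n) holomorphic_on U (s m) \<inter> {u. a' < norm u \<and> norm u < b'}"
      using m s by (intro holomorphic_intros hol admissible_in) auto
    show "open (U (s m) \<inter> {u. a' < norm u \<and> norm u < b'})"
      using m s by (intro open_Int op open_U admissible_in)
    fix r assume r: "r \<in> {a..b}"
    show "of_real r * cis t \<in> U (s m) \<inter> {u. a' < norm u \<and> norm u < b'}" if "t \<in> {node K m..node K (Suc m)}" for t
      using admissible_arc[OF s m _ that, of r] r ab by (auto simp: norm_mult)
    let ?u = "of_real r * cis (node K (Suc m))"
    have nu: "norm ?u = r" using r ab by (simp add: norm_mult)
    have "norm (F (s m) ?u - F (s (Suc m mod K)) ?u) \<le> D (norm ?u)"
      by (rule diff) (use m r ab nu K_pos node_Suc_le[of K m] in \<open>auto intro!: admissible_in[OF s] admissible_arc[OF s] admissible_next[OF s]\<close>)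
    thus "norm (F (s m) ?u / ?u ^ n - F (s (Suc m mod K)) ?u / ?u ^ n) \<le> D r / r ^ n"
      unfolding diff_divide_distrib[symmetric] norm_divide norm_power nu using r ab by (intro divide_right_mono) auto
  qed (use ab cD in \<open>auto intro!: continuous_intros\<close>)
  thus ?thesis by (simp add: mult.commute)
qed

text \<open>The Cauchy kernel has its pole at z, which may lie inside the annulus. With c = F i0 z,
  the subtraction of c makes the numerator F (z/u)^N - c vanish at u = z, so the integrand extends
  holomorphically across it; for z outside the annulus c is arbitrary. The subtracted term is common
  to all branches and does not change the jumps, and at a switch the kernel u/(u - z) is at most
  1/gap.\<close>

lemma kernel_annulus_le:
  assumes s: "adapted s \<theta> i0" and z: "z = of_real (norm z) * cis \<theta>" "z \<noteq> 0"
    and ab: "0 < a" "a \<le> b" "a' < a" "b < b'"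
    and hol: "\<And>i. i \<in> I \<Longrightarrow> F i holomorphic_on U i \<inter> {u. a' < norm u \<and> norm u < b'}"
    and diff: "\<And>i j u. i \<in> I \<Longrightarrow> j \<in> I \<Longrightarrow> u \<in> U i \<Longrightarrow> u \<in> U j \<Longrightarrow> a \<le> norm u \<Longrightarrow> norm u \<le> b \<Longrightarrow> norm (F i u - F j u) \<le> D (norm u)"
    and cD: "continuous_on {a..b} D"
    and zab: "norm z < a \<or> b < norm z \<or> (a < norm z \<and> norm z < b \<and> F i0 z = c)"
  shows "norm (circ_sum K (\<lambda>m u. F (s m) u * (z / u) ^ N * (u / (u - z)) - c * (u / (u - z))) b
       - circ_sum K (\<lambda>m u. F (s m) u * (z / u) ^ N * (u / (u - z)) - c * (u / (u - z))) a)
    \<le> real K / gap * norm z ^ N * integral {a..b} (\<lambda>r. D r / r ^ (N + 1))"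
proof -
  let ?A = "{u::complex. a' < norm u \<and> norm u < b'}"
  have adm: "admissible s" and i0: "i0 \<in> I" "cis \<theta> \<in> U i0"
    and own: "\<And>m t. m < K \<Longrightarrow> t \<in> {node K m..node K (Suc m)} \<Longrightarrow> cis t = cis \<theta> \<Longrightarrow> s m = i0"
    and far: "\<And>m. m < K \<Longrightarrow> s m \<noteq> s (Suc m mod K) \<Longrightarrow> cos (node K (Suc m) - \<theta>) \<le> cos (2 * pi / real K)"
    using s by (auto simp: adapted_def)
  have op: "open ?A"
    by (intro open_Collect_conj open_Collect_less continuous_intros)
  define \<phi> where "\<phi> = (\<lambda>u. F i0 u * (z / u) ^ N - c)"
  \<comment> \<open>At u = z the fractions are 0 by the convention for division by 0; the value of
    the holomorphic extension, \<phi>'(z) z, has to be put in by hand.\<close>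
  define G where "G m u = (if u = z \<and> s m = i0 then deriv \<phi> z * u else
     F (s m) u * (z / u) ^ N * (u / (u - z)) - c * (u / (u - z)))" for m u
  \<comment> \<open>Only the branch i0 may pass through z. The other arcs miss the removed point,
    because they do not contain the direction of z or because |z| lies outside [a, b].\<close>
  define V where "V m = (if s m = i0 \<and> a < norm z \<and> norm z < b then U (s m) \<inter> ?A else U (s m) \<inter> ?A - {z})" for m
  have "norm (circ_sum K G b - circ_sum K G a)
    \<le> real K * integral {a..b} (\<lambda>r. (norm z ^ N / gap * (D r / r ^ N)) / r)"
  proof (rule circ_sum_annulus_le[OF K_pos ab(1,2), where U=V])
    fix m assume m: "m < K"
    have z0: "0 \<notin> U (s m)" using m admissible_in[OF adm] zero_U by blast
    have sI: "s m \<in> I" using m admissible_in[OF adm] by blast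
    show "G m holomorphic_on V m"
    proof (cases "s m = i0 \<and> a < norm z \<and> norm z < b")
      case True
      have h\<phi>: "\<phi> holomorphic_on U i0 \<inter> ?A"
        unfolding \<phi>_def using z0 True i0 by (intro holomorphic_intros hol) auto
      have "\<phi> z = 0" using zab True z by (auto simp: \<phi>_def)
      have "(\<lambda>u. (if u = z then deriv \<phi> z else (\<phi> u - \<phi> z) / (u - z)) * u) holomorphic_on U i0 \<inter> ?A"
        by (intro holomorphic_intros pole_lemma_open h\<phi> open_Int op open_U i0)
      also have "(\<lambda>u. (if u = z then deriv \<phi> z else (\<phi> u - \<phi> z) / (u - z)) * u) = G m"
        using True \<open>\<phi> z = 0\<close> by (auto simp: G_def \<phi>_def fun_eq_iff diff_divide_distrib left_diff_distrib)
      finally show ?thesis using True by (simp add: V_def)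
    next
      case False
      have "(\<lambda>u. F (s m) u * (z / u) ^ N * (u / (u - z)) - c * (u / (u - z))) holomorphic_on U (s m) \<inter> ?A - {z}"
        using z0 sI by (intro holomorphic_intros holomorphic_on_subset[OF hol[OF sI]]) auto
      hence "G m holomorphic_on U (s m) \<inter> ?A - {z}"
        by (rule holomorphic_transform) (auto simp: G_def)
      thus ?thesis using False by (auto simp: V_def)
    qed
    show "open (V m)"
      unfolding V_def using sI by (auto intro!: open_Int op open_U open_Diff)
    fix r assume r: "r \<in> {a..b}"
    show "of_real r * cis t \<in> V m" if t: "t \<in> {node K m..node K (Suc m)}" for t
    proof -
      let ?u = "of_real r * cis t"
      have nu: "norm ?u = r" using r ab by (simp add: norm_mult)
      have 1: "?u \<in> U (s m) \<inter> ?A" using admissible_arc[OF adm m _ t, of r] r ab by (auto simp: norm_mult)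
      moreover have "s m = i0 \<and> a < norm z \<and> norm z < b" if "?u = z"
      proof -
        have "cis t = cis \<theta>" using that z nu r ab by (metis nonzero_mult_div_cancel_left norm_eq_zero of_real_eq_0_iff)
        thus ?thesis using own[OF m t] zab that nu r by auto
      qed
      ultimately show ?thesis by (auto simp: V_def)
    qed
    let ?u = "of_real r * cis (node K (Suc m))"
    have nu: "norm ?u = r" using r ab by (simp add: norm_mult)
    have Dn: "norm (F (s m) ?u - F (s (Suc m mod K)) ?u) \<le> D (norm ?u)"
      by (rule diff) (use m r ab nu K_pos node_Suc_le[of K m] in \<open>auto intro!: admissible_in[OF adm] admissible_arc[OF adm] admissible_next[OF adm]\<close>)
    hence D0: "D r \<ge> 0" using nu norm_ge_zero order_trans by metis
    show "norm (G m ?u - G (Suc m mod K) ?u) \<le> norm z ^ N / gap * (D r / r ^ N)"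
    proof (cases "s m = s (Suc m mod K)")
      case True
      hence "G m ?u - G (Suc m mod K) ?u = 0" by (simp add: G_def)
      thus ?thesis using D0 gap_pos r ab by simp
    next
      case False
      have dist: "r * gap \<le> norm (?u - z)"
        unfolding gap_def by (subst z(1), rule norm_cis_diff_ge)
          (use far[OF m False] cos_step_nonneg gap_pos r ab in \<open>auto simp: gap_def\<close>)
      have "r * gap > 0" using r ab gap_pos by auto
      hence ne: "?u \<noteq> z" using dist by auto
      have "G m ?u - G (Suc m mod K) ?u = (F (s m) ?u - F (s (Suc m mod K)) ?u) * (z / ?u) ^ N * (?u / (?u - z))"
        using ne by (simp add: G_def algebra_simps)
      also have "norm \<dots> = norm (F (s m) ?u - F (s (Suc m mod K)) ?u) * (norm z / r) ^ N * (r / norm (?u - z))"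
        by (simp only: norm_mult[of "(F (s m) ?u - F (s (Suc m mod K)) ?u) * (z / ?u) ^ N"]
            norm_mult[of "F (s m) ?u - F (s (Suc m mod K)) ?u"] norm_power norm_divide nu)
      also have "\<dots> \<le> D r * (norm z / r) ^ N * (r / (r * gap))"
        using Dn nu r ab dist D0 \<open>r * gap > 0\<close>
        by (intro mult_mono divide_left_mono) (auto intro!: mult_pos_pos divide_nonneg_nonneg mult_nonneg_nonneg)
      also have "\<dots> = norm z ^ N / gap * (D r / r ^ N)"
        using r ab by (simp add: power_divide field_simps)
      finally show ?thesis .
    qed
  qed (use ab cD gap_pos in \<open>auto intro!: continuous_intros\<close>)
  also have "integral {a..b} (\<lambda>r. (norm z ^ N / gap * (D r / r ^ N)) / r) = norm z ^ N / gap * integral {a..b} (\<lambda>r. D r / r ^ (N + 1))"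
    unfolding integral_mult_right[symmetric] by (intro integral_cong) (simp add: mult_ac)
  also have "circ_sum K G b = circ_sum K (\<lambda>m u. F (s m) u * (z / u) ^ N * (u / (u - z)) - c * (u / (u - z))) b"
    by (rule circ_sum_cong) (use zab ab in \<open>auto simp: G_def norm_mult\<close>)
  also have "circ_sum K G a = circ_sum K (\<lambda>m u. F (s m) u * (z / u) ^ N * (u / (u - z)) - c * (u / (u - z))) a"
    by (rule circ_sum_cong) (use zab ab in \<open>auto simp: G_def norm_mult\<close>)
  finally show ?thesis by (simp add: mult_ac)
qed

end

lemma arc_cont_mult:
  assumes "arc_cont K G r" "r \<ge> 0" "continuous_on (sphere 0 r) h"
  shows "arc_cont K (\<lambda>m u. G m u * h u) r"
  using assms unfolding arc_cont_def
  by (auto intro!: continuous_intros continuous_on_compose2[OF assms(3)] simp: norm_mult)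

lemma arc_cont_cmult: "arc_cont K G r \<Longrightarrow> arc_cont K (\<lambda>m u. z * G m u) r"
  unfolding arc_cont_def by (intro allI impI continuous_on_mult continuous_on_const) auto

lemma arc_cont_diff: "arc_cont K G r \<Longrightarrow> arc_cont K H r \<Longrightarrow> arc_cont K (\<lambda>m u. G m u - H m u) r"
  unfolding arc_cont_def by (auto intro!: continuous_intros)

lemma arc_cont_fun:
  assumes "r \<ge> 0" "continuous_on (sphere 0 r) h"
  shows "arc_cont K (\<lambda>m u. h u) r"
  using assms unfolding arc_cont_def
  by (auto intro!: continuous_intros continuous_on_compose2[OF assms(2)] simp: norm_mult)

lemma norm_sum5:
  fixes a :: complex
  shows "norm (- a - b + c - d + e) \<le> norm a + norm b + norm c + norm d + norm e"
  using norm_triangle_ineq4[of "- a" b] norm_triangle_ineq[of "- a - b" c]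
    norm_triangle_ineq4[of "- a - b + c" d] norm_triangle_ineq[of "- a - b + c - d" e] by simp

lemma norm_sum6:
  fixes a :: complex
  shows "norm (a - b + c - d - e + f) \<le> norm a + norm b + norm c + norm d + norm e + norm f"
  using norm_triangle_ineq4[of a b] norm_triangle_ineq[of "a - b" c] norm_triangle_ineq4[of "a - b + c" d]
    norm_triangle_ineq4[of "a - b + c - d" e] norm_triangle_ineq[of "a - b + c - d - e" f] by simp

text \<open>With q = z/u the factor u/(u - z) is 1/(1 - q), and this is the finite geometric sum. It
  holds for all sizes of q, so it can also be used on circles inside |z|.\<close>

lemma kernel_split:
  fixes u z F :: complex
  assumes "u \<noteq> 0" "u \<noteq> z"
  shows "F * (z / u) ^ N * (u / (u - z)) = F * (u / (u - z)) - (\<Sum>n<N. z ^ n * (F / u ^ n))"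
proof -
  let ?q = "z / u"
  have q: "?q \<noteq> 1" using assms by simp
  have k: "u / (u - z) = 1 / (1 - ?q)" using assms by (simp add: field_simps)
  have "(\<Sum>n<N. z ^ n * (F / u ^ n)) = F * (\<Sum>n<N. ?q ^ n)"
    unfolding sum_distrib_left by (intro sum.cong) (auto simp: power_divide)
  also have "(\<Sum>n<N. ?q ^ n) = (1 - ?q ^ N) / (1 - ?q)"
    using q by (subst sum_gp_strict) (simp only: if_False)
  finally have S: "(\<Sum>n<N. z ^ n * (F / u ^ n)) = F * ((1 - ?q ^ N) / (1 - ?q))" .
  have "F * q ^ N * (1 / (1 - q)) = F * (1 / (1 - q)) - F * ((1 - q ^ N) / (1 - q))" if "q \<noteq> 1" for q :: complex
    by (simp add: diff_divide_distrib right_diff_distrib)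
  from this[OF q] show ?thesis unfolding k S .
qed

section \<open>The Ramis-Sibuya theorem for families that change form at radius \<rho>\<close>

context cone_cover begin

lemma arc_cont_family:
  assumes s: "admissible s" and r: "0 < r" "a' < r" "r < b'"
    and hol: "\<And>i. i \<in> I \<Longrightarrow> F i holomorphic_on U i \<inter> {u. a' < norm u \<and> norm u < b'}"
  shows "arc_cont K (\<lambda>m u. F (s m) u) r"
proof (rule arc_cont_holomorphic[where U="\<lambda>m. U (s m) \<inter> {u. a' < norm u \<and> norm u < b'}"])
  fix m \<theta> assume m: "m < K"
  show "F (s m) holomorphic_on U (s m) \<inter> {u. a' < norm u \<and> norm u < b'}"
    using hol admissible_in[OF s m] .
  assume "\<theta> \<in> {node K m..node K (Suc m)}"
  thus "of_real r * cis \<theta> \<in> U (s m) \<inter> {u. a' < norm u \<and> norm u < b'}"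
    using admissible_arc[OF s m r(1)] r by (auto simp: norm_mult)
qed

text \<open>The family consists of \<open>F\<close> inside \<open>|u| \<le> \<rho>\<close> and of \<open>G\<close> outside; matching them up to \<open>D \<rho>\<close> on the
  circle suffices to integrate up to \<open>R\<close>, so the bounds do not degenerate as \<open>\<rho> \<rightarrow> 0\<close>.
  The remainder formula comes from comparing the kernel \<open>(z/u)^N u/(u - z)\<close> on the circles of radius
  \<open>R\<close>, \<open>\<rho>\<close> and \<open>e \<rightarrow> 0\<close>.\<close>
lemma ramis_sibuya:
  assumes rho: "0 < \<rho>" "\<rho> \<le> R" "0 \<le> \<rho>0" "\<rho>0 < \<rho>" "\<rho> < \<rho>1" "R < R1"
    and holI: "\<And>i. i \<in> I \<Longrightarrow> F i holomorphic_on U i \<inter> {u. norm u < \<rho>1}"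
    and holO: "\<And>i. i \<in> I \<Longrightarrow> G i holomorphic_on U i \<inter> {u. \<rho>0 < norm u \<and> norm u < R1}"
    and dI: "\<And>i j u. i \<in> I \<Longrightarrow> j \<in> I \<Longrightarrow> u \<in> U i \<Longrightarrow> u \<in> U j \<Longrightarrow> norm u \<le> \<rho> \<Longrightarrow> norm (F i u - F j u) \<le> D (norm u)"
    and dO: "\<And>i j u. i \<in> I \<Longrightarrow> j \<in> I \<Longrightarrow> u \<in> U i \<Longrightarrow> u \<in> U j \<Longrightarrow> \<rho> \<le> norm u \<Longrightarrow> norm u \<le> R \<Longrightarrow> norm (G i u - G j u) \<le> D (norm u)"
    and jump: "\<And>i u. i \<in> I \<Longrightarrow> u \<in> U i \<Longrightarrow> norm u = \<rho> \<Longrightarrow> norm (F i u - G i u) \<le> D \<rho>"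
    and Q0: "\<And>i u. i \<in> I \<Longrightarrow> u \<in> U i \<Longrightarrow> norm u \<le> \<rho> \<Longrightarrow> norm (F i u) \<le> Q0"
    and Q: "\<And>i u. i \<in> I \<Longrightarrow> u \<in> U i \<Longrightarrow> norm u = R \<Longrightarrow> norm (G i u) \<le> Q"
    and cD: "continuous_on {0<..R} D"
    and E: "\<And>N. \<exists>E. \<forall>r\<in>{0<..R}. D r \<le> E * r ^ N"
  shows "\<exists>c. (\<forall>n J. (\<forall>e\<in>{0<..<R}. integral {e..R} (\<lambda>r. D r / r ^ (n + 1)) \<le> J) \<longrightarrow>
              norm (c n) \<le> Q / R ^ n + real K * J + D \<rho> / \<rho> ^ n) \<and>
         (\<forall>N J s \<kappa> i z. (\<forall>e\<in>{0<..<R}. integral {e..R} (\<lambda>r. D r / r ^ (N + 1)) \<le> J) \<longrightarrow>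
              (\<forall>r\<in>{0<..R}. D r \<le> s * r ^ N) \<longrightarrow> 0 < \<kappa> \<longrightarrow> \<kappa> < 1 \<longrightarrow> i \<in> I \<longrightarrow> z \<in> U i \<longrightarrow> norm z \<le> \<kappa> * \<rho> \<longrightarrow>
              norm (F i z - (\<Sum>n<N. c n * z ^ n)) \<le> (Q / R ^ N / (1 - \<kappa>) + real K / gap * J + 2 * s / (1 - \<kappa>)) * norm z ^ N)"
proof -
  have R0: "R > 0" using rho by simp
  \<comment> \<open>Nonnegativity of \<open>D\<close> comes from comparing a branch with
    itself.\<close>
  have D0: "D r \<ge> 0" if r: "r \<in> {0<..R}" for r
  proof -
    obtain i where i: "i \<in> I" "cis 0 \<in> U i" using cover_U[of 0] K_pos by fastforce
    have u: "of_real r * cis 0 \<in> U i" using polar_in_U[OF i] r by simp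
    show ?thesis
      using dI[OF i(1) i(1) u u] dO[OF i(1) i(1) u u] r by (cases "r \<le> \<rho>") auto
  qed
  have holI': "F i holomorphic_on U i \<inter> {u. 0 < norm u \<and> norm u < \<rho>1}" if "i \<in> I" for i
    by (rule holomorphic_on_subset[OF holI[OF that]]) auto
  have cDs: "continuous_on {a..b} D" if "0 < a" "b \<le> R" for a b
    by (rule continuous_on_subset[OF cD]) (use that in auto)
  have int: "(\<lambda>r. D r / r ^ n) integrable_on {a..b}" if "0 < a" "b \<le> R" for a b n
    using that by (intro integrable_continuous_real continuous_intros cDs) auto
  have int0: "integral {a..b} (\<lambda>r. D r / r ^ n) \<ge> 0" if "0 < a" "b \<le> R" for a b n
    using that by (intro integral_nonneg int) (auto intro!: divide_nonneg_nonneg D0)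
  have comb: "integral {a..\<rho>} (\<lambda>r. D r / r ^ n) + integral {\<rho>..R} (\<lambda>r. D r / r ^ n) = integral {a..R} (\<lambda>r. D r / r ^ n)"
    if "0 < a" "a \<le> \<rho>" for a n
    using that rho by (intro Henstock_Kurzweil_Integration.integral_combine int) auto
  obtain s0 where s0: "admissible s0" using ex_admissible by blast
  define M where "M s n e = circ_sum K (\<lambda>m u. F (s m) u / u ^ n) e" for s n e
  have acF: "arc_cont K (\<lambda>m u. F (s m) u) r" if "admissible s" "0 < r" "r \<le> \<rho>" for s r
    by (rule arc_cont_family[OF that(1) that(2) that(2) _ holI']) (use that rho in auto)
  have acG: "arc_cont K (\<lambda>m u. G (s m) u) r" if "admissible s" "\<rho> \<le> r" "r \<le> R" for s r
    by (rule arc_cont_family[OF that(1) _ _ _ holO]) (use that rho in auto)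
  have ic: "continuous_on (sphere 0 r) (\<lambda>u::complex. inverse (u ^ n))" if "0 < r" for r n
    using that by (intro continuous_intros) auto
  have acFn: "arc_cont K (\<lambda>m u. F (s m) u / u ^ n) r" if "admissible s" "0 < r" "r \<le> \<rho>" for s r n
    using arc_cont_mult[OF acF[OF that], of "\<lambda>u. inverse (u ^ n)"] ic[of r n] that
    by (simp add: divide_inverse)
  have acGn: "arc_cont K (\<lambda>m u. G (s m) u / u ^ n) r" if "admissible s" "\<rho> \<le> r" "r \<le> R" for s r n
    using arc_cont_mult[OF acG[OF that], of "\<lambda>u. inverse (u ^ n)"] ic[of r n] that rho
    by (simp add: divide_inverse)
  have M_le: "norm (M s n b - M s n a) \<le> real K * integral {a..b} (\<lambda>r. D r / r ^ (n + 1))"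
    if "admissible s" "0 < a" "a \<le> b" "b \<le> \<rho>" for s n a b
    unfolding M_def
    by (rule moment_annulus_le[OF that(1-3) that(2) _ holI' dI]) (use that rho in \<open>auto intro!: cDs\<close>)
  \<comment> \<open>Flatness of \<open>D\<close> to order n + 1 bounds the integrand D r / r^(n+1)
    down to r = 0, so the moment is Lipschitz in the radius and has a limit.\<close>
  have lip: "\<exists>C. \<forall>a b. 0 < a \<longrightarrow> a \<le> b \<longrightarrow> b \<le> \<rho> \<longrightarrow> norm (M s0 n b - M s0 n a) \<le> C * (b - a)" for n
  proof -
    obtain E1 where E1: "\<And>r. r \<in> {0<..R} \<Longrightarrow> D r \<le> E1 * r ^ (n + 1)" using E by metis
    show ?thesis
    proof (intro exI[of _ "real K * E1"] allI impI)
      fix a b assume ab: "0 < a" "a \<le> b" "b \<le> \<rho>"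
      have "integral {a..b} (\<lambda>r. D r / r ^ (n + 1)) \<le> integral {a..b} (\<lambda>r. E1)"
        using ab rho E1 by (intro integral_le int) (auto simp: pos_divide_le_eq simp del: power_Suc)
      hence "integral {a..b} (\<lambda>r. D r / r ^ (n + 1)) \<le> E1 * (b - a)" using ab by (simp add: mult.commute)
      hence "real K * integral {a..b} (\<lambda>r. D r / r ^ (n + 1)) \<le> real K * (E1 * (b - a))" by (intro mult_left_mono) auto
      thus "norm (M s0 n b - M s0 n a) \<le> real K * E1 * (b - a)" using M_le[OF s0 ab, of n] by (simp add: mult.assoc)
    qed
  qed
  then obtain Cl where Cl: "\<And>n a b. 0 < a \<Longrightarrow> a \<le> b \<Longrightarrow> b \<le> \<rho> \<Longrightarrow> norm (M s0 n b - M s0 n a) \<le> Cl n * (b - a)"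
    by metis
  have "\<exists>L. \<forall>e\<in>{0<..\<rho>}. norm (M s0 n e - L) \<le> Cl n * e" for n
    by (rule lipschitz_limit_0[OF rho(1)]) (use Cl in blast)
  then obtain L where L: "\<And>n e. e \<in> {0<..\<rho>} \<Longrightarrow> norm (M s0 n e - L n) \<le> Cl n * e" by metis
  \<comment> \<open>\<open>circ_sum\<close> integrates against d\<theta>, so a moment is 2 pi times
    a coefficient.\<close>
  define c where "c n = L n / (2 * pi)" for n
  have coeff: "norm (c n) \<le> Q / R ^ n + real K * J + D \<rho> / \<rho> ^ n"
    if J: "\<And>e. e \<in> {0<..<R} \<Longrightarrow> integral {e..R} (\<lambda>r. D r / r ^ (n + 1)) \<le> J" for n J
  proof -
    define MG where "MG r = circ_sum K (\<lambda>m u. G (s0 m) u / u ^ n) r" for r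
    have J0: "J \<ge> 0" using J[of "R/2"] int0[of "R/2" R "n+1"] R0 by simp
    have 1: "norm (MG R) \<le> 2 * pi * (Q / R ^ n)"
      unfolding MG_def
    proof (rule circ_sum_norm_le[OF K_pos acGn[OF s0 rho(2)]])
      fix m \<theta> assume m: "m < K" "\<theta> \<in> {node K m..node K (Suc m)}"
      have "norm (G (s0 m) (of_real R * cis \<theta>)) \<le> Q"
        by (rule Q) (use m R0 in \<open>auto intro!: admissible_in[OF s0] admissible_arc[OF s0] simp: norm_mult\<close>)
      thus "norm (G (s0 m) (of_real R * cis \<theta>) / (of_real R * cis \<theta>) ^ n) \<le> Q / R ^ n"
        using R0 by (simp add: norm_divide norm_mult norm_power divide_right_mono)
    qed simp
    have 2: "norm (MG R - MG \<rho>) \<le> real K * integral {\<rho>..R} (\<lambda>r. D r / r ^ (n + 1))"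
      unfolding MG_def
      by (rule moment_annulus_le[OF s0 rho(1,2) rho(4,6) holO dO]) (use rho in \<open>auto intro!: cDs\<close>)
    have 3: "norm (M s0 n \<rho> - MG \<rho>) \<le> 2 * pi * (D \<rho> / \<rho> ^ n)"
    proof -
      have "M s0 n \<rho> - MG \<rho> = circ_sum K (\<lambda>m u. F (s0 m) u / u ^ n - G (s0 m) u / u ^ n) \<rho>"
        unfolding M_def MG_def using rho by (intro circ_sum_diff[symmetric] acFn acGn s0) auto
      also have "norm \<dots> \<le> 2 * pi * (D \<rho> / \<rho> ^ n)"
      proof (rule circ_sum_norm_le[OF K_pos])
        show "arc_cont K (\<lambda>m u. F (s0 m) u / u ^ n - G (s0 m) u / u ^ n) \<rho>"
          using rho by (intro arc_cont_diff acFn acGn s0) auto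
        fix m \<theta> assume m: "m < K" "\<theta> \<in> {node K m..node K (Suc m)}"
        have "norm (F (s0 m) (of_real \<rho> * cis \<theta>) - G (s0 m) (of_real \<rho> * cis \<theta>)) \<le> D \<rho>"
          by (rule jump) (use m rho in \<open>auto intro!: admissible_in[OF s0] admissible_arc[OF s0] simp: norm_mult\<close>)
        thus "norm (F (s0 m) (of_real \<rho> * cis \<theta>) / (of_real \<rho> * cis \<theta>) ^ n - G (s0 m) (of_real \<rho> * cis \<theta>) / (of_real \<rho> * cis \<theta>) ^ n) \<le> D \<rho> / \<rho> ^ n"
          using rho by (simp add: diff_divide_distrib[symmetric] norm_divide norm_mult norm_power divide_right_mono)
      qed
      finally show ?thesis .
    qed
    have "norm (L n) \<le> (2 * pi * (Q / R ^ n) + real K * J + 2 * pi * (D \<rho> / \<rho> ^ n)) + Cl n * e" if e: "0 < e" "e < \<rho>" for e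
    proof -
      have 4: "norm (M s0 n \<rho> - M s0 n e) \<le> real K * integral {e..\<rho>} (\<lambda>r. D r / r ^ (n + 1))"
        using e by (intro M_le s0) auto
      have 5: "norm (M s0 n e - L n) \<le> Cl n * e" using L e by simp
      have 6: "real K * integral {e..\<rho>} (\<lambda>r. D r / r ^ (n + 1)) + real K * integral {\<rho>..R} (\<lambda>r. D r / r ^ (n + 1)) \<le> real K * J"
        unfolding distrib_left[symmetric] using e J[of e] rho comb[of e "n + 1"] by (intro mult_left_mono) auto
      \<comment> \<open>Telescoping from radius 0 outwards: limit to e, e to \<rho>, from
        \<open>F\<close> to \<open>G\<close> at \<rho>, \<rho> to R, and the boundary term on |u| =
        R. These are the origins of the summands of the bound.\<close>
      have "L n = - (M s0 n e - L n) - (M s0 n \<rho> - M s0 n e) + (M s0 n \<rho> - MG \<rho>) - (MG R - MG \<rho>) + MG R" by simp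
      also have "norm \<dots> \<le> norm (M s0 n e - L n) + norm (M s0 n \<rho> - M s0 n e) + norm (M s0 n \<rho> - MG \<rho>) + norm (MG R - MG \<rho>) + norm (MG R)"
        by (rule norm_sum5)
      finally show ?thesis using 1 2 3 4 5 6 by simp
    qed
    hence "norm (L n) \<le> 2 * pi * (Q / R ^ n) + real K * J + 2 * pi * (D \<rho> / \<rho> ^ n)"
      by (rule le_of_linear_error[OF rho(1)])
    also have "\<dots> \<le> 2 * pi * (Q / R ^ n + real K * J + D \<rho> / \<rho> ^ n)"
    proof -
      have "1 * (real K * J) \<le> 2 * pi * (real K * J)" using J0 pi_gt3 by (intro mult_right_mono) auto
      thus ?thesis unfolding distrib_left by linarith
    qed
    finally show ?thesis by (simp add: c_def norm_divide pos_divide_le_eq mult.commute)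
  qed
  have rem: "norm (F i z - (\<Sum>n<N. c n * z ^ n)) \<le> (Q / R ^ N / (1 - \<kappa>) + real K / gap * J + 2 * d / (1 - \<kappa>)) * norm z ^ N"
    if J: "\<And>e. e \<in> {0<..<R} \<Longrightarrow> integral {e..R} (\<lambda>r. D r / r ^ (N + 1)) \<le> J"
      and d: "\<And>r. r \<in> {0<..R} \<Longrightarrow> D r \<le> d * r ^ N" and \<kappa>: "0 < \<kappa>" "\<kappa> < 1" and i: "i \<in> I" "z \<in> U i" "norm z \<le> \<kappa> * \<rho>"
    for N J d \<kappa> i z
  proof -
    have z0: "z \<noteq> 0" using zero_U i by auto
    have J0: "J \<ge> 0" using J[of "R/2"] int0[of "R/2" R "N+1"] R0 by simp
    have zr: "norm z < \<rho>" "0 < norm z" using i(3) \<kappa> rho(1) z0 by (auto intro: le_less_trans)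
    obtain s i0 where ad: "adapted s (Arg z) i0" using ex_adapted by blast
    hence s: "admissible s" and i0: "i0 \<in> I" "cis (Arg z) \<in> U i0" by (auto simp: adapted_def)
    have zp: "z = of_real (norm z) * cis (Arg z)" using rcis_cmod_Arg[of z] by (simp add: rcis_def)
    have zU: "z \<in> U i0" using polar_in_U[OF i0 zr(2)] zp by simp
    define f where "f = F i0 z"
    define h where "h u = (z / u) ^ N * (u / (u - z))" for u
    define k where "k u = u / (u - z)" for u
    have hc: "continuous_on (sphere 0 r) h" and kc: "continuous_on (sphere 0 r) k" if "r > 0" "r \<noteq> norm z" for r
      unfolding h_def k_def using that by (auto intro!: continuous_intros)
    \<comment> \<open>From |z| \<le> \<kappa> \<rho> \<le> \<kappa> |u| follows |u - z| \<ge> (1 -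
      \<kappa>)|u|, the source of the factor 1/(1 - \<kappa>).\<close>
    have hb: "norm (h u) \<le> norm z ^ N / norm u ^ N / (1 - \<kappa>)" if "norm u \<ge> \<rho>" for u
    proof -
      have "norm z \<le> \<kappa> * norm u" using i(3) that \<kappa> by (meson mult_left_mono order_trans less_imp_le)
      hence u1: "(1 - \<kappa>) * norm u \<le> norm (u - z)" using norm_triangle_ineq2[of u z] by (simp add: algebra_simps)
      have u2: "0 < (1 - \<kappa>) * norm u" using that \<kappa> rho(1) by (intro mult_pos_pos) linarith+
      have "norm u / norm (u - z) \<le> norm u / ((1 - \<kappa>) * norm u)"
        by (rule divide_left_mono[OF u1 norm_ge_zero mult_pos_pos[OF less_le_trans[OF u2 u1] u2]])
      also have "\<dots> = 1 / (1 - \<kappa>)" using that rho by auto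
      finally have "(norm z / norm u) ^ N * (norm u / norm (u - z)) \<le> (norm z / norm u) ^ N * (1 / (1 - \<kappa>))"
        by (intro mult_left_mono) auto
      thus ?thesis by (simp add: h_def norm_mult norm_power norm_divide power_divide)
    qed
    \<comment> \<open>The constant f = F i0 z is subtracted so that \<open>kernel_annulus_le\<close>
      can cross |z| between e and \<rho>; between \<rho> and R it is merely carried along.\<close>
    define HF where "HF r = circ_sum K (\<lambda>m u. F (s m) u * (z / u) ^ N * (u / (u - z)) - f * (u / (u - z))) r" for r
    define HG where "HG r = circ_sum K (\<lambda>m u. G (s m) u * (z / u) ^ N * (u / (u - z)) - f * (u / (u - z))) r" for r
    define PF where "PF r = circ_sum K (\<lambda>m u. F (s m) u * h u) r" for r
    define PG where "PG r = circ_sum K (\<lambda>m u. G (s m) u * h u) r" for r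
    define kk where "kk r = circ_sum K (\<lambda>m u. k u) r" for r
    have ack: "arc_cont K (\<lambda>m u. f * k u) r" if "r > 0" "r \<noteq> norm z" for r
      using that by (intro arc_cont_fun continuous_intros kc) auto
    have HF: "HF r = PF r - f * kk r" if "0 < r" "r \<le> \<rho>" "r \<noteq> norm z" for r
    proof -
      have "PF r - f * kk r = circ_sum K (\<lambda>m u. F (s m) u * h u - f * k u) r"
        unfolding PF_def kk_def circ_sum_cmult[symmetric]
        using that by (intro circ_sum_diff[symmetric] ack arc_cont_mult acF s hc) auto
      thus ?thesis by (simp add: HF_def h_def k_def mult.assoc)
    qed
    have HG: "HG r = PG r - f * kk r" if "\<rho> \<le> r" "r \<le> R" for r
    proof -
      have "PG r - f * kk r = circ_sum K (\<lambda>m u. G (s m) u * h u - f * k u) r"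
        unfolding PG_def kk_def circ_sum_cmult[symmetric]
        using that zr rho by (intro circ_sum_diff[symmetric] ack arc_cont_mult acG s hc) auto
      thus ?thesis by (simp add: HG_def h_def k_def mult.assoc)
    qed
    have X1: "norm (HG R - HG \<rho>) \<le> real K / gap * norm z ^ N * integral {\<rho>..R} (\<lambda>r. D r / r ^ (N + 1))"
      unfolding HG_def
      by (rule kernel_annulus_le[OF ad zp z0 rho(1,2) rho(4,6) holO dO]) (use rho zr in \<open>auto intro!: cDs\<close>)
    have X3: "norm (PF \<rho> - PG \<rho>) \<le> 2 * pi * (d * norm z ^ N / (1 - \<kappa>))"
    proof -
      have "PF \<rho> - PG \<rho> = circ_sum K (\<lambda>m u. F (s m) u * h u - G (s m) u * h u) \<rho>"
        unfolding PF_def PG_def using rho zr by (intro circ_sum_diff[symmetric] arc_cont_mult acF acG hc s) auto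
      also have "norm \<dots> \<le> 2 * pi * (d * norm z ^ N / (1 - \<kappa>))"
      proof (rule circ_sum_norm_le[OF K_pos])
        show "arc_cont K (\<lambda>m u. F (s m) u * h u - G (s m) u * h u) \<rho>"
          using rho zr by (intro arc_cont_diff arc_cont_mult acF acG hc s) auto
        fix m \<theta> assume m: "m < K" "\<theta> \<in> {node K m..node K (Suc m)}"
        let ?u = "of_real \<rho> * cis \<theta>"
        have nu: "norm ?u = \<rho>" using rho by (simp add: norm_mult)
        have "norm (F (s m) ?u - G (s m) ?u) \<le> D \<rho>"
          by (rule jump) (use m rho nu in \<open>auto intro!: admissible_in[OF s] admissible_arc[OF s]\<close>)
        also have "\<dots> \<le> d * \<rho> ^ N" using d rho by simp
        finally have "norm (F (s m) ?u - G (s m) ?u) * norm (h ?u) \<le> d * \<rho> ^ N * (norm z ^ N / norm ?u ^ N / (1 - \<kappa>))"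
          using hb[of ?u] nu by (intro mult_mono) (auto intro: order_trans[OF norm_ge_zero])
        also have "\<dots> = d * norm z ^ N / (1 - \<kappa>)" unfolding nu using rho by simp
        finally show "norm (F (s m) ?u * h ?u - G (s m) ?u * h ?u) \<le> d * norm z ^ N / (1 - \<kappa>)"
          by (simp only: left_diff_distrib[symmetric] norm_mult)
      qed
      finally show ?thesis .
    qed
    have X4: "norm (PG R) \<le> 2 * pi * (Q / R ^ N / (1 - \<kappa>) * norm z ^ N)"
      unfolding PG_def
    proof (rule circ_sum_norm_le[OF K_pos])
      show "arc_cont K (\<lambda>m u. G (s m) u * h u) R"
        using rho zr by (intro arc_cont_mult acG hc s) auto
      fix m \<theta> assume m: "m < K" "\<theta> \<in> {node K m..node K (Suc m)}"
      let ?u = "of_real R * cis \<theta>"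
      have nu: "norm ?u = R" using R0 by (simp add: norm_mult)
      have "norm (G (s m) ?u) \<le> Q"
        by (rule Q) (use m R0 nu in \<open>auto intro!: admissible_in[OF s] admissible_arc[OF s]\<close>)
      hence "norm (G (s m) ?u) * norm (h ?u) \<le> Q * (norm z ^ N / norm ?u ^ N / (1 - \<kappa>))"
        using hb[of ?u] nu rho by (intro mult_mono) (auto intro: order_trans[OF norm_ge_zero])
      also have "\<dots> = Q / R ^ N / (1 - \<kappa>) * norm z ^ N" unfolding nu by simp
      finally show "norm (G (s m) ?u * h ?u) \<le> Q / R ^ N / (1 - \<kappa>) * norm z ^ N" by (simp only: norm_mult)
    qed
    have kR: "kk R = 2 * pi"
      unfolding kk_def k_def using circ_sum_kernel(1)[OF K_pos R0, of z] zr rho by simp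
    have "\<forall>n. \<exists>E1. \<forall>r\<in>{0<..R}. D r \<le> E1 * r ^ (n + 1)" using E by blast
    from choice[OF this] obtain E1 where E1: "\<And>n r. r \<in> {0<..R} \<Longrightarrow> D r \<le> E1 n * r ^ (n + 1)" by blast
    define CC where "CC = 4 * pi * Q0 / norm z + (\<Sum>n<N. (2 * pi * E1 n + Cl n) * norm z ^ n)"
    \<comment> \<open>The kernel u/(u - z) integrates to 2 pi over |u| = R and to 0 over |u| = e <
      |z|. Comparing the two circles therefore isolates 2 pi f, while on the small circle
      \<open>kernel_split\<close> brings out the moments, whose limits are the
      \<open>L n\<close>.\<close>
    have main: "norm (2 * pi * f - (\<Sum>n<N. L n * z ^ n)) \<le>
        (2 * pi * (Q / R ^ N / (1 - \<kappa>)) + real K / gap * J + 2 * pi * (d / (1 - \<kappa>))) * norm z ^ N + CC * e"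
      if e: "0 < e" "e < norm z / 2" for e
    proof -
      have e': "e < norm z" "e \<le> \<rho>" using e zr by auto
      have X2: "norm (HF \<rho> - HF e) \<le> real K / gap * norm z ^ N * integral {e..\<rho>} (\<lambda>r. D r / r ^ (N + 1))"
        unfolding HF_def
        by (rule kernel_annulus_le[OF ad zp z0 e(1) _ e(1) rho(5) holI' dI]) (use rho zr e' e(1) in \<open>auto intro!: cDs simp: f_def\<close>)
      have ke: "kk e = 0"
        unfolding kk_def k_def using circ_sum_kernel(2)[OF K_pos e(1), of z] e' by simp
      have PFe: "PF e = circ_sum K (\<lambda>m u. F (s m) u * k u) e - (\<Sum>n<N. z ^ n * M s n e)"
      proof -
        have "PF e = circ_sum K (\<lambda>m u. F (s m) u * k u - (\<Sum>n<N. z ^ n * (F (s m) u / u ^ n))) e"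
          unfolding PF_def
        proof (rule circ_sum_cong)
          fix m \<theta>
          let ?u = "complex_of_real e * cis \<theta>"
          have "norm ?u = e" using e by (simp add: norm_mult)
          hence "?u \<noteq> 0" "?u \<noteq> z" using e e' by auto
          from kernel_split[OF this, of "F (s m) ?u" N]
          show "F (s m) ?u * h ?u = F (s m) ?u * k ?u - (\<Sum>n<N. z ^ n * (F (s m) ?u / ?u ^ n))"
            by (simp add: h_def k_def mult.assoc)
        qed
        also have "\<dots> = circ_sum K (\<lambda>m u. F (s m) u * k u) e - circ_sum K (\<lambda>m u. \<Sum>n<N. z ^ n * (F (s m) u / u ^ n)) e"
        proof (rule circ_sum_diff)
          show "arc_cont K (\<lambda>m u. F (s m) u * k u) e"
            using e e' by (intro arc_cont_mult acF s kc) auto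
          show "arc_cont K (\<lambda>m u. \<Sum>n<N. z ^ n * (F (s m) u / u ^ n)) e"
            by (intro arc_cont_sum arc_cont_cmult acFn[OF s e(1) e'(2)]) auto
        qed
        also have "circ_sum K (\<lambda>m u. \<Sum>n<N. z ^ n * (F (s m) u / u ^ n)) e = (\<Sum>n<N. z ^ n * M s n e)"
        proof (subst circ_sum_sum)
          show "arc_cont K (\<lambda>m u. z ^ n * (F (s m) u / u ^ n)) e" for n
            by (intro arc_cont_cmult acFn[OF s e(1) e'(2)])
        qed (simp_all only: M_def circ_sum_cmult finite_lessThan)
        finally show ?thesis .
      qed
      \<comment> \<open>This term vanishes with e: the branches are bounded near 0 and the kernel is
        O(e/|z|).\<close>
      have X5: "norm (circ_sum K (\<lambda>m u. F (s m) u * k u) e) \<le> 4 * pi * Q0 / norm z * e"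
      proof -
        have "norm (circ_sum K (\<lambda>m u. F (s m) u * k u) e) \<le> 2 * pi * (Q0 * (e / (norm z / 2)))"
        proof (rule circ_sum_norm_le[OF K_pos])
          show "arc_cont K (\<lambda>m u. F (s m) u * k u) e"
            using e e' by (intro arc_cont_mult acF s kc) auto
          fix m \<theta> assume m: "m < K" "\<theta> \<in> {node K m..node K (Suc m)}"
          let ?u = "of_real e * cis \<theta>"
          have nu: "norm ?u = e" using e by (simp add: norm_mult)
          have q: "norm (F (s m) ?u) \<le> Q0"
            by (rule Q0) (use m e e' nu in \<open>auto intro!: admissible_in[OF s] admissible_arc[OF s]\<close>)
          have uz: "norm z / 2 \<le> norm (?u - z)"
            using norm_triangle_ineq2[of z ?u] nu e by (simp add: norm_minus_commute)
          have "0 < norm z / 2" using zr by simp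
          hence "norm (k ?u) \<le> e / (norm z / 2)"
            unfolding k_def norm_divide nu using e uz by (intro divide_left_mono mult_pos_pos) linarith+
          thus "norm (F (s m) ?u * k ?u) \<le> Q0 * (e / (norm z / 2))"
            unfolding norm_mult using q by (intro mult_mono) (auto intro: order_trans[OF norm_ge_zero])
        qed
        thus ?thesis by simp
      qed
      \<comment> \<open>The limits \<open>L n\<close> were built with the selection
        \<open>s0\<close>, whereas the one in use is adapted to z. Their moments differ by a
        multiple of D e / e^n = O(e), so the limits are the same.\<close>
      have X6: "norm (M s n e - L n) \<le> (2 * pi * E1 n + Cl n) * e" for n
      proof -
        have "M s n e - M s0 n e = circ_sum K (\<lambda>m u. F (s m) u / u ^ n - F (s0 m) u / u ^ n) e"
          unfolding M_def using e e' by (intro circ_sum_diff[symmetric] acFn s s0) auto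
        also have "norm \<dots> \<le> 2 * pi * (E1 n * e)"
        proof (rule circ_sum_norm_le[OF K_pos])
          show "arc_cont K (\<lambda>m u. F (s m) u / u ^ n - F (s0 m) u / u ^ n) e"
            using e e' by (intro arc_cont_diff acFn s s0) auto
          fix m \<theta> assume m: "m < K" "\<theta> \<in> {node K m..node K (Suc m)}"
          let ?u = "of_real e * cis \<theta>"
          have nu: "norm ?u = e" using e by (simp add: norm_mult)
          have "norm (F (s m) ?u - F (s0 m) ?u) \<le> D (norm ?u)"
            by (rule dI) (use m e e' nu in \<open>auto intro!: admissible_in[OF s] admissible_arc[OF s] admissible_in[OF s0] admissible_arc[OF s0]\<close>)
          also have "\<dots> \<le> E1 n * e ^ (n + 1)" unfolding nu using E1[of e n] e e' rho by simp
          finally have "norm (F (s m) ?u - F (s0 m) ?u) / e ^ n \<le> E1 n * e ^ (n + 1) / e ^ n"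
            using e by (intro divide_right_mono) auto
          thus "norm (F (s m) ?u / ?u ^ n - F (s0 m) ?u / ?u ^ n) \<le> E1 n * e"
            unfolding diff_divide_distrib[symmetric] norm_divide norm_power nu using e by simp
        qed
        finally have "norm (M s n e - M s0 n e) \<le> 2 * pi * (E1 n * e)" .
        moreover have "norm (M s0 n e - L n) \<le> Cl n * e" using L e e' by simp
        ultimately have "norm (M s n e - L n) \<le> 2 * pi * (E1 n * e) + Cl n * e"
          using norm_triangle_ineq[of "M s n e - M s0 n e" "M s0 n e - L n"] by simp
        thus ?thesis by (simp add: algebra_simps)
      qed
      have X7: "norm (\<Sum>n<N. (M s n e - L n) * z ^ n) \<le> (\<Sum>n<N. (2 * pi * E1 n + Cl n) * norm z ^ n) * e"
      proof -
        have "norm (\<Sum>n<N. (M s n e - L n) * z ^ n) \<le> (\<Sum>n<N. ((2 * pi * E1 n + Cl n) * e) * norm z ^ n)"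
          by (rule sum_norm_le) (auto simp: norm_mult norm_power intro!: mult_right_mono X6)
        thus ?thesis by (simp add: sum_distrib_left sum_distrib_right mult_ac)
      qed
      have X12: "real K / gap * norm z ^ N * integral {e..\<rho>} (\<lambda>r. D r / r ^ (N + 1)) +
          real K / gap * norm z ^ N * integral {\<rho>..R} (\<lambda>r. D r / r ^ (N + 1)) \<le> real K / gap * norm z ^ N * J"
        unfolding distrib_left[symmetric] using e e' zr J[of e] rho comb[of e "N + 1"] gap_pos by (intro mult_left_mono) auto
      have "2 * pi * f - (\<Sum>n<N. L n * z ^ n) = PG R - (HG R - HG \<rho>) + (PF \<rho> - PG \<rho>) - (HF \<rho> - HF e)
          - circ_sum K (\<lambda>m u. F (s m) u * k u) e + (\<Sum>n<N. (M s n e - L n) * z ^ n)"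
        unfolding HG[OF rho(2) order_refl] HG[OF order_refl rho(2)] HF[OF rho(1) order_refl less_imp_neq[OF zr(1), symmetric]]
          HF[OF e(1) e'(2) less_imp_neq[OF e'(1)]] PFe ke kR
        by (simp add: sum_subtractf left_diff_distrib right_diff_distrib mult_ac)
      also have "norm \<dots> \<le> norm (PG R) + norm (HG R - HG \<rho>) + norm (PF \<rho> - PG \<rho>) + norm (HF \<rho> - HF e)
          + norm (circ_sum K (\<lambda>m u. F (s m) u * k u) e) + norm (\<Sum>n<N. (M s n e - L n) * z ^ n)"
        by (rule norm_sum6)
      also have "\<dots> \<le> (2 * pi * (Q / R ^ N / (1 - \<kappa>)) + real K / gap * J + 2 * pi * (d / (1 - \<kappa>))) * norm z ^ N + CC * e"
        using X1 X2 X3 X4 X5 X7 X12 unfolding CC_def by (simp add: algebra_simps)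
      finally show ?thesis .
    qed
    have "norm (2 * pi * f - (\<Sum>n<N. L n * z ^ n)) \<le>
        (2 * pi * (Q / R ^ N / (1 - \<kappa>)) + real K / gap * J + 2 * pi * (d / (1 - \<kappa>))) * norm z ^ N"
      by (rule le_of_linear_error[of "norm z / 2", OF _ main]) (use zr in auto)
    also have "\<dots> \<le> 2 * pi * ((Q / R ^ N / (1 - \<kappa>) + real K / gap * J + d / (1 - \<kappa>)) * norm z ^ N)"
    proof -
      have "1 * (real K / gap * J) \<le> 2 * pi * (real K / gap * J)" using J0 pi_gt3 gap_pos by (intro mult_right_mono) auto
      hence "2 * pi * (Q / R ^ N / (1 - \<kappa>)) + real K / gap * J + 2 * pi * (d / (1 - \<kappa>)) \<le>
         2 * pi * (Q / R ^ N / (1 - \<kappa>) + real K / gap * J + d / (1 - \<kappa>))" unfolding distrib_left by linarith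
      from mult_right_mono[OF this, of "norm z ^ N"] show ?thesis by simp
    qed
    also have "2 * pi * f - (\<Sum>n<N. L n * z ^ n) = 2 * pi * (f - (\<Sum>n<N. c n * z ^ n))"
      by (simp add: right_diff_distrib sum_distrib_left c_def)
    also have "norm \<dots> = 2 * pi * norm (f - (\<Sum>n<N. c n * z ^ n))" by (simp add: norm_mult)
    finally have 1: "norm (f - (\<Sum>n<N. c n * z ^ n)) \<le> (Q / R ^ N / (1 - \<kappa>) + real K / gap * J + d / (1 - \<kappa>)) * norm z ^ N"
      by (subst (asm) mult_le_cancel_left_pos) auto
    have d0: "0 \<le> d" using d[of R] D0[of R] R0 by (smt (verit) atLeastAtMost_iff greaterThanAtMost_iff mult_neg_pos zero_less_power)
    \<comment> \<open>So far the value is that of the branch i0 of the adapted selection. Passing to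
      the given branch i costs one more d, which accounts for the factor 2 in
      \<open>2 * d / (1 - \<kappa>)\<close>.\<close>
    have "norm (F i z - f) \<le> D (norm z)"
      unfolding f_def by (rule dI) (use i i0 zU zr in auto)
    also have "\<dots> \<le> d * norm z ^ N" using d[of "norm z"] zr rho by simp
    also have "\<dots> \<le> d / (1 - \<kappa>) * norm z ^ N"
      using d0 \<kappa> mult_left_mono[of "1 - \<kappa>" 1 d] by (intro mult_right_mono) (auto simp: pos_le_divide_eq)
    finally have 2: "norm (F i z - f) \<le> d / (1 - \<kappa>) * norm z ^ N" .
    have "norm (F i z - (\<Sum>n<N. c n * z ^ n)) \<le> norm (F i z - f) + norm (f - (\<Sum>n<N. c n * z ^ n))"
      using norm_triangle_ineq[of "F i z - f" "f - (\<Sum>n<N. c n * z ^ n)"] by simp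
    moreover have "2 * d / (1 - \<kappa>) = d / (1 - \<kappa>) + d / (1 - \<kappa>)" by simp
    ultimately show ?thesis using 1 2 unfolding distrib_right by linarith
  qed
  show ?thesis by (intro exI[of _ c] conjI allI impI) (use coeff rem in blast)+
qed

end

section \<open>Coefficients of asymptotic expansions\<close>

text \<open>Morera's theorem: by Fubini the integral over a triangle moves inside the parameter
  integral, where it vanishes by Cauchy's theorem for each t.\<close>

lemma holomorphic_on_param_integral:
  fixes \<phi> :: "complex \<Rightarrow> real \<Rightarrow> complex"
  assumes S: "open S" and c: "continuous_on (S \<times> {a..b}) (\<lambda>(u,t). \<phi> u t)"
    and h: "\<And>t. t \<in> {a..b} \<Longrightarrow> (\<lambda>u. \<phi> u t) holomorphic_on S"
  shows "(\<lambda>u. integral {a..b} (\<phi> u)) holomorphic_on S"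
proof -
  let ?f = "\<lambda>u. integral {a..b} (\<phi> u)"
  have cf: "continuous_on S ?f"
    using integral_continuous_on_param[of S a b \<phi>] c by simp
  have line: "contour_integral (linepath x y) ?f = integral {a..b} (\<lambda>t. contour_integral (linepath x y) (\<lambda>u. \<phi> u t))"
    if xy: "closed_segment x y \<subseteq> S" for x y
  proof -
    have cc: "continuous_on (cbox (0,a) (1,b)) (\<lambda>(s,t). \<phi> (linepath x y s) t)"
      unfolding split_beta
      by (rule continuous_on_compose2[OF c, of _ "\<lambda>p. (linepath x y (fst p), snd p)", unfolded split_beta fst_conv snd_conv])
         (auto simp: linepath_def cbox_Pair_eq intro!: continuous_intros subsetD[OF xy] linepath_in_path[of _ x y, unfolded linepath_def])
    have "contour_integral (linepath x y) ?f = integral {0..1} (\<lambda>s. integral {a..b} (\<phi> (linepath x y s))) * (y - x)"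
      by (simp add: contour_integral_integral)
    also have "integral {0..1} (\<lambda>s. integral {a..b} (\<phi> (linepath x y s))) = integral {a..b} (\<lambda>t. integral {0..1} (\<lambda>s. \<phi> (linepath x y s) t))"
      using integral_swap_continuous[OF cc] by simp
    also have "\<dots> * (y - x) = integral {a..b} (\<lambda>t. contour_integral (linepath x y) (\<lambda>u. \<phi> u t))"
      by (simp add: contour_integral_integral)
    finally show ?thesis .
  qed
  have cl: "continuous_on {a..b} (\<lambda>t. contour_integral (linepath x y) (\<lambda>u. \<phi> u t))"
    if xy: "closed_segment x y \<subseteq> S" for x y
  proof -
    have cc: "continuous_on ({a..b} \<times> cbox 0 1) (\<lambda>(t,s). \<phi> (linepath x y s) t)"
      unfolding split_beta
      by (rule continuous_on_compose2[OF c, of _ "\<lambda>p. (linepath x y (snd p), fst p)", unfolded split_beta fst_conv snd_conv])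
         (auto simp: linepath_def cbox_Pair_eq intro!: continuous_intros subsetD[OF xy] linepath_in_path[of _ x y, unfolded linepath_def])
    have "continuous_on {a..b} (\<lambda>t. integral (cbox 0 1) (\<lambda>s. \<phi> (linepath x y s) t))"
      by (rule integral_continuous_on_param) (use cc in simp)
    thus ?thesis by (simp add: contour_integral_integral continuous_on_mult_right)
  qed
  have "?f analytic_on S"
  proof (rule Morera_triangle[OF cf S], intro impI)
    fix x y z assume sub: "convex hull {x, y, z} \<subseteq> S"
    have seg: "closed_segment x y \<subseteq> S" "closed_segment y z \<subseteq> S" "closed_segment z x \<subseteq> S"
      using sub by (auto intro!: order_trans[OF _ sub] hull_mono simp: segment_convex_hull)
    let ?I = "\<lambda>x y t. contour_integral (linepath x y) (\<lambda>u. \<phi> u t)"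
    have "contour_integral (linepath x y) ?f + contour_integral (linepath y z) ?f + contour_integral (linepath z x) ?f
       = integral {a..b} (\<lambda>t. ?I x y t + ?I y z t + ?I z x t)"
      unfolding line[OF seg(1)] line[OF seg(2)] line[OF seg(3)]
      by (simp add: integral_add integrable_add integrable_continuous_real cl seg)
    also have "\<dots> = integral {a..b} (\<lambda>t. 0)"
    proof (rule integral_cong)
      fix t assume t: "t \<in> {a..b}"
      have "((\<lambda>u. \<phi> u t) has_contour_integral 0) (linepath x y +++ linepath y z +++ linepath z x)"
        by (rule Cauchy_theorem_triangle) (rule holomorphic_on_subset[OF h[OF t] sub])
      moreover have "(\<lambda>u. \<phi> u t) contour_integrable_on linepath p q" if "closed_segment p q \<subseteq> S" for p q
        by (rule contour_integrable_continuous_linepath) (rule continuous_on_subset[OF holomorphic_on_imp_continuous_on[OF h[OF t]] that])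
      ultimately show "?I x y t + ?I y z t + ?I z x t = 0"
        using has_chain_integral_chain_integral3 seg by (metis contour_integral_join contour_integral_unique add.assoc
            contour_integrable_join pathfinish_join pathfinish_linepath pathstart_join pathstart_linepath valid_path_join valid_path_linepath)
    qed
    finally show "contour_integral (linepath x y) ?f + contour_integral (linepath y z) ?f + contour_integral (linepath z x) ?f = 0"
      by simp
  qed
  thus ?thesis using S analytic_on_open by blast
qed

text \<open>One point of each small modulus is enough: by induction the lower terms cancel, and an
  error of order n + 1 is o(r^n).\<close>

lemma expansion_coeffs_unique:
  fixes c d :: "nat \<Rightarrow> complex"
  assumes e0: "e0 > 0"
    and bd: "\<And>N. \<exists>C. \<forall>r\<in>{0<..e0}. \<exists>z. norm z = r \<and> norm (\<Sum>n<N. (c n - d n) * z ^ n) \<le> C * r ^ N"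
  shows "c n = d n"
proof (induction n rule: less_induct)
  case (less n)
  obtain C where C: "\<And>r. r \<in> {0<..e0} \<Longrightarrow> \<exists>z. norm z = r \<and> norm (\<Sum>m<Suc n. (c m - d m) * z ^ m) \<le> C * r ^ Suc n"
    using bd[of "Suc n"] by blast
  have "norm (c n - d n) \<le> 0 + C * e" if e: "0 < e" "e < e0" for e
  proof -
    obtain z where z: "norm z = e" "norm (\<Sum>m<Suc n. (c m - d m) * z ^ m) \<le> C * e ^ Suc n" using C[of e] e by auto
    have "(\<Sum>m<Suc n. (c m - d m) * z ^ m) = (c n - d n) * z ^ n" using less by simp
    hence "norm (c n - d n) * e ^ n \<le> (C * e) * e ^ n" using z by (simp add: norm_mult norm_power mult_ac)
    thus ?thesis using e by (simp add: mult_le_cancel_right)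
  qed
  hence "norm (c n - d n) \<le> 0" by (rule le_of_linear_error[OF e0])
  thus ?case by simp
qed

text \<open>The N-th term is the difference of two consecutive remainders. As r tends to 0 the
  second one disappears, so the coefficient inherits the constant b exactly, whatever b' is.\<close>

lemma expansion_coeff_le:
  fixes c :: "nat \<Rightarrow> complex"
  assumes e0: "e0 > 0"
    and z: "\<And>r. r \<in> {0<..e0} \<Longrightarrow> \<exists>z. norm z = r \<and> norm (F z - (\<Sum>n<N. c n * z ^ n)) \<le> b * r ^ N
          \<and> norm (F z - (\<Sum>n<Suc N. c n * z ^ n)) \<le> b' * r ^ Suc N"
  shows "norm (c N) \<le> b"
proof (rule le_of_linear_error[OF e0])
  fix e assume e: "0 < e" "e < e0"
  obtain z where z: "norm z = e" "norm (F z - (\<Sum>n<N. c n * z ^ n)) \<le> b * e ^ N"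
     "norm (F z - (\<Sum>n<Suc N. c n * z ^ n)) \<le> b' * e ^ Suc N" using z[of e] e by auto
  have "norm (c N * z ^ N) \<le> b * e ^ N + b' * e ^ Suc N"
    using z(2,3) norm_triangle_ineq4[of "F z - (\<Sum>n<N. c n * z ^ n)" "F z - (\<Sum>n<Suc N. c n * z ^ n)"] by simp
  hence "norm (c N) * e ^ N \<le> (b + b' * e) * e ^ N" using z(1) by (simp add: norm_mult norm_power algebra_simps)
  thus "norm (c N) \<le> b + b' * e" using e by (simp add: mult_le_cancel_right)
qed

text \<open>The coefficients are chosen for each x separately, so their dependence on x is at first
  uncontrolled. They are recovered as uniform limits of (\<Phi> k x - partial sum)/\<eta>_k^n along
  a sequence of parameters, which makes them holomorphic.\<close>

lemma expansion_coeff_holomorphic: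
  fixes \<Phi> :: "nat \<Rightarrow> complex \<Rightarrow> complex" and g :: "nat \<Rightarrow> complex \<Rightarrow> complex"
  assumes S: "open S" and h: "\<And>k. \<Phi> k holomorphic_on S"
    and \<eta>: "\<eta> \<longlonglongrightarrow> 0" "\<And>k. \<eta> k \<noteq> 0"
    and bd: "\<And>N. \<exists>C. \<forall>k. \<forall>x\<in>S. norm (\<Phi> k x - (\<Sum>n<N. g n x * \<eta> k ^ n)) \<le> C * norm (\<eta> k) ^ N"
  shows "g n holomorphic_on S"
proof (induction n rule: less_induct)
  case (less n)
  define f where "f k x = (\<Phi> k x - (\<Sum>m<n. g m x * \<eta> k ^ m)) / \<eta> k ^ n" for k x
  obtain C where C: "\<And>k x. x \<in> S \<Longrightarrow> norm (\<Phi> k x - (\<Sum>m<Suc n. g m x * \<eta> k ^ m)) \<le> C * norm (\<eta> k) ^ Suc n"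
    using bd[of "Suc n"] by blast
  have le: "norm (f k x - g n x) \<le> C * norm (\<eta> k)" if "x \<in> S" for k x
  proof -
    have "f k x - g n x = (\<Phi> k x - (\<Sum>m<Suc n. g m x * \<eta> k ^ m)) / \<eta> k ^ n"
      unfolding f_def using \<eta>(2)[of k] by (simp add: field_simps)
    also have "norm \<dots> \<le> C * norm (\<eta> k) ^ Suc n / norm (\<eta> k) ^ n"
      unfolding norm_divide norm_power using C[OF that, of k] by (intro divide_right_mono) auto
    also have "\<dots> = C * norm (\<eta> k)" using \<eta>(2)[of k] by simp
    finally show ?thesis .
  qed
  have "(\<lambda>k. C * norm (\<eta> k)) \<longlonglongrightarrow> C * 0" by (intro tendsto_intros tendsto_norm_zero \<eta>)
  hence lim: "(\<lambda>k. C * norm (\<eta> k)) \<longlonglongrightarrow> 0" by simp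
  have ul: "uniform_limit S f (g n) sequentially"
  proof (rule uniform_limitI)
    fix e :: real assume "e > 0"
    hence "\<forall>\<^sub>F k in sequentially. C * norm (\<eta> k) < e" using lim by (intro order_tendstoD) auto
    thus "\<forall>\<^sub>F k in sequentially. \<forall>x\<in>S. dist (f k x) (g n x) < e"
      by eventually_elim (use le in \<open>auto simp: dist_norm intro: le_less_trans\<close>)
  qed
  show ?case
  proof (rule holomorphic_uniform_sequence[OF S])
    show "f k holomorphic_on S" for k
      unfolding f_def using less h \<eta>(2) by (intro holomorphic_intros) auto
    fix x assume "x \<in> S"
    then obtain d where "d > 0" "cball x d \<subseteq> S" using S open_contains_cball by blast
    thus "\<exists>d>0. cball x d \<subseteq> S \<and> uniform_limit (cball x d) f (g n) sequentially"
      using uniform_limit_on_subset[OF ul] by blast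
  qed
qed

section \<open>Construction of cone covers\<close>

lemma ex_cone_cover:
  assumes "\<And>i. i \<in> I \<Longrightarrow> open (U i)" "\<And>i u r. i \<in> I \<Longrightarrow> u \<in> U i \<Longrightarrow> r > 0 \<Longrightarrow> of_real r * u \<in> U i"
    and "\<And>i. i \<in> I \<Longrightarrow> 0 \<notin> U i" and cov: "\<And>t. \<exists>i\<in>I. cis t \<in> U i"
  shows "\<exists>K. cone_cover I U K"
proof -
  define B where "B i = {t. cis t \<in> U i}" for i
  have "open (B i)" if "i \<in> I" for i
  proof -
    have "open (cis -` U i)" by (rule open_vimage[OF assms(1)[OF that]]) (intro continuous_intros)
    thus ?thesis by (simp add: B_def vimage_def)
  qed
  \<comment> \<open>Two full turns: a window that starts in [0, 2 pi) and has length at most 2 pi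
    never leaves the interval.\<close>
  moreover have "{0..4 * pi} \<subseteq> \<Union> (B ` I)" "B ` I \<noteq> {}" using cov by (auto simp: B_def)
  ultimately obtain d where d: "d > 0" "\<And>T. T \<subseteq> {0..4 * pi} \<Longrightarrow> diameter T < d \<Longrightarrow> \<exists>X\<in>B ` I. T \<subseteq> X"
    using Lebesgue_number_lemma[of "{0..4 * pi}" "B ` I"] by (metis (no_types, lifting) compact_Icc imageE)
  obtain K0 where K0: "8 * pi / d < real K0" using reals_Archimedean2 by blast
  define K where "K = max 4 K0"
  have K4: "K \<ge> 4" and Kd: "8 * pi / real K < d"
  proof -
    show "K \<ge> 4" by (simp add: K_def)
    have "8 * pi / d < real K" using K0 by (simp add: K_def)
    thus "8 * pi / real K < d" using d(1) \<open>K \<ge> 4\<close> by (simp add: field_simps)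
  qed
  have "cone_cover I U K"
  proof
    fix s :: real
    define k where "k = \<lfloor>s / (2 * pi)\<rfloor>"
    define s' where "s' = s - 2 * pi * of_int k"
    have k: "of_int k \<le> s / (2 * pi)" "s / (2 * pi) < of_int k + 1" unfolding k_def by linarith+
    have "of_int k * (2 * pi) \<le> s" using k(1) by (subst (asm) pos_le_divide_eq) auto
    moreover have "s < (of_int k + 1) * (2 * pi)" using k(2) by (subst (asm) pos_divide_less_eq) auto
    ultimately have s': "0 \<le> s'" "s' < 2 * pi" by (auto simp: s'_def algebra_simps)
    have K2: "8 * pi / real K \<le> 2 * pi" using K4 by (simp add: field_simps)
    have "{s'..s' + 8 * pi / real K} \<subseteq> {0..4 * pi}" using s' K2 by auto
    moreover have "diameter {s'..s' + 8 * pi / real K} < d" using Kd d(1) by simp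
    ultimately obtain i where i: "i \<in> I" "{s'..s' + 8 * pi / real K} \<subseteq> B i" using d(2) by blast
    have "cis t \<in> U i" if "t \<in> {s..s + 8 * pi / real K}" for t
    proof -
      have "t + 2 * pi * of_int (- k) \<in> B i" using i(2) that by (auto simp: s'_def)
      thus ?thesis using cis_add_2pi_int[of t "-k"] by (simp add: B_def)
    qed
    thus "\<exists>i\<in>I. \<forall>t\<in>{s..s + 8 * pi / real K}. cis t \<in> U i" using i(1) by blast
  qed (use assms K4 in auto)
  thus ?thesis by blast
qed

text \<open>Rotation keeps K. The cones for the different l are rotations of one cover, so all their
  Cauchy transforms use the same K arcs and can be subtracted arc by arc.\<close>

lemma cone_cover_rotate:
  assumes "cone_cover I U K"
  shows "cone_cover I (\<lambda>i. {w. w * cis (- \<phi>) \<in> U i}) K"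
proof -
  interpret cone_cover I U K by fact
  show ?thesis
  proof
    show "open {w. w * cis (- \<phi>) \<in> U i}" if "i \<in> I" for i
    proof -
      have "open ((\<lambda>w. w * cis (- \<phi>)) -` U i)" by (rule open_vimage[OF open_U[OF that]]) (intro continuous_intros)
      thus ?thesis by (simp add: vimage_def)
    qed
    show "\<exists>i\<in>I. \<forall>t\<in>{s..s + 8 * pi / real K}. cis t \<in> {w. w * cis (- \<phi>) \<in> U i}" for s
    proof -
      obtain i where i: "i \<in> I" "\<forall>t\<in>{s - \<phi>..s - \<phi> + 8 * pi / real K}. cis t \<in> U i" using cover_U by blast
      have "cis t * cis (- \<phi>) \<in> U i" if "t \<in> {s..s + 8 * pi / real K}" for t
        using i(2)[rule_format, of "t - \<phi>"] that by (simp add: cis_mult)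
      thus ?thesis using i(1) by blast
    qed
  qed (use K4 zero_U cone_U in \<open>auto simp: mult.assoc\<close>)
qed

section \<open>Gevrey estimates\<close>

text \<open>The upper incomplete Gamma function Gamma(a, x).\<close>

definition igam :: "real \<Rightarrow> real \<Rightarrow> real" where
  "igam a x = integral {x..} (\<lambda>t. t powr (a - 1) / exp t)"

lemma gamma_integrand_integrable:
  fixes a x :: real
  assumes "a > 0" "x \<ge> 0" shows "(\<lambda>t. t powr (a - 1) / exp t) integrable_on {x..}"
proof -
  have "(\<lambda>t. t powr (a - 1) / exp t) integrable_on {0..}"
    using Gamma_integral_real[OF assms(1)] by blast
  hence "(\<lambda>t. t powr (a - 1) / exp t) absolutely_integrable_on {0..}"
    by (rule nonnegative_absolutely_integrable_1) auto
  hence "(\<lambda>t. t powr (a - 1) / exp t) absolutely_integrable_on {x..}"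
    by (rule set_integrable_subset) (use assms sets_completionI_sets[of "{x..}" lborel] in auto)
  thus ?thesis by (rule set_lebesgue_integral_eq_integral(1))
qed

lemma igam_nonneg: "a > 0 \<Longrightarrow> x \<ge> 0 \<Longrightarrow> igam a x \<ge> 0"
  unfolding igam_def by (intro integral_nonneg gamma_integrand_integrable) auto

text \<open>On t \<ge> x one has x^b \<le> t^b, so the power goes into the exponent of the
  integrand. This is what turns a factor |X|^m into Gamma((m + n)/p) instead of a product of two
  Gamma values.\<close>

lemma igam_pow_le:
  assumes "a > 0" "b \<ge> 0" "x \<ge> 0"
  shows "x powr b * igam a x \<le> Gamma (a + b)"
proof -
  have "x powr b * igam a x = integral {x..} (\<lambda>t. x powr b * (t powr (a - 1) / exp t))"
    unfolding igam_def by (rule integral_mult_right[symmetric])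
  also have "\<dots> \<le> integral {x..} (\<lambda>t. t powr (a + b - 1) / exp t)"
  proof (rule integral_le)
    show "(\<lambda>t. x powr b * (t powr (a - 1) / exp t)) integrable_on {x..}"
      using gamma_integrand_integrable[OF assms(1,3)] by (rule integrable_on_mult_right)
    show "(\<lambda>t. t powr (a + b - 1) / exp t) integrable_on {x..}"
      using assms by (intro gamma_integrand_integrable) auto
    fix t assume t: "t \<in> {x..}"
    have "x powr b * t powr (a - 1) \<le> t powr b * t powr (a - 1)"
      using t assms by (intro mult_right_mono powr_mono2) auto
    also have "\<dots> = t powr (a + b - 1)" by (simp add: powr_add[symmetric] algebra_simps)
    finally show "x powr b * (t powr (a - 1) / exp t) \<le> t powr (a + b - 1) / exp t"
      by (simp add: divide_right_mono)
  qed
  also have "\<dots> \<le> integral {0..} (\<lambda>t. t powr (a + b - 1) / exp t)"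
    using assms by (intro integral_subset_le gamma_integrand_integrable) auto
  also have "\<dots> = Gamma (a + b)"
    using Gamma_integral_real[of "a + b"] assms by (simp add: integral_unique)
  finally show ?thesis .
qed

lemma igam_le_Gamma: "a > 0 \<Longrightarrow> x > 0 \<Longrightarrow> igam a x \<le> Gamma a"
  using igam_pow_le[of a 0 x] by simp

lemma igam_diff:
  assumes "a > 0" "0 \<le> x" "x \<le> y"
  shows "igam a x - igam a y = integral {x..y} (\<lambda>t. t powr (a - 1) / exp t)"
proof -
  let ?f = "\<lambda>t::real. t powr (a - 1) / exp t"
  have 1: "(?f has_integral igam a y) {y..}"
    unfolding igam_def by (rule integrable_integral, rule gamma_integrand_integrable) (use assms in auto)
  have "?f integrable_on {x..y}"
    by (rule integrable_on_subinterval[OF gamma_integrand_integrable[OF assms(1,2)]]) auto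
  hence 2: "(?f has_integral integral {x..y} ?f) {x..y}" by (rule integrable_integral)
  have "{x..y} \<inter> {y..} = {y}" using assms by auto
  hence "negligible ({x..y} \<inter> {y..})" by simp
  from has_integral_Un[OF 2 1 this] have "(?f has_integral integral {x..y} ?f + igam a y) ({x..y} \<union> {y..})" .
  moreover have "{x..y} \<union> {y..} = {x..}" using assms by auto
  ultimately have "igam a x = integral {x..y} ?f + igam a y"
    unfolding igam_def by (simp add: integral_unique)
  thus ?thesis by simp
qed

lemma igam_has_derivative:
  assumes "a > 0" "x > 0"
  shows "(igam a has_real_derivative - (x powr (a - 1) / exp x)) (at x)"
proof -
  let ?f = "\<lambda>t::real. t powr (a - 1) / exp t"
  have cf: "continuous_on {x/2..2*x} ?f" using assms by (intro continuous_intros) auto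
  have "((\<lambda>y. integral {x/2..y} ?f) has_real_derivative ?f x) (at x within {x/2..2*x})"
    by (rule integral_has_real_derivative[OF cf]) (use assms in auto)
  hence "((\<lambda>y. igam a (x/2) - integral {x/2..y} ?f) has_real_derivative - ?f x) (at x within {x/2..2*x})"
    by (auto intro!: derivative_eq_intros)
  hence "(igam a has_real_derivative - ?f x) (at x within {x/2..2*x})"
    by (rule has_field_derivative_transform_within[of _ _ _ _ 1])
       (use assms igam_diff[OF assms(1), of "x/2"] in \<open>auto simp: algebra_simps\<close>)
  moreover have "at x within {x/2..2*x} = at x"
    using assms by (intro at_within_interior) (auto simp: interior_atLeastAtMost_real)
  ultimately show ?thesis by simp
qed

text \<open>The instance of \<open>igam_pow_le\<close> with first parameter 1, since Gamma(1, x) =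
  exp(-x).\<close>

lemma powr_exp_le_Gamma:
  fixes a x :: real
  assumes "a \<ge> 0" "x > 0"
  shows "x powr a * exp (- x) \<le> Gamma (a + 1)"
proof -
  have i: "((\<lambda>t. exp (- (1 * t))) has_integral exp (- (1 * x)) / 1) {x..}"
    using has_integral_exp_minus_to_infinity[of 1 x] by simp
  have "igam 1 x = integral {x..} (\<lambda>t. exp (- (1 * t)))"
    unfolding igam_def by (rule integral_cong) (use assms in \<open>auto simp: exp_minus inverse_eq_divide\<close>)
  hence "igam 1 x = exp (- x)" using i by (simp add: integral_unique)
  thus ?thesis using igam_pow_le[of 1 a x] assms by (simp add: add.commute)
qed

lemma Gamma_ge_exp: "x \<ge> 1 \<Longrightarrow> Gamma (x::real) \<ge> exp (- 1)"
  using powr_exp_le_Gamma[of "x - 1" 1] by simp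

text \<open>Gamma first decreases to the right of 1, so plain monotonicity fails. For x < 3/2 one
  has Gamma x \<le> Gamma (x + 1) \<le> Gamma 3 = 2, whereas Gamma y \<ge> exp(-1) \<ge> 1/3; hence
  the factor 6.\<close>

lemma Gamma_le_Gamma:
  assumes "1 \<le> x" "x \<le> (y::real)" shows "Gamma x \<le> 6 * Gamma y"
proof (cases "x \<ge> 3/2")
  case True
  have "Gamma x \<le> Gamma y" using Gamma_real_strict_mono[OF True, of y] assms by (cases "x = y") auto
  moreover have "Gamma y > 0" using assms by simp
  ultimately show ?thesis by linarith
next
  case False
  have x0: "x \<notin> \<int>\<^sub>\<le>\<^sub>0" using assms by (auto elim!: nonpos_Ints_cases)
  have "Gamma (x + 1) = x * Gamma x" using Gamma_plus1[OF x0] by simp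
  moreover have "1 * Gamma x \<le> x * Gamma x" using assms by (intro mult_right_mono) auto
  moreover have "Gamma (x + 1) \<le> Gamma 3"
    using Gamma_real_strict_mono[of "x + 1" 3] False assms by simp
  moreover have "Gamma (3::real) = 2" using Gamma_fact[of 2, where 'a=real] by (simp add: numeral_eq_Suc)
  moreover have "exp (- 1) \<le> Gamma y" using Gamma_ge_exp assms by simp
  moreover have "exp (-1) \<ge> 1 / (3::real)" using exp_le by (simp add: exp_minus field_simps)
  ultimately show ?thesis by linarith
qed

lemma Gamma_le_Gamma_plus1:
  fixes x :: real assumes "c > 0" "c * x \<ge> 1" "x > 0"
  shows "Gamma x \<le> c * Gamma (x + 1)"
proof -
  have x0: "x \<notin> \<int>\<^sub>\<le>\<^sub>0" using assms by (auto elim!: nonpos_Ints_cases)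
  have "1 * Gamma x \<le> (c * x) * Gamma x" using assms by (intro mult_right_mono) auto
  thus ?thesis using Gamma_plus1[OF x0] by simp
qed

section \<open>The weights Gamma(n/p + 1) and A^(-n/p)\<close>

definition gev :: "nat \<Rightarrow> nat \<Rightarrow> real" where "gev p n = Gamma (real n / real p + 1)"

lemma gev_pos [simp]: "gev p n > 0" unfolding gev_def by (intro Gamma_real_pos) (simp add: add_nonneg_pos)

lemma gev_nonneg [simp]: "gev p n \<ge> 0" using gev_pos[of p n] by linarith

lemma gev_neq_0 [simp]: "gev p n \<noteq> 0" using gev_pos[of p n] by linarith

lemma gev_mono: "m \<le> n \<Longrightarrow> gev p m \<le> 6 * gev p n"
  unfolding gev_def by (intro Gamma_le_Gamma) (auto simp: divide_right_mono)

lemma gev_add_p: "p \<ge> 1 \<Longrightarrow> gev p (n + p) = (real (n + p) / real p) * gev p n"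
proof -
  assume p: "p \<ge> 1"
  have 1: "real (n + p) / real p = real n / real p + 1" using p by (simp add: field_simps)
  have "real n / real p + 1 \<notin> \<int>\<^sub>\<le>\<^sub>0"
  proof
    assume "real n / real p + 1 \<in> \<int>\<^sub>\<le>\<^sub>0"
    hence "real n / real p + 1 \<le> 0" by (auto elim!: nonpos_Ints_cases)
    moreover have "real n / real p \<ge> 0" by simp
    ultimately show False by linarith
  qed
  from Gamma_plus1[OF this] show ?thesis unfolding gev_def 1 .
qed

text \<open>The weights gain a factor N/p every p steps and so outgrow any geometric sequence. The
  part of the sum with i \<le> N - p is q^p times the sum for N - p, which by
  \<open>gev_add_p\<close> is at most half of the claimed bound once N \<ge> 2 p q^p; the last p
  terms contribute a constant multiple of \<open>gev p N\<close>.\<close>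

lemma gev_geometric_sum:
  assumes p: "p \<ge> 1" and q: "q > 0"
  shows "\<exists>K>0. \<forall>N. (\<Sum>i\<le>N. q ^ (N - i) * gev p i) \<le> K * gev p N"
proof -
  define T where "T N = (\<Sum>i\<le>N. q ^ (N - i) * gev p i)" for N
  define q1 where "q1 = max 1 q"
  define C where "C = real p * q1 ^ p * 6"
  obtain N0 where N0: "2 * (real p * q ^ p) \<le> real N0" using real_arch_simple by blast
  define N1 where "N1 = max N0 p"
  \<comment> \<open>K is at least 2C, so that K/2 + C \<le> K closes the induction; the finite sum
    covers the N below the threshold \<open>N1\<close>, and 1 makes K positive.\<close>
  define K where "K = 2 * C + (\<Sum>N<N1. T N / gev p N) + 1"
  have T0: "T N \<ge> 0" for N unfolding T_def using q by (intro sum_nonneg mult_nonneg_nonneg) auto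
  have C0: "C \<ge> 0" unfolding C_def q1_def by simp
  have K1: "K \<ge> 1" unfolding K_def using C0 T0 by (simp add: sum_nonneg)
  have "T N \<le> K * gev p N" for N
  proof (induction N rule: less_induct)
    case (less N)
    show ?case
    proof (cases "N < N1")
      case True
      have "T N / gev p N \<le> (\<Sum>N<N1. T N / gev p N)"
        using True T0 by (intro member_le_sum) auto
      also have "\<dots> \<le> K" using C0 by (simp add: K_def)
      finally show ?thesis by (simp add: pos_divide_le_eq)
    next
      case False
      define n where "n = N - p"
      have N: "N = n + p" using False by (simp add: n_def N1_def)
      have split: "{..N} = {..n} \<union> {n<..N}" using N by auto
      have "T N = (\<Sum>i\<le>n. q ^ (N - i) * gev p i) + (\<Sum>i\<in>{n<..N}. q ^ (N - i) * gev p i)"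
        unfolding T_def split by (rule sum.union_disjoint) auto
      also have "(\<Sum>i\<le>n. q ^ (N - i) * gev p i) = q ^ p * T n"
        unfolding T_def sum_distrib_left
        by (intro sum.cong refl) (auto simp: N power_add[symmetric] mult.assoc[symmetric] intro!: arg_cong[where f="\<lambda>k. q ^ k"])
      also have "(\<Sum>i\<in>{n<..N}. q ^ (N - i) * gev p i) \<le> (\<Sum>i\<in>{n<..N}. q1 ^ p * (6 * gev p N))"
      proof (intro sum_mono mult_mono)
        fix i assume i: "i \<in> {n<..N}"
        have "q ^ (N - i) \<le> q1 ^ (N - i)" using q by (intro power_mono) (auto simp: q1_def)
        also have "\<dots> \<le> q1 ^ p" using i N by (intro power_increasing) (auto simp: q1_def)
        finally show "q ^ (N - i) \<le> q1 ^ p" .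
        show "gev p i \<le> 6 * gev p N" using i by (intro gev_mono) auto
      qed (auto simp: q1_def)
      also have "\<dots> = C * gev p N" using N by (simp add: C_def)
      also have "q ^ p * T n \<le> q ^ p * (K * gev p n)"
        using less[of n] N p q by (intro mult_left_mono) auto
      also have "\<dots> = (real p * q ^ p / real N) * K * gev p N"
      proof -
        have cancel: "Q * (K * G) = (P * Q / X) * K * (X / P * G)" if "X \<noteq> 0" "P \<noteq> 0" for P Q X G :: real
          using that by (simp only: field_simps) simp
        show ?thesis unfolding N gev_add_p[OF p] by (rule cancel) (use p in auto)
      qed
      also have "\<dots> \<le> (1 / 2) * K * gev p N"
      proof (intro mult_right_mono)
        have "2 * (real p * q ^ p) \<le> real N" using N0 False by (simp add: N1_def)
        thus "real p * q ^ p / real N \<le> 1 / 2" using N p by (simp add: field_simps)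
      qed (use K1 in auto)
      finally have "T N \<le> (K / 2 + C) * gev p N" by (simp add: algebra_simps)
      also have "\<dots> \<le> K * gev p N"
      proof (rule mult_right_mono)
        have "0 \<le> (\<Sum>N<N1. T N / gev p N)" using T0 by (intro sum_nonneg) auto
        thus "K / 2 + C \<le> K" by (simp add: K_def)
      qed simp
      finally show ?thesis .
    qed
  qed
  thus ?thesis using K1 unfolding T_def by (intro exI[of _ K]) auto
qed

definition gw :: "nat \<Rightarrow> real \<Rightarrow> nat \<Rightarrow> real" where "gw p A n = A powr (- real n / real p)"

lemma gw_pos [simp]: "A > 0 \<Longrightarrow> gw p A n > 0" by (simp add: gw_def)

lemma gw_neq_0 [simp]: "A > 0 \<Longrightarrow> gw p A n \<noteq> 0" by (simp add: gw_def)

lemma gw_nonneg [simp]: "gw p A n \<ge> 0" by (simp add: gw_def)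

lemma gw_power: "A > 0 \<Longrightarrow> gw p A n = (A powr (- 1 / real p)) ^ n"
  by (simp add: gw_def powr_powr flip: powr_realpow)

lemma gw_add: "A > 0 \<Longrightarrow> gw p A (m + n) = gw p A m * gw p A n"
  by (simp add: gw_power power_add)

text \<open>The variable t = A/r^p, in which r^(-n) is t^(n/p) up to the constant A^(-n/p). The
  incomplete Gamma functions enter through this substitution.\<close>

lemma tau_powr:
  assumes "A > 0" "r > 0" "p \<ge> 1"
  shows "(A / r ^ p) powr (real n / real p) = 1 / (gw p A n * r ^ n)"
proof -
  have "(r ^ p) powr (real n / real p) = r powr (real p * (real n / real p))"
    using assms by (simp add: powr_powr flip: powr_realpow)
  also have "\<dots> = r ^ n" using assms by (simp add: powr_realpow)
  finally have "(A / r ^ p) powr (real n / real p) = A powr (real n / real p) / r ^ n"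
    using assms by (simp add: powr_divide)
  also have "A powr (real n / real p) = 1 / gw p A n"
    by (simp add: gw_def powr_minus_divide)
  finally show ?thesis by simp
qed

lemma gevrey_pointwise:
  assumes "A > 0" "r > 0" "p \<ge> 1"
  shows "exp (- (A / r ^ p)) \<le> gw p A n * gev p n * r ^ n"
proof -
  have "(A / r ^ p) powr (real n / real p) * exp (- (A / r ^ p)) \<le> gev p n"
    unfolding gev_def using assms by (intro powr_exp_le_Gamma) auto
  hence "exp (- (A / r ^ p)) / (gw p A n * r ^ n) \<le> gev p n"
    unfolding tau_powr[OF assms] by simp
  thus ?thesis using assms by (simp add: pos_divide_le_eq mult_ac)
qed

text \<open>An antiderivative of exp(-A/r^p)/r^(n+1) up to a constant, from the substitution t =
  A/r^p. It serves both for the exact integrals and for the integration by parts in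
  \<open>dgev_integral\<close>.\<close>

lemma igam_tau_derivative:
  assumes A: "A > 0" and r: "r > 0" and p: "p \<ge> 1" and n: "n \<ge> 1"
  shows "((\<lambda>r. igam (real n / real p) (A / r ^ p)) has_real_derivative
            real p / gw p A n * (exp (- (A / r ^ p)) / r ^ (n + 1))) (at r)"
proof -
  define a where "a = real n / real p"
  define x where "x = A / r ^ p"
  have a0: "a > 0" using p n by (simp add: a_def)
  have x0: "x > 0" using A r by (simp add: x_def)
  have "((\<lambda>r. A / r ^ p) has_real_derivative - (real p * x / r)) (at r)"
    using r p by (auto intro!: derivative_eq_intros simp: x_def power_diff field_simps power2_eq_square)
  from DERIV_chain2[OF igam_has_derivative[OF a0 x0, unfolded x_def] this]
  have "((\<lambda>r. igam a (A / r ^ p)) has_real_derivative - (x powr (a - 1) / exp x) * - (real p * x / r)) (at r)"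
    by (simp add: x_def)
  also have "- (x powr (a - 1) / exp x) * - (real p * x / r) = real p * (x powr a) * exp (- x) / r"
    using x0 by (simp add: powr_diff exp_minus field_simps)
  also have "x powr a = 1 / (gw p A n * r ^ n)" unfolding x_def a_def by (rule tau_powr) fact+
  finally show ?thesis by (simp add: a_def x_def mult_ac)
qed

lemma gevrey_integral_eq:
  assumes A: "A > 0" and p: "p \<ge> 1" and n: "n \<ge> 1" and e: "0 < e" "e \<le> R"
  shows "((\<lambda>r. exp (- (A / r ^ p)) / r ^ (n + 1)) has_integral
     gw p A n / real p * (igam (real n / real p) (A / R ^ p) - igam (real n / real p) (A / e ^ p))) {e..R}"
proof -
  have "((\<lambda>r. real p / gw p A n * (exp (- (A / r ^ p)) / r ^ (n + 1))) has_integral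
      (igam (real n / real p) (A / R ^ p) - igam (real n / real p) (A / e ^ p))) {e..R}"
  proof (rule fundamental_theorem_of_calculus[OF e(2)])
    fix r assume "r \<in> {e..R}"
    hence "r > 0" using e by auto
    from igam_tau_derivative[OF A this p n]
    show "((\<lambda>r. igam (real n / real p) (A / r ^ p)) has_vector_derivative
        real p / gw p A n * (exp (- (A / r ^ p)) / r ^ (n + 1))) (at r within {e..R})"
      unfolding has_real_derivative_iff_has_vector_derivative by (rule has_vector_derivative_at_within)
  qed
  from has_integral_mult_right[OF this, of "gw p A n / real p"] show ?thesis
  proof (rule has_integral_eq[rotated])
    have cancel: "G / P * (P / G * x) = x" if "G \<noteq> 0" "P \<noteq> 0" for G P x :: real
      using that by simp
    show "gw p A n / real p * (real p / gw p A n * (exp (- (A / r ^ p)) / r ^ (n + 1))) = exp (- (A / r ^ p)) / r ^ (n + 1)" for r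
      by (rule cancel) (use A p in auto)
  qed
qed

lemma igam_0_gev:
  assumes "p \<ge> 1" "n \<ge> 1" "x > 0" shows "igam (real n / real p) x \<le> real p * gev p n"
proof -
  have "igam (real n / real p) x \<le> Gamma (real n / real p)" using assms by (intro igam_le_Gamma) auto
  also have "\<dots> \<le> real p * gev p n"
    unfolding gev_def by (rule Gamma_le_Gamma_plus1) (use assms in auto)
  finally show ?thesis .
qed

lemma gevrey_integral:
  assumes A: "A > 0" and p: "p \<ge> 1" and n: "n \<ge> 1" and e: "0 < e" "e \<le> R"
  shows "integral {e..R} (\<lambda>r. exp (- (A / r ^ p)) / r ^ (n + 1)) \<le> gw p A n * gev p n"
proof -
  have "integral {e..R} (\<lambda>r. exp (- (A / r ^ p)) / r ^ (n + 1)) =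
    gw p A n / real p * (igam (real n / real p) (A / R ^ p) - igam (real n / real p) (A / e ^ p))"
    using gevrey_integral_eq[OF assms] by (rule integral_unique)
  also have "\<dots> \<le> gw p A n / real p * (real p * gev p n)"
  proof (intro mult_left_mono)
    have "igam (real n / real p) (A / e ^ p) \<ge> 0" using A e p n by (intro igam_nonneg) auto
    thus "igam (real n / real p) (A / R ^ p) - igam (real n / real p) (A / e ^ p) \<le> real p * gev p n"
      using igam_0_gev[OF p n, of "A / R ^ p"] A e by auto
  qed simp
  finally show ?thesis using p by simp
qed

text \<open>For n = 0 the parameter n/p of the incomplete Gamma function would be 0; the crude bound
  exp(-x) \<le> 1/x is enough here.\<close>

lemma gevrey_integral_0:
  fixes A e R :: real
  assumes A: "A > 0" and p: "p \<ge> 1" and e: "0 < e" "e \<le> R"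
  shows "integral {e..R} (\<lambda>r. exp (- (A / r ^ p)) / r) \<le> R ^ p / A"
proof -
  have "integral {e..R} (\<lambda>r. exp (- (A / r ^ p)) / r) \<le> integral {e..R} (\<lambda>r. R ^ (p - 1) / A)"
  proof (rule integral_le)
    show "(\<lambda>r. exp (- (A / r ^ p)) / r) integrable_on {e..R}"
      using e by (intro integrable_continuous_real continuous_intros) auto
    fix r assume r: "r \<in> {e..R}"
    define x where "x = A / r ^ p"
    have x0: "x > 0" using A r e by (simp add: x_def)
    have "x \<le> exp x" using exp_ge_add_one_self[of x] by linarith
    hence "exp (- x) \<le> 1 / x" using x0 by (simp add: exp_minus field_simps)
    hence "exp (- x) / r \<le> (1 / x) / r" using r e by (intro divide_right_mono) auto
    also have "\<dots> = r ^ (p - 1) / A" using r e p A by (simp add: x_def power_diff)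
    also have "\<dots> \<le> R ^ (p - 1) / A" using r e A by (intro divide_right_mono power_mono) auto
    finally show "exp (- (A / r ^ p)) / r \<le> R ^ (p - 1) / A" by (simp add: x_def)
  qed auto
  also have "\<dots> = R ^ (p - 1) / A * (R - e)" using e by simp
  also have "\<dots> \<le> R ^ (p - 1) / A * R" using e A by (intro mult_left_mono) auto
  also have "\<dots> = R ^ p / A" using p by (cases p) auto
  finally show ?thesis .
qed

lemma gevrey_integral_all:
  assumes A: "A > 0" and p: "p \<ge> 1" and R: "R > 0"
  shows "\<exists>K>0. \<forall>n. \<forall>e\<in>{0<..R}. integral {e..R} (\<lambda>r. exp (- (A / r ^ p)) / r ^ (n + 1)) \<le> K * (gw p A n * gev p n)"
proof -
  define K where "K = max 1 (R ^ p / A / (gw p A 0 * gev p 0))"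
  have "integral {e..R} (\<lambda>r. exp (- (A / r ^ p)) / r ^ (n + 1)) \<le> K * (gw p A n * gev p n)" if e: "e \<in> {0<..R}" for n e
  proof (cases "n = 0")
    case True
    have "integral {e..R} (\<lambda>r. exp (- (A / r ^ p)) / r ^ (n + 1)) \<le> R ^ p / A"
      using gevrey_integral_0[OF A p, of e R] e True by simp
    also have "\<dots> = (R ^ p / A / (gw p A 0 * gev p 0)) * (gw p A 0 * gev p 0)" using A by simp
    also have "\<dots> \<le> K * (gw p A 0 * gev p 0)" by (intro mult_right_mono) (auto simp: K_def)
    finally show ?thesis using True by simp
  next
    case False
    have "integral {e..R} (\<lambda>r. exp (- (A / r ^ p)) / r ^ (n + 1)) \<le> 1 * (gw p A n * gev p n)"
      using gevrey_integral[OF A p, of n e R] e False by simp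
    also have "\<dots> \<le> K * (gw p A n * gev p n)" by (intro mult_right_mono) (auto simp: K_def)
    finally show ?thesis .
  qed
  thus ?thesis by (intro exI[of _ K]) (auto simp: K_def)
qed

text \<open>Split at the radius s where A/s^p = \<tau>. Below s the exponent is A/r^p and the
  integral is governed by Gamma(n/p, \<tau>); above s the exponential is the constant exp(-\<tau>)
  and the rest integrates to at most s^(-n) = A^(-n/p) \<tau>^(n/p).\<close>

lemma gevrey_max_integral:
  fixes A \<tau> e \<rho> :: real
  assumes A: "A > 0" and \<tau>: "\<tau> > 0" and p: "p \<ge> 1" and n: "n \<ge> 1" and e: "0 < e" "e \<le> \<rho>"
  shows "integral {e..\<rho>} (\<lambda>r. exp (- max (A / r ^ p) \<tau>) / r ^ (n + 1))
    \<le> gw p A n * (exp (- \<tau>) * \<tau> powr (real n / real p) + igam (real n / real p) \<tau>)"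
proof -
  define f where "f r = exp (- max (A / r ^ p) \<tau>) / r ^ (n + 1)" for r
  define s where "s = (A / \<tau>) powr (1 / real p)"
  have s0: "s > 0" using A \<tau> by (simp add: s_def)
  have "s ^ p = A / \<tau>" using A \<tau> p by (simp add: s_def powr_powr flip: powr_realpow)
  hence sp: "A / s ^ p = \<tau>" using A \<tau> by simp
  \<comment> \<open>The interval is enlarged so that s lies inside it, which saves a distinction of
    cases; the integrand is nonnegative.\<close>
  define e' where "e' = min e (s / 2)"
  define \<rho>' where "\<rho>' = max \<rho> (2 * s)"
  have e': "0 < e'" "e' \<le> e" "e' \<le> s" "s \<le> \<rho>'" "\<rho> \<le> \<rho>'" using e s0 by (auto simp: e'_def \<rho>'_def)
  have int: "f integrable_on {a..b}" if "0 < a" for a b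
    unfolding f_def using that by (intro integrable_continuous_real continuous_intros) auto
  have "integral {e..\<rho>} f \<le> integral {e'..\<rho>'} f"
    using e e' by (intro integral_subset_le int) (auto simp: f_def)
  also have "\<dots> = integral {e'..s} f + integral {s..\<rho>'} f"
    using e' by (intro Henstock_Kurzweil_Integration.integral_combine[symmetric] int) auto
  also have "integral {e'..s} f \<le> integral {e'..s} (\<lambda>r. exp (- (A / r ^ p)) / r ^ (n + 1))"
  proof (rule integral_le[OF int])
    show "(\<lambda>r. exp (- (A / r ^ p)) / r ^ (n + 1)) integrable_on {e'..s}"
      using e' by (intro integrable_continuous_real continuous_intros) auto
  qed (use e' in \<open>auto simp: f_def intro!: divide_right_mono\<close>)
  also have "\<dots> = gw p A n / real p * (igam (real n / real p) \<tau> - igam (real n / real p) (A / e' ^ p))"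
    using gevrey_integral_eq[OF A p n e'(1,3)] unfolding sp by (rule integral_unique)
  also have "\<dots> \<le> gw p A n / real p * igam (real n / real p) \<tau>"
    using igam_nonneg[of "real n / real p" "A / e' ^ p"] e' A p n by (intro mult_left_mono) auto
  also have "\<dots> \<le> gw p A n * igam (real n / real p) \<tau>"
  proof (rule mult_right_mono)
    show "gw p A n / real p \<le> gw p A n"
      using divide_left_mono[of 1 "real p" "gw p A n"] p by simp
  qed (use \<tau> p n in \<open>auto intro!: igam_nonneg\<close>)
  also have "integral {s..\<rho>'} f \<le> integral {s..\<rho>'} (\<lambda>r. exp (- \<tau>) * (1 / r ^ (n + 1)))"
  proof (rule integral_le[OF int])
    show "(\<lambda>r. exp (- \<tau>) * (1 / r ^ (n + 1))) integrable_on {s..\<rho>'}"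
      using s0 by (intro integrable_continuous_real continuous_intros) auto
  qed (use s0 in \<open>auto simp: f_def intro!: divide_right_mono\<close>)
  also have "\<dots> = exp (- \<tau>) * integral {s..\<rho>'} (\<lambda>r. 1 / r ^ (n + 1))" by (rule integral_mult_right)
  also have "integral {s..\<rho>'} (\<lambda>r. 1 / r ^ (n + 1)) \<le> 1 / s ^ n"
  proof -
    have "((\<lambda>r. 1 / r ^ (n + 1)) has_integral (- (1 / (real n * \<rho>' ^ n)) - - (1 / (real n * s ^ n)))) {s..\<rho>'}"
    proof (rule fundamental_theorem_of_calculus[OF e'(4)])
      fix r assume "r \<in> {s..\<rho>'}"
      hence r: "r > 0" using s0 by auto
      have "((\<lambda>r. - (1 / (real n * r ^ n))) has_real_derivative 1 / r ^ (n + 1)) (at r)"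
      proof -
        obtain k where k: "n = Suc k" using n by (cases n) auto
        define c where "c = real n"
        have c0: "c \<noteq> 0" using n by (simp add: c_def)
        have "((\<lambda>r. c * r ^ n) has_real_derivative c * (c * r ^ k)) (at r)"
          using DERIV_cmult[OF DERIV_pow[of n r UNIV], of c] by (simp add: c_def k)
        from DERIV_minus[OF DERIV_inverse_fun[OF this]]
        have "((\<lambda>r. - (1 / (c * r ^ n))) has_real_derivative inverse (c * r ^ n) * (c * (c * r ^ k)) * inverse (c * r ^ n)) (at r)"
          using c0 r by (simp add: inverse_eq_divide)
        also have "inverse (c * r ^ n) * (c * (c * r ^ k)) * inverse (c * r ^ n) = 1 / r ^ (n + 1)"
        proof -
          have "inverse (c * (r * q)) * (c * (c * q)) * inverse (c * (r * q)) = 1 / (r * (r * q))" if "q \<noteq> 0" for q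
            using that c0 r by (simp add: field_simps)
          from this[of "r ^ k"] show ?thesis using r by (simp add: k)
        qed
        finally show ?thesis by (simp add: c_def)
      qed
      thus "((\<lambda>r. - (1 / (real n * r ^ n))) has_vector_derivative 1 / r ^ (n + 1)) (at r within {s..\<rho>'})"
        unfolding has_real_derivative_iff_has_vector_derivative by (rule has_vector_derivative_at_within)
    qed
    hence "integral {s..\<rho>'} (\<lambda>r. 1 / r ^ (n + 1)) = 1 / (real n * s ^ n) - 1 / (real n * \<rho>' ^ n)"
      by (simp add: integral_unique)
    also have "\<dots> \<le> 1 / (real n * s ^ n)" using s0 e' by simp
    also have "\<dots> \<le> 1 / s ^ n" using s0 n by (intro divide_left_mono) auto
    finally show ?thesis .
  qed
  also have "1 / s ^ n = gw p A n * \<tau> powr (real n / real p)"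
    using tau_powr[OF A s0 p, of n] A unfolding sp by simp
  finally show ?thesis unfolding f_def by (simp add: algebra_simps mult_left_mono)
qed

text \<open>The bound that \<open>gevrey_max_integral\<close> gives for the differences of the \<open>g_n\<close>, with \<open>r = 1/|X|\<close>. For
  \<open>n = 0\<close> the incomplete Gamma function is not needed (and \<open>igam 0\<close> would spoil the Gevrey bounds).\<close>
definition dgev :: "nat \<Rightarrow> real \<Rightarrow> nat \<Rightarrow> real \<Rightarrow> real" where
  "dgev p B n r = exp (- (B / r ^ p)) * (B / r ^ p) powr (real n / real p)
     + (if n = 0 then 0 else igam (real n / real p) (B / r ^ p))"

lemma continuous_on_igam: "a > 0 \<Longrightarrow> continuous_on {0<..} (igam a)"
  by (auto intro!: DERIV_isCont[OF igam_has_derivative] continuous_at_imp_continuous_on)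

lemma dgev_continuous:
  assumes "B > 0" "p \<ge> 1" shows "continuous_on {0<..R} (dgev p B n)"
proof -
  have 1: "continuous_on {0<..R} (\<lambda>r. exp (- (B / r ^ p)) * (B / r ^ p) powr (real n / real p))"
    using assms by (intro continuous_intros) auto
  have "continuous_on {0<..R} (\<lambda>r. igam (real n / real p) (B / r ^ p))" if "n \<noteq> 0"
    using assms that by (intro continuous_on_compose2[OF continuous_on_igam] continuous_intros) auto
  thus ?thesis using continuous_on_add[OF 1] 1 by (cases "n = 0") (simp_all add: dgev_def[abs_def])
qed

text \<open>Multiply by x^(m/p), where x = B/r^p: the two parts of \<open>dgev\<close> are then
  bounded by Gamma at (m + n)/p + 1 and at (m + n)/p.\<close>

lemma dgev_pointwise:
  assumes B: "B > 0" and p: "p \<ge> 1" and r: "r > 0"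
  shows "dgev p B n r \<le> (1 + real p) * (gw p B m * gev p (m + n)) * r ^ m"
proof -
  define x where "x = B / r ^ p"
  have x0: "x > 0" using B r by (simp add: x_def)
  define b where "b = real m / real p"
  have xb: "x powr b * (gw p B m * r ^ m) = 1"
    using tau_powr[OF B r p, of m] B r by (simp add: x_def b_def)
  have mn: "real n / real p + b = real (m + n) / real p" by (simp add: b_def add_divide_distrib)
  have 1: "x powr b * (exp (- x) * x powr (real n / real p)) \<le> gev p (m + n)"
  proof -
    have "real (m + n) / real p \<ge> 0" by simp
    from powr_exp_le_Gamma[OF this x0] show ?thesis
      unfolding gev_def mn[symmetric] powr_add by (simp only: mult_ac)
  qed
  have 2: "x powr b * igam (real n / real p) x \<le> real p * gev p (m + n)" if "n \<noteq> 0"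
  proof -
    have "x powr b * igam (real n / real p) x \<le> Gamma (real (m + n) / real p)"
      unfolding mn[symmetric] by (rule igam_pow_le) (use that p x0 in \<open>auto simp: b_def\<close>)
    also have "\<dots> \<le> real p * gev p (m + n)"
      unfolding gev_def by (rule Gamma_le_Gamma_plus1) (use that p in auto)
    finally show ?thesis .
  qed
  have "x powr b * dgev p B n r \<le> (1 + real p) * gev p (m + n)"
  proof (cases "n = 0")
    case True
    have "x powr b * (exp (- x) * x powr (real n / real p)) \<le> gev p (m + n) + real p * gev p (m + n)"
      using 1 by (rule order_trans) simp
    thus ?thesis using True unfolding dgev_def x_def[symmetric] distrib_left distrib_right by simp
  next
    case False
    thus ?thesis using 1 2 unfolding dgev_def x_def[symmetric] distrib_left distrib_right by auto
  qed
  hence "(x powr b * dgev p B n r) * (gw p B m * r ^ m) \<le> ((1 + real p) * gev p (m + n)) * (gw p B m * r ^ m)"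
    using r by (intro mult_right_mono) auto
  also have "(x powr b * dgev p B n r) * (gw p B m * r ^ m) = dgev p B n r"
    using xb by (metis mult.assoc mult.commute mult.left_neutral)
  finally show ?thesis by (simp add: mult_ac)
qed

text \<open>The exponential part reduces to \<open>gevrey_integral\<close> with exponent m + n. The
  part with the incomplete Gamma function is integrated by parts: its derivative in r is again
  exp(-B/r^p)/r^(n+1) up to a constant, and the boundary term at e is bounded uniformly in e by
  \<open>igam_pow_le\<close>.\<close>

lemma dgev_integral:
  assumes B: "B > 0" and p: "p \<ge> 1" and m: "m \<ge> 1" and e: "0 < e" "e \<le> R"
  shows "integral {e..R} (\<lambda>r. dgev p B n r / r ^ (m + 1)) \<le> (1 + 2 * real p) * (gw p B m * gev p (m + n))"
proof -
  define a where "a = real n / real p"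
  have i1: "(\<lambda>r. exp (- (B / r ^ p)) / r ^ (m + n + 1)) integrable_on {e..R}"
    using e by (intro integrable_continuous_real continuous_intros) auto
  have I1: "integral {e..R} (\<lambda>r. exp (- (B / r ^ p)) / r ^ (m + n + 1)) / gw p B n \<le> gw p B m * gev p (m + n)"
    using gevrey_integral[OF B p _ e, of "m + n"] m B by (simp add: gw_add pos_divide_le_eq mult_ac)
  have E1: "exp (- (B / r ^ p)) * (B / r ^ p) powr a / r ^ (m + 1) = exp (- (B / r ^ p)) / r ^ (m + n + 1) / gw p B n"
    if "r \<in> {e..R}" for r
    using tau_powr[OF B _ p, of r n] that e by (simp add: a_def power_add mult_ac)
  have J1: "(\<lambda>r. exp (- (B / r ^ p)) * (B / r ^ p) powr a / r ^ (m + 1)) integrable_on {e..R}"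
    using e B by (intro integrable_continuous_real continuous_intros) auto
  have K1: "integral {e..R} (\<lambda>r. exp (- (B / r ^ p)) * (B / r ^ p) powr a / r ^ (m + 1)) \<le> gw p B m * gev p (m + n)"
  proof -
    have "integral {e..R} (\<lambda>r. exp (- (B / r ^ p)) * (B / r ^ p) powr a / r ^ (m + 1))
        = integral {e..R} (\<lambda>r. exp (- (B / r ^ p)) / r ^ (m + n + 1) / gw p B n)"
      by (intro integral_cong E1)
    thus ?thesis using I1 unfolding integral_divide by simp
  qed
  show ?thesis
  proof (cases "n = 0")
    case True
    have "integral {e..R} (\<lambda>r. dgev p B n r / r ^ (m + 1)) \<le> 1 * (gw p B m * gev p (m + n))"
      using K1 True by (simp add: dgev_def a_def)
    also have "\<dots> \<le> (1 + 2 * real p) * (gw p B m * gev p (m + n))" by (intro mult_right_mono) auto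
    finally show ?thesis .
  next
    case False
    hence n1: "n \<ge> 1" and a0: "a > 0" using p by (auto simp: a_def)
    define P where "P r = igam a (B / r ^ p) / r ^ m" for r
    have ci: "continuous_on {e..R} (\<lambda>r. igam a (B / r ^ p))"
      using e B by (intro continuous_on_compose2[OF continuous_on_igam[OF a0]] continuous_intros) auto
    have J2: "(\<lambda>r. igam a (B / r ^ p) / r ^ (m + 1)) integrable_on {e..R}"
      using e by (intro integrable_continuous_real continuous_intros ci) auto
    have "((\<lambda>r. real p * (exp (- (B / r ^ p)) / r ^ (m + n + 1) / gw p B n) - real m * (igam a (B / r ^ p) / r ^ (m + 1)))
        has_integral (P R - P e)) {e..R}"
    proof (rule fundamental_theorem_of_calculus[OF e(2)])
      fix r assume r: "r \<in> {e..R}"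
      hence r0: "r > 0" using e by auto
      have "(P has_real_derivative ((real p / gw p B n * (exp (- (B / r ^ p)) / r ^ (n + 1))) * r ^ m
           - igam a (B / r ^ p) * (real m * r ^ (m - 1))) / (r ^ m * r ^ m)) (at r)"
        unfolding P_def
        using DERIV_quotient[OF igam_tau_derivative[OF B r0 p n1, folded a_def] DERIV_pow[of m r UNIV]] r0
        by (simp add: power2_eq_square mult_ac)
      also have "((real p / gw p B n * (exp (- (B / r ^ p)) / r ^ (n + 1))) * r ^ m
           - igam a (B / r ^ p) * (real m * r ^ (m - 1))) / (r ^ m * r ^ m) =
         real p * (exp (- (B / r ^ p)) / r ^ (m + n + 1) / gw p B n) - real m * (igam a (B / r ^ p) / r ^ (m + 1))"
      proof -
        have rm: "r ^ m = r ^ (m - 1) * r" using m by (cases m) auto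
        have "(u / g * (x / (rn * r)) * (q * r) - i * (k * q)) / ((q * r) * (q * r)) =
           u * (x / ((q * r) * (rn * r)) / g) - k * (i / ((q * r) * r))" if "q \<noteq> 0" "g \<noteq> 0" "rn \<noteq> 0" for u g x rn q i k :: real
        proof -
          have t1: "u / g * (x / (rn * r)) * (q * r) / ((q * r) * (q * r)) = u * (x / ((q * r) * (rn * r)) / g)"
            using that r0 by (simp add: divide_simps)
          have t2: "i * (k * q) / ((q * r) * (q * r)) = k * (i / ((q * r) * r))"
            using that r0 by (simp add: divide_simps)
          show ?thesis unfolding diff_divide_distrib t1 t2 ..
        qed
        note alg = this[of "r ^ (m - 1)" "gw p B n" "r ^ n" "real p" "exp (- (B / r ^ p))" "igam a (B / r ^ p)" "real m"]
        have "(real p / gw p B n * (exp (- (B / r ^ p)) / (r ^ n * r)) * (r ^ (m - 1) * r) - igam a (B / r ^ p) * (real m * r ^ (m - 1))) /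
            ((r ^ (m - 1) * r) * (r ^ (m - 1) * r)) =
          real p * (exp (- (B / r ^ p)) / ((r ^ (m - 1) * r) * (r ^ n * r)) / gw p B n) - real m * (igam a (B / r ^ p) / ((r ^ (m - 1) * r) * r))"
          by (rule alg) (use r0 B in auto)
        moreover have "r ^ (n + 1) = r ^ n * r" "r ^ (m + n + 1) = (r ^ (m - 1) * r) * (r ^ n * r)" "r ^ (m + 1) = (r ^ (m - 1) * r) * r"
          unfolding rm[symmetric] by (simp_all add: power_add)
        ultimately show ?thesis unfolding rm by presburger
      qed
      finally show "(P has_vector_derivative real p * (exp (- (B / r ^ p)) / r ^ (m + n + 1) / gw p B n)
          - real m * (igam a (B / r ^ p) / r ^ (m + 1))) (at r within {e..R})"
        unfolding has_real_derivative_iff_has_vector_derivative by (rule has_vector_derivative_at_within)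
    qed
    hence "P R - P e = integral {e..R} (\<lambda>r. real p * (exp (- (B / r ^ p)) / r ^ (m + n + 1) / gw p B n) - real m * (igam a (B / r ^ p) / r ^ (m + 1)))"
      by (simp add: integral_unique)
    also have "\<dots> = integral {e..R} (\<lambda>r. real p * (exp (- (B / r ^ p)) / r ^ (m + n + 1) / gw p B n)) - integral {e..R} (\<lambda>r. real m * (igam a (B / r ^ p) / r ^ (m + 1)))"
      by (intro integral_diff integrable_on_mult_right integrable_on_divide i1 J2)
    also have "\<dots> = real p * (integral {e..R} (\<lambda>r. exp (- (B / r ^ p)) / r ^ (m + n + 1)) / gw p B n) - real m * integral {e..R} (\<lambda>r. igam a (B / r ^ p) / r ^ (m + 1))"
      unfolding integral_mult_right integral_divide ..
    finally have eq: "real m * integral {e..R} (\<lambda>r. igam a (B / r ^ p) / r ^ (m + 1)) =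
        real p * (integral {e..R} (\<lambda>r. exp (- (B / r ^ p)) / r ^ (m + n + 1)) / gw p B n) + P e - P R" by simp
    have PR: "P R \<ge> 0" using e B by (auto simp: P_def intro!: divide_nonneg_nonneg igam_nonneg a0)
    have Pe: "P e \<le> real p * (gw p B m * gev p (m + n))"
    proof -
      have eq': "1 / e ^ m = gw p B m * (B / e ^ p) powr (real m / real p)"
        using tau_powr[OF B e(1) p, of m] B by simp
      have "P e = (1 / e ^ m) * igam a (B / e ^ p)" by (simp add: P_def)
      also have "\<dots> = gw p B m * ((B / e ^ p) powr (real m / real p) * igam a (B / e ^ p))"
        unfolding eq' by (rule mult.assoc)
      also have "\<dots> \<le> gw p B m * Gamma (a + real m / real p)"
        using e B by (intro mult_left_mono igam_pow_le a0) auto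
      also have "a + real m / real p = real (m + n) / real p" by (simp add: a_def add_divide_distrib)
      also have "gw p B m * Gamma (real (m + n) / real p) \<le> gw p B m * (real p * gev p (m + n))"
        unfolding gev_def by (intro mult_left_mono Gamma_le_Gamma_plus1) (use n1 p in auto)
      finally show ?thesis by (simp only: mult_ac)
    qed
    have "integral {e..R} (\<lambda>r. igam a (B / r ^ p) / r ^ (m + 1)) \<ge> 0"
      using e B by (intro integral_nonneg J2) (auto intro!: divide_nonneg_nonneg igam_nonneg a0)
    hence "1 * integral {e..R} (\<lambda>r. igam a (B / r ^ p) / r ^ (m + 1)) \<le> real m * integral {e..R} (\<lambda>r. igam a (B / r ^ p) / r ^ (m + 1))"
      using m by (intro mult_right_mono) auto
    also have "\<dots> \<le> 2 * real p * (gw p B m * gev p (m + n))"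
      unfolding eq using PR Pe mult_left_mono[OF I1, of "real p"] by simp
    finally have K2: "integral {e..R} (\<lambda>r. igam a (B / r ^ p) / r ^ (m + 1)) \<le> 2 * real p * (gw p B m * gev p (m + n))" by simp
    have "integral {e..R} (\<lambda>r. dgev p B n r / r ^ (m + 1)) =
      integral {e..R} (\<lambda>r. exp (- (B / r ^ p)) * (B / r ^ p) powr a / r ^ (m + 1) + igam a (B / r ^ p) / r ^ (m + 1))"
      using False by (simp add: dgev_def a_def add_divide_distrib)
    also have "\<dots> = integral {e..R} (\<lambda>r. exp (- (B / r ^ p)) * (B / r ^ p) powr a / r ^ (m + 1)) + integral {e..R} (\<lambda>r. igam a (B / r ^ p) / r ^ (m + 1))"
      by (rule integral_add[OF J1 J2])
    finally show ?thesis using K1 K2 by (simp add: distrib_right)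
  qed
qed

section \<open>Geometric factors and remainders away from 0\<close>

lemma gev_0 [simp]: "gev p 0 = 1" by (simp add: gev_def)

lemma gw_0 [simp]: "A > 0 \<Longrightarrow> gw p A 0 = 1" by (simp add: gw_def)

text \<open>Absorbing A into the ratio q = x A^(1/p) reduces this to
  \<open>gev_geometric_sum\<close>. The constant does not depend on n because the shifted sum is
  part of the full sum up to N + n.\<close>

lemma gev_geometric_sum':
  assumes A: "A > 0" and p: "p \<ge> 1" and x: "x > 0"
  shows "\<exists>K>0. \<forall>N n. (\<Sum>i\<le>N. x ^ (N - i) * (gw p A i * gev p (i + n))) \<le> K * (gw p A N * gev p (N + n))"
proof -
  define q where "q = x * A powr (1 / real p)"
  have q0: "q > 0" using x A by (simp add: q_def)
  obtain K where K: "K > 0" "\<And>N. (\<Sum>i\<le>N. q ^ (N - i) * gev p i) \<le> K * gev p N"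
    using gev_geometric_sum[OF p q0] by blast
  have xq: "x ^ k * gw p A i = q ^ k * gw p A (i + k)" for k i
  proof -
    have "(A powr (1 / real p)) ^ k * gw p A k = 1"
      using A by (simp add: gw_power flip: power_mult_distrib powr_add)
    thus ?thesis using A by (simp add: q_def power_mult_distrib gw_add)
  qed
  have "(\<Sum>i\<le>N. x ^ (N - i) * (gw p A i * gev p (i + n))) \<le> K * (gw p A N * gev p (N + n))" for N n
  proof -
    have "(\<Sum>i\<le>N. x ^ (N - i) * (gw p A i * gev p (i + n))) = (\<Sum>i\<le>N. gw p A N * (q ^ (N - i) * gev p (i + n)))"
    proof (intro sum.cong refl)
      fix i assume "i \<in> {..N}"
      thus "x ^ (N - i) * (gw p A i * gev p (i + n)) = gw p A N * (q ^ (N - i) * gev p (i + n))"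
        using xq[of "N - i" i] by simp
    qed
    also have "\<dots> = gw p A N * (\<Sum>i\<le>N. q ^ (N - i) * gev p (i + n))" by (simp add: sum_distrib_left)
    finally have 1: "(\<Sum>i\<le>N. x ^ (N - i) * (gw p A i * gev p (i + n))) = gw p A N * (\<Sum>i\<le>N. q ^ (N - i) * gev p (i + n))" .
    have "(\<Sum>i\<le>N. q ^ (N - i) * gev p (i + n)) = (\<Sum>k\<in>(\<lambda>i. i + n) ` {..N}. q ^ (N + n - k) * gev p k)"
      by (subst sum.reindex) (auto simp: inj_on_def)
    also have "\<dots> \<le> (\<Sum>k\<le>N + n. q ^ (N + n - k) * gev p k)"
      using q0 by (intro sum_mono2) auto
    also have "\<dots> \<le> K * gev p (N + n)" by (rule K)
    finally have "gw p A N * (\<Sum>i\<le>N. q ^ (N - i) * gev p (i + n)) \<le> gw p A N * (K * gev p (N + n))"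
      by (rule mult_left_mono) simp
    thus ?thesis unfolding 1 by (simp only: mult_ac)
  qed
  thus ?thesis using K(1) by blast
qed

lemma power_le_gev:
  assumes A: "A > 0" and p: "p \<ge> 1" and x: "x > 0"
  shows "\<exists>K>0. \<forall>N n. x ^ N * gev p n \<le> K * (gw p A N * gev p (N + n))"
proof -
  obtain K where K: "K > 0" "\<And>N n. (\<Sum>i\<le>N. x ^ (N - i) * (gw p A i * gev p (i + n))) \<le> K * (gw p A N * gev p (N + n))"
    using gev_geometric_sum'[OF assms] by blast
  have "x ^ N * gev p n \<le> K * (gw p A N * gev p (N + n))" for N n
  proof -
    have "x ^ (N - 0) * (gw p A 0 * gev p (0 + n)) \<le> (\<Sum>i\<le>N. x ^ (N - i) * (gw p A i * gev p (i + n)))"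
      using x by (intro member_le_sum) auto
    thus ?thesis using K(2)[of N n] A by simp
  qed
  thus ?thesis using K(1) by blast
qed

text \<open>For |z| \<ge> r nothing asymptotic is at stake: each term is bounded by itself and |z|^m
  \<le> r^(m-N) |z|^N, a geometric loss absorbed by the weights. \<open>W\<close> and
  \<open>n\<close> are there for uniformity: W = 1, n = 0 for expansions in \<eta>, and W =
  \<open>gw p At n\<close> for the expansions of the g_n at infinity.\<close>

lemma gevrey_tail:
  assumes A: "A > 0" and p: "p \<ge> 1" and r: "r > 0" and Q: "Q \<ge> 0" and K1: "K1 \<ge> 0"
  obtains K where "K > 0"
    "\<And>N n c (z :: complex) (F :: complex) W. \<lbrakk>\<And>m. norm (c m) \<le> K1 * (W * (gw p A m * gev p (m + n))); norm F \<le> Q * (W * gev p n); r \<le> norm z; W \<ge> 0\<rbrakk>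
      \<Longrightarrow> norm (F - (\<Sum>m<N. c m * z ^ m)) \<le> K * (W * (gw p A N * gev p (N + n))) * norm z ^ N"
proof -
  obtain K2 where K2: "K2 > 0" "\<And>N n. (\<Sum>i\<le>N. (1/r) ^ (N - i) * (gw p A i * gev p (i + n))) \<le> K2 * (gw p A N * gev p (N + n))"
    using gev_geometric_sum'[OF A p, of "1/r"] r by auto
  obtain K3 where K3: "K3 > 0" "\<And>N n. (1/r) ^ N * gev p n \<le> K3 * (gw p A N * gev p (N + n))"
    using power_le_gev[OF A p, of "1/r"] r by auto
  define K where "K = Q * K3 + K1 * K2 + 1"
  show ?thesis
  proof
    show "K > 0" using Q K1 K2 K3 by (simp add: K_def add_nonneg_pos)
    fix N n and c :: "nat \<Rightarrow> complex" and z F :: complex and W :: real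
    assume c: "\<And>m. norm (c m) \<le> K1 * (W * (gw p A m * gev p (m + n)))" and F: "norm F \<le> Q * (W * gev p n)" and z: "r \<le> norm z" and W: "W \<ge> 0"
    have zp: "norm z ^ m \<le> (1/r) ^ (N - m) * norm z ^ N" if "m \<le> N" for m
    proof -
      have "1 \<le> (norm z / r) ^ (N - m)" using z r by (intro one_le_power) (auto simp: field_simps)
      hence "norm z ^ m * 1 \<le> norm z ^ m * (norm z / r) ^ (N - m)" by (intro mult_left_mono) auto
      also have "\<dots> = (1/r) ^ (N - m) * (norm z ^ m * norm z ^ (N - m))" by (simp add: power_divide)
      also have "norm z ^ m * norm z ^ (N - m) = norm z ^ N" using that by (simp flip: power_add)
      finally show ?thesis by simp
    qed
    have 1: "norm F \<le> Q * K3 * (W * (gw p A N * gev p (N + n))) * norm z ^ N"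
    proof -
      have "norm F \<le> Q * (W * gev p n) * norm z ^ 0" using F by simp
      also have "\<dots> \<le> Q * (W * gev p n) * ((1/r) ^ (N - 0) * norm z ^ N)"
        using Q W by (intro mult_left_mono zp) auto
      also have "\<dots> = Q * W * norm z ^ N * ((1/r) ^ N * gev p n)" by simp
      also have "\<dots> \<le> Q * W * norm z ^ N * (K3 * (gw p A N * gev p (N + n)))" using Q W by (intro mult_left_mono K3) auto
      finally show ?thesis by (simp only: mult_ac)
    qed
    have "norm (\<Sum>m<N. c m * z ^ m) \<le> (\<Sum>m<N. (K1 * (W * (gw p A m * gev p (m + n)))) * ((1/r) ^ (N - m) * norm z ^ N))"
      by (rule sum_norm_le) (use W K1 in \<open>auto simp: norm_mult norm_power intro!: mult_mono c zp[simplified]\<close>)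
    also have "\<dots> = K1 * W * norm z ^ N * (\<Sum>m<N. (1/r) ^ (N - m) * (gw p A m * gev p (m + n)))"
      unfolding sum_distrib_left by (intro sum.cong refl) (simp only: mult_ac)
    also have "\<dots> \<le> K1 * W * norm z ^ N * (\<Sum>m\<le>N. (1/r) ^ (N - m) * (gw p A m * gev p (m + n)))"
      using K1 W r by (intro mult_left_mono sum_mono2) auto
    also have "\<dots> \<le> K1 * W * norm z ^ N * (K2 * (gw p A N * gev p (N + n)))"
      using K1 W by (intro mult_left_mono K2) auto
    finally have 2: "norm (\<Sum>m<N. c m * z ^ m) \<le> K1 * K2 * (W * (gw p A N * gev p (N + n))) * norm z ^ N"
      by (simp only: mult_ac)
    have "norm (F - (\<Sum>m<N. c m * z ^ m)) \<le> norm F + norm (\<Sum>m<N. c m * z ^ m)" by (rule norm_triangle_ineq4)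
    also have "\<dots> \<le> (Q * K3 + K1 * K2) * (W * (gw p A N * gev p (N + n))) * norm z ^ N"
      using 1 2 by (simp add: distrib_right)
    also have "\<dots> \<le> K * (W * (gw p A N * gev p (N + n))) * norm z ^ N"
      using W by (intro mult_right_mono) (auto simp: K_def)
    finally show "norm (F - (\<Sum>m<N. c m * z ^ m)) \<le> K * (W * (gw p A N * gev p (N + n))) * norm z ^ N" .
  qed
qed

section \<open>The combined expansion\<close>

text \<open>The structural hypotheses of \<open>ramis_sibuya\<close> in one predicate. The collar
  radii and the bound \<open>Q0\<close> near 0 are quantified away because the final bounds do not
  involve them; R, \<rho>, \<open>D\<close> and \<open>Q\<close> remain visible.\<close>

definition two_zone_family :: "nat set \<Rightarrow> (nat \<Rightarrow> complex set) \<Rightarrow> real \<Rightarrow> real \<Rightarrow> (real \<Rightarrow> real) \<Rightarrow> real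
    \<Rightarrow> (nat \<Rightarrow> complex \<Rightarrow> complex) \<Rightarrow> (nat \<Rightarrow> complex \<Rightarrow> complex) \<Rightarrow> bool" where
  "two_zone_family I U R \<rho> D Q F G \<longleftrightarrow> 0 < \<rho> \<and> \<rho> \<le> R \<and>
     (\<exists>\<rho>0 \<rho>1 R1 Q0. 0 \<le> \<rho>0 \<and> \<rho>0 < \<rho> \<and> \<rho> < \<rho>1 \<and> R < R1 \<and>
       (\<forall>i\<in>I. F i holomorphic_on U i \<inter> {u. norm u < \<rho>1}) \<and>
       (\<forall>i\<in>I. G i holomorphic_on U i \<inter> {u. \<rho>0 < norm u \<and> norm u < R1}) \<and>
       (\<forall>i\<in>I. \<forall>u\<in>U i. norm u \<le> \<rho> \<longrightarrow> norm (F i u) \<le> Q0)) \<and>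
     (\<forall>i\<in>I. \<forall>j\<in>I. \<forall>u\<in>U i \<inter> U j. norm u \<le> \<rho> \<longrightarrow> norm (F i u - F j u) \<le> D (norm u)) \<and>
     (\<forall>i\<in>I. \<forall>j\<in>I. \<forall>u\<in>U i \<inter> U j. \<rho> \<le> norm u \<and> norm u \<le> R \<longrightarrow> norm (G i u - G j u) \<le> D (norm u)) \<and>
     (\<forall>i\<in>I. \<forall>u\<in>U i. norm u = \<rho> \<longrightarrow> norm (F i u - G i u) \<le> D (norm u)) \<and>
     (\<forall>i\<in>I. \<forall>u\<in>U i. norm u = R \<longrightarrow> norm (G i u) \<le> Q)"

lemma two_zone_familyI:
  assumes "0 < \<rho>" "\<rho> \<le> R" "0 \<le> \<sigma>" "\<sigma> < \<rho>" "\<rho> < \<tau>" "R < T"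
    and "\<And>i. i \<in> I \<Longrightarrow> F i holomorphic_on U i \<inter> {u. norm u < \<tau>}"
    and "\<And>i. i \<in> I \<Longrightarrow> G i holomorphic_on U i \<inter> {u. \<sigma> < norm u \<and> norm u < T}"
    and "\<And>i j u. i \<in> I \<Longrightarrow> j \<in> I \<Longrightarrow> u \<in> U i \<Longrightarrow> u \<in> U j \<Longrightarrow> norm u \<le> \<rho> \<Longrightarrow> norm (F i u - F j u) \<le> D (norm u)"
    and "\<And>i j u. i \<in> I \<Longrightarrow> j \<in> I \<Longrightarrow> u \<in> U i \<Longrightarrow> u \<in> U j \<Longrightarrow> \<rho> \<le> norm u \<Longrightarrow> norm u \<le> R \<Longrightarrow> norm (G i u - G j u) \<le> D (norm u)"
    and "\<And>i u. i \<in> I \<Longrightarrow> u \<in> U i \<Longrightarrow> norm u = \<rho> \<Longrightarrow> norm (F i u - G i u) \<le> D (norm u)"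
    and "\<And>i u. i \<in> I \<Longrightarrow> u \<in> U i \<Longrightarrow> norm u \<le> \<rho> \<Longrightarrow> norm (F i u) \<le> Qi"
    and "\<And>i u. i \<in> I \<Longrightarrow> u \<in> U i \<Longrightarrow> norm u = R \<Longrightarrow> norm (G i u) \<le> Q"
  shows "two_zone_family I U R \<rho> D Q F G"
  unfolding two_zone_family_def
  by (intro conjI exI[of _ \<sigma>] exI[of _ \<tau>] exI[of _ T] exI[of _ Qi] ballI impI; (elim IntE conjE)?; (rule assms; assumption))

lemma two_zone_family_const:
  assumes "0 < R" "R < T"
    and h: "\<And>i. i \<in> I \<Longrightarrow> F i holomorphic_on U i \<inter> {u. norm u < T}"
    and d: "\<And>i j u. i \<in> I \<Longrightarrow> j \<in> I \<Longrightarrow> u \<in> U i \<Longrightarrow> u \<in> U j \<Longrightarrow> norm u \<le> R \<Longrightarrow> norm (F i u - F j u) \<le> D (norm u)"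
    and q: "\<And>i u. i \<in> I \<Longrightarrow> u \<in> U i \<Longrightarrow> norm u \<le> R \<Longrightarrow> norm (F i u) \<le> Q"
  shows "two_zone_family I U R R D Q F F"
proof (rule two_zone_familyI[where \<sigma>=0 and \<tau>=T and T=T and Qi=Q])
  show "F i holomorphic_on U i \<inter> {u. 0 < norm u \<and> norm u < T}" if "i \<in> I" for i
    by (rule holomorphic_on_subset[OF h[OF that]]) auto
  show "norm (F i u - F i u) \<le> D (norm u)" if "i \<in> I" "u \<in> U i" "norm u = R" for i u
    using d[OF that(1,1,2,2)] that by simp
  show "norm (F i u) \<le> Q" if "i \<in> I" "u \<in> U i" "norm u = R" for i u
    using q[OF that(1,2)] that by simp
qed (use assms in auto)

lemma (in cone_cover) ramis_sibuya_two_zone: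
  assumes tz: "two_zone_family I U R \<rho> D Q F G"
    and cD: "continuous_on {0<..R} D"
    and E: "\<And>N. \<exists>E. \<forall>r\<in>{0<..R}. D r \<le> E * r ^ N"
  shows "\<exists>c. (\<forall>n J. (\<forall>e\<in>{0<..<R}. integral {e..R} (\<lambda>r. D r / r ^ (n + 1)) \<le> J) \<longrightarrow>
              norm (c n) \<le> Q / R ^ n + real K * J + D \<rho> / \<rho> ^ n) \<and>
         (\<forall>N J s \<kappa> i z. (\<forall>e\<in>{0<..<R}. integral {e..R} (\<lambda>r. D r / r ^ (N + 1)) \<le> J) \<longrightarrow>
              (\<forall>r\<in>{0<..R}. D r \<le> s * r ^ N) \<longrightarrow> 0 < \<kappa> \<longrightarrow> \<kappa> < 1 \<longrightarrow> i \<in> I \<longrightarrow> z \<in> U i \<longrightarrow> norm z \<le> \<kappa> * \<rho> \<longrightarrow>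
              norm (F i z - (\<Sum>n<N. c n * z ^ n)) \<le> (Q / R ^ N / (1 - \<kappa>) + real K / gap * J + 2 * s / (1 - \<kappa>)) * norm z ^ N)"
proof -
  note tz' = tz[unfolded two_zone_family_def]
  obtain \<rho>0 \<rho>1 R1 Q0 where rho: "0 < \<rho>" "\<rho> \<le> R" "0 \<le> \<rho>0" "\<rho>0 < \<rho>" "\<rho> < \<rho>1" "R < R1"
    and h: "\<forall>i\<in>I. F i holomorphic_on U i \<inter> {u. norm u < \<rho>1}"
       "\<forall>i\<in>I. G i holomorphic_on U i \<inter> {u. \<rho>0 < norm u \<and> norm u < R1}"
    and Q0: "\<forall>i\<in>I. \<forall>u\<in>U i. norm u \<le> \<rho> \<longrightarrow> norm (F i u) \<le> Q0"
    using tz' by (elim conjE exE) (rule that; assumption)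
  have dI: "\<forall>i\<in>I. \<forall>j\<in>I. \<forall>u\<in>U i \<inter> U j. norm u \<le> \<rho> \<longrightarrow> norm (F i u - F j u) \<le> D (norm u)"
    and dO: "\<forall>i\<in>I. \<forall>j\<in>I. \<forall>u\<in>U i \<inter> U j. \<rho> \<le> norm u \<and> norm u \<le> R \<longrightarrow> norm (G i u - G j u) \<le> D (norm u)"
    and jump: "\<forall>i\<in>I. \<forall>u\<in>U i. norm u = \<rho> \<longrightarrow> norm (F i u - G i u) \<le> D (norm u)"
    and Qb: "\<forall>i\<in>I. \<forall>u\<in>U i. norm u = R \<longrightarrow> norm (G i u) \<le> Q"
    using tz' by - (elim conjE, assumption)+
  show ?thesis
  proof (rule ramis_sibuya[OF rho])
    show "F i holomorphic_on U i \<inter> {u. norm u < \<rho>1}"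
      "G i holomorphic_on U i \<inter> {u. \<rho>0 < norm u \<and> norm u < R1}" if "i \<in> I" for i
      using h that by blast+
    show "norm (F i u) \<le> Q0" if "i \<in> I" "u \<in> U i" "norm u \<le> \<rho>" for i u using Q0 that by blast
    show "norm (F i u - F j u) \<le> D (norm u)" if "i \<in> I" "j \<in> I" "u \<in> U i" "u \<in> U j" "norm u \<le> \<rho>" for i j u
      using dI that by blast
    show "norm (G i u - G j u) \<le> D (norm u)" if "i \<in> I" "j \<in> I" "u \<in> U i" "u \<in> U j" "\<rho> \<le> norm u" "norm u \<le> R" for i j u
      using dO that by blast
    show "norm (F i u - G i u) \<le> D \<rho>" if "i \<in> I" "u \<in> U i" "norm u = \<rho>" for i u
      using jump that by blast
    show "norm (G i u) \<le> Q" if "i \<in> I" "u \<in> U i" "norm u = R" for i u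
      using Qb that by blast
  qed (fact cD E)+
qed

definition gevrey_expansion_on where
  "gevrey_expansion_on p A K I U s F c \<longleftrightarrow> (\<forall>n. norm (c n) \<le> K * (gw p A n * gev p n)) \<and>
     (\<forall>N. \<forall>i\<in>I. \<forall>z\<in>U i. norm z \<le> s \<longrightarrow>
        norm (F i z - (\<Sum>n<N. c n * z ^ n)) \<le> K * (gw p A N * gev p N) * norm (z::complex) ^ N)"
  for F :: "nat \<Rightarrow> complex \<Rightarrow> complex"

text \<open>The point is the order of the quantifiers: \<open>Kc\<close> is fixed before the family
  and before \<rho>. This is possible because D \<rho> / \<rho>^n is itself bounded by the flatness
  of \<open>D\<close>, so no negative power of \<rho> survives.\<close>

lemma (in cone_cover) gevrey_ramis_sibuya:
  assumes A: "A > 0" and p: "p \<ge> 1" and R: "R > 0" and \<kappa>: "0 < \<kappa>" "\<kappa> < 1" and C: "C \<ge> 0" and Q: "Q \<ge> 0"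
  shows "\<exists>Kc>0. \<forall>F G \<rho>. two_zone_family I U R \<rho> (\<lambda>r. C * exp (- (A / r ^ p))) Q F G \<longrightarrow>
      (\<exists>c. gevrey_expansion_on p A Kc I U (\<kappa> * \<rho>) F c)"
proof -
  obtain K1 where K1: "K1 > 0" "\<And>n e. e \<in> {0<..R} \<Longrightarrow> integral {e..R} (\<lambda>r. exp (- (A / r ^ p)) / r ^ (n + 1)) \<le> K1 * (gw p A n * gev p n)"
    using gevrey_integral_all[OF A p R] by blast
  \<comment> \<open>The boundary term carries R^(-N), a geometric factor that the weights absorb
    without change of type.\<close>
  obtain K2 where K2: "K2 > 0" "\<And>N n. (1/R) ^ N * gev p n \<le> K2 * (gw p A N * gev p (N + n))"
    using power_le_gev[OF A p, of "1/R"] R by auto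
  define Kc where "Kc = Q * K2 + real K * (C * K1) + C + Q * K2 / (1 - \<kappa>) + real K / gap * (C * K1) + 2 * C / (1 - \<kappa>) + 1"
  have nn: "0 \<le> Q * K2" "0 \<le> real K * (C * K1)" "0 \<le> Q * K2 / (1 - \<kappa>)" "0 \<le> real K / gap * (C * K1)" "0 \<le> 2 * C / (1 - \<kappa>)"
    using Q K2 C K1 \<kappa> gap_pos by auto
  show ?thesis
  proof (intro exI[of _ Kc] conjI allI impI)
    show "Kc > 0" unfolding Kc_def using nn C by linarith
    fix F G \<rho>
    assume tz: "two_zone_family I U R \<rho> (\<lambda>r. C * exp (- (A / r ^ p))) Q F G"
    define D where "D r = C * exp (- (A / r ^ p))" for r
    have pt: "D r \<le> (C * (gw p A N * gev p N)) * r ^ N" if "r \<in> {0<..R}" for r N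
      using mult_left_mono[OF gevrey_pointwise[OF A _ p, of r N] C] that by (simp add: D_def mult_ac)
    have I: "integral {e..R} (\<lambda>r. D r / r ^ (N + 1)) \<le> C * (K1 * (gw p A N * gev p N))" if "e \<in> {0<..<R}" for e N
    proof -
      have "integral {e..R} (\<lambda>r. D r / r ^ (N + 1)) = C * integral {e..R} (\<lambda>r. exp (- (A / r ^ p)) / r ^ (N + 1))"
        unfolding integral_mult_right[symmetric] by (simp add: D_def)
      also have "\<dots> \<le> C * (K1 * (gw p A N * gev p N))" using C K1(2)[of e N] that by (intro mult_left_mono) auto
      finally show ?thesis .
    qed
    have QR: "Q / R ^ N \<le> Q * K2 * (gw p A N * gev p N)" for N
      using mult_left_mono[OF K2(2)[of N 0] Q] by (simp add: power_divide mult_ac)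
    have "\<exists>c. (\<forall>n J. (\<forall>e\<in>{0<..<R}. integral {e..R} (\<lambda>r. D r / r ^ (n + 1)) \<le> J) \<longrightarrow>
              norm (c n) \<le> Q / R ^ n + real K * J + D \<rho> / \<rho> ^ n) \<and>
         (\<forall>N J s \<kappa> i z. (\<forall>e\<in>{0<..<R}. integral {e..R} (\<lambda>r. D r / r ^ (N + 1)) \<le> J) \<longrightarrow>
              (\<forall>r\<in>{0<..R}. D r \<le> s * r ^ N) \<longrightarrow> 0 < \<kappa> \<longrightarrow> \<kappa> < 1 \<longrightarrow> i \<in> I \<longrightarrow> z \<in> U i \<longrightarrow> norm z \<le> \<kappa> * \<rho> \<longrightarrow>
              norm (F i z - (\<Sum>n<N. c n * z ^ n)) \<le> (Q / R ^ N / (1 - \<kappa>) + real K / gap * J + 2 * s / (1 - \<kappa>)) * norm z ^ N)"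
    proof (rule ramis_sibuya_two_zone)
      show "two_zone_family I U R \<rho> D Q F G" using tz by (simp add: D_def[abs_def])
      show "continuous_on {0<..R} D" unfolding D_def by (intro continuous_intros) auto
      show "\<exists>E. \<forall>r\<in>{0<..R}. D r \<le> E * r ^ N" for N using pt by blast
    qed
    then obtain c where c: "\<And>n J. (\<forall>e\<in>{0<..<R}. integral {e..R} (\<lambda>r. D r / r ^ (n + 1)) \<le> J) \<Longrightarrow>
              norm (c n) \<le> Q / R ^ n + real K * J + D \<rho> / \<rho> ^ n"
      and rem: "\<And>N J s i z. (\<forall>e\<in>{0<..<R}. integral {e..R} (\<lambda>r. D r / r ^ (N + 1)) \<le> J) \<Longrightarrow>
              (\<forall>r\<in>{0<..R}. D r \<le> s * r ^ N) \<Longrightarrow> i \<in> I \<Longrightarrow> z \<in> U i \<Longrightarrow> norm z \<le> \<kappa> * \<rho> \<Longrightarrow>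
              norm (F i z - (\<Sum>n<N. c n * z ^ n)) \<le> (Q / R ^ N / (1 - \<kappa>) + real K / gap * J + 2 * s / (1 - \<kappa>)) * norm z ^ N"
      using \<kappa> by blast
    have rho: "0 < \<rho>" "\<rho> \<le> R" using tz unfolding two_zone_family_def by - (elim conjE, assumption)+
    show "\<exists>c. gevrey_expansion_on p A Kc I U (\<kappa> * \<rho>) F c"
      unfolding gevrey_expansion_on_def
    proof (intro exI[of _ c] conjI allI impI ballI)
      fix n
      define w where "w = gw p A n * gev p n"
      have w0: "w \<ge> 0" by (simp add: w_def)
      have "D \<rho> / \<rho> ^ n \<le> C * w" using pt[of \<rho> n] rho by (simp add: pos_divide_le_eq w_def)
      hence "norm (c n) \<le> Q * K2 * w + real K * (C * (K1 * w)) + C * w"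
        using c[of n "C * (K1 * w)"] I[of _ n] QR[of n] by (force simp: w_def)
      also have "\<dots> = (Q * K2 + real K * (C * K1) + C) * w" by (simp add: algebra_simps)
      also have "\<dots> \<le> Kc * w" using w0 nn by (intro mult_right_mono) (auto simp: Kc_def)
      finally show "norm (c n) \<le> Kc * (gw p A n * gev p n)" by (simp add: w_def)
    next
      fix N i z assume i: "i \<in> I" "z \<in> U i" "norm z \<le> \<kappa> * \<rho>"
      define w where "w = gw p A N * gev p N"
      have w0: "w \<ge> 0" by (simp add: w_def)
      have "norm (F i z - (\<Sum>n<N. c n * z ^ n)) \<le> (Q / R ^ N / (1 - \<kappa>) + real K / gap * (C * (K1 * w)) + 2 * (C * w) / (1 - \<kappa>)) * norm z ^ N"
        by (rule rem) (use I pt i in \<open>auto simp: w_def\<close>)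
      also have "\<dots> \<le> (Q * K2 * w / (1 - \<kappa>) + real K / gap * (C * (K1 * w)) + 2 * (C * w) / (1 - \<kappa>)) * norm z ^ N"
        using QR[of N] \<kappa> by (intro mult_right_mono add_mono divide_right_mono order_refl) (auto simp: w_def)
      also have "\<dots> = ((Q * K2 / (1 - \<kappa>) + real K / gap * (C * K1) + 2 * C / (1 - \<kappa>)) * w) * norm z ^ N"
        by (simp add: algebra_simps)
      also have "\<dots> \<le> (Kc * w) * norm z ^ N"
        using w0 nn C by (intro mult_right_mono) (auto simp: Kc_def)
      finally show "norm (F i z - (\<Sum>n<N. c n * z ^ n)) \<le> Kc * (gw p A N * gev p N) * norm z ^ N" by (simp add: w_def)
    qed
  qed
qed

text \<open>\<open>US l\<close>, \<open>P l j\<close> and \<open>UV j\<close> are infinite sectors in the planes of \<open>\<eta>\<close>, \<open>x\<close> and \<open>X = x/\<eta>\<close>; the quasi-sector \<open>V j\<close>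
  differs from \<open>UV j\<close> only near the origin. \<open>dom j l\<close> is the domain of \<open>y j l\<close> before shrinking.\<close>
locale coherent_family =
  fixes p :: nat and IJ IL :: "nat set" and US :: "nat \<Rightarrow> complex set" and P :: "nat \<Rightarrow> nat \<Rightarrow> complex set"
    and UV V :: "nat \<Rightarrow> complex set" and KS KX KV :: nat and r0 r1 \<eta>0 A B C Q T0 :: real
    and y :: "nat \<Rightarrow> nat \<Rightarrow> complex \<Rightarrow> complex \<Rightarrow> complex" and dom :: "nat \<Rightarrow> nat \<Rightarrow> (complex \<times> complex) set"
  assumes p: "p \<ge> 1" and r01: "0 < r0" "r0 < r1" and \<eta>0: "\<eta>0 > 0"
    and ABC: "A > 0" "B > 0" "C > 0" and Q: "Q \<ge> 0" and T0: "T0 > 0"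
    and coverS: "cone_cover IL US KS"
    and coverP: "\<And>l. l \<in> IL \<Longrightarrow> cone_cover IJ (P l) KX"
    and coverV: "cone_cover IJ UV KV"
    and open_V: "\<And>j. j \<in> IJ \<Longrightarrow> open (V j)"
    and V_UV: "\<And>j X. j \<in> IJ \<Longrightarrow> norm X > T0 \<Longrightarrow> X \<in> V j \<longleftrightarrow> X \<in> UV j"
    and y_cont: "\<And>j l. j \<in> IJ \<Longrightarrow> l \<in> IL \<Longrightarrow> continuous_on (dom j l) (\<lambda>(x,\<eta>). y j l x \<eta>)"
    and y_hol: "\<And>j l \<phi> \<psi> S. j \<in> IJ \<Longrightarrow> l \<in> IL \<Longrightarrow> open S \<Longrightarrow> \<phi> holomorphic_on S \<Longrightarrow> \<psi> holomorphic_on S \<Longrightarrow>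
        (\<And>t. t \<in> S \<Longrightarrow> (\<phi> t, \<psi> t) \<in> dom j l) \<Longrightarrow> (\<lambda>t. y j l (\<phi> t) (\<psi> t)) holomorphic_on S"
    and y_bound: "\<And>j l x \<eta>. j \<in> IJ \<Longrightarrow> l \<in> IL \<Longrightarrow> (x, \<eta>) \<in> dom j l \<Longrightarrow> norm (y j l x \<eta>) \<le> Q"
    and dom_outer: "\<And>j l w \<eta>. j \<in> IJ \<Longrightarrow> l \<in> IL \<Longrightarrow> \<eta> \<in> US l \<Longrightarrow> norm \<eta> < \<eta>0 \<Longrightarrow> w \<in> P l j \<Longrightarrow> r0 \<le> norm w \<Longrightarrow> norm w < r1 \<Longrightarrow> (w, \<eta>) \<in> dom j l"
    and diff_outer: "\<And>i j l l' w \<eta>. i \<in> IJ \<Longrightarrow> j \<in> IJ \<Longrightarrow> l \<in> IL \<Longrightarrow> l' \<in> IL \<Longrightarrow> \<eta> \<in> US l \<Longrightarrow> \<eta> \<in> US l' \<Longrightarrow> norm \<eta> < \<eta>0 \<Longrightarrow>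
        w \<in> P l j \<Longrightarrow> w \<in> P l' i \<Longrightarrow> r0 \<le> norm w \<Longrightarrow> norm w < r1 \<Longrightarrow> norm (y j l w \<eta> - y i l' w \<eta>) \<le> C * exp (- (min A (B * r0 ^ p) / norm \<eta> ^ p))"
    and dom_inner: "\<And>j l X \<eta>. j \<in> IJ \<Longrightarrow> l \<in> IL \<Longrightarrow> \<eta> \<in> US l \<Longrightarrow> norm \<eta> < \<eta>0 \<Longrightarrow> X \<in> V j \<Longrightarrow> norm (\<eta> * X) < r1 \<Longrightarrow> (\<eta> * X, \<eta>) \<in> dom j l"
    and diff_inner_l: "\<And>j l l' X \<eta>. j \<in> IJ \<Longrightarrow> l \<in> IL \<Longrightarrow> l' \<in> IL \<Longrightarrow> \<eta> \<in> US l \<Longrightarrow> \<eta> \<in> US l' \<Longrightarrow> norm \<eta> < \<eta>0 \<Longrightarrow> X \<in> V j \<Longrightarrow> norm (\<eta> * X) < r1 \<Longrightarrow>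
        norm (y j l (\<eta> * X) \<eta> - y j l' (\<eta> * X) \<eta>) \<le> C * exp (- (A / norm \<eta> ^ p))"
    and diff_inner_j: "\<And>i j l X \<eta>. i \<in> IJ \<Longrightarrow> j \<in> IJ \<Longrightarrow> l \<in> IL \<Longrightarrow> \<eta> \<in> US l \<Longrightarrow> norm \<eta> < \<eta>0 \<Longrightarrow> X \<in> V i \<Longrightarrow> X \<in> V j \<Longrightarrow> T0 < norm X \<Longrightarrow> norm (\<eta> * X) < r1 \<Longrightarrow>
        norm (y i l (\<eta> * X) \<eta> - y j l (\<eta> * X) \<eta>) \<le> C * exp (- (B * norm X ^ p))"
    and diff_match: "\<And>i j l X \<eta>. i \<in> IJ \<Longrightarrow> j \<in> IJ \<Longrightarrow> l \<in> IL \<Longrightarrow> \<eta> \<in> US l \<Longrightarrow> norm \<eta> < \<eta>0 \<Longrightarrow> X \<in> V j \<Longrightarrow> \<eta> * X \<in> P l i \<Longrightarrow> r0 \<le> norm (\<eta> * X) \<Longrightarrow> norm (\<eta> * X) < r1 \<Longrightarrow>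
        norm (y j l (\<eta> * X) \<eta> - y i l (\<eta> * X) \<eta>) \<le> C * exp (- (min A (B * r0 ^ p) / norm \<eta> ^ p))"
begin

section \<open>Cauchy transforms over circles beyond r0\<close>

definition At :: real where "At = min A (B * r0 ^ p)"

definition sx :: "nat \<Rightarrow> nat \<Rightarrow> nat" where
  "sx l = (SOME s. cone_cover.admissible IJ (P l) KX s)"

text \<open>The Cauchy integral of y dw/(2 pi i (w - x)), since dw = i w d\<theta>. On each arc the
  branch prescribed by \<open>sx l\<close> is integrated, as a single j need not serve the whole
  circle.\<close>

definition f :: "real \<Rightarrow> nat \<Rightarrow> complex \<Rightarrow> complex \<Rightarrow> complex" where
  "f r l x \<eta> = circ_sum KX (\<lambda>m w. y (sx l m) l w \<eta> * (w / (w - x))) r / (2 * pi)"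

lemma At_pos: "At > 0" using ABC r01 by (simp add: At_def)

lemma sx_admissible: "l \<in> IL \<Longrightarrow> cone_cover.admissible IJ (P l) KX (sx l)"
  unfolding sx_def using cone_cover.ex_admissible[OF coverP] by (rule someI_ex)

lemma KX_pos: "l \<in> IL \<Longrightarrow> KX > 0" using cone_cover.K_pos[OF coverP] .

lemma sx_in: "l \<in> IL \<Longrightarrow> m < KX \<Longrightarrow> sx l m \<in> IJ"
  using cone_cover.admissible_in[OF coverP sx_admissible] .

lemma sx_arc: "l \<in> IL \<Longrightarrow> m < KX \<Longrightarrow> r > 0 \<Longrightarrow> t \<in> {node KX m..node KX (Suc m)} \<Longrightarrow> of_real r * cis t \<in> P l (sx l m)"
  using cone_cover.admissible_arc[OF coverP sx_admissible] .

lemma open_P: "l \<in> IL \<Longrightarrow> j \<in> IJ \<Longrightarrow> open (P l j)"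
  using cone_cover.open_U[OF coverP] .

lemma open_US: "l \<in> IL \<Longrightarrow> open (US l)"
  using cone_cover.open_U[OF coverS] .

lemma y_hol_x:
  assumes "j \<in> IJ" "l \<in> IL" "\<eta> \<in> US l" "norm \<eta> < \<eta>0"
  shows "(\<lambda>w. y j l w \<eta>) holomorphic_on P l j \<inter> {w. r0 < norm w \<and> norm w < r1}"
proof (rule y_hol)
  show "open (P l j \<inter> {w. r0 < norm w \<and> norm w < r1})"
    using assms by (intro open_Int open_P open_Collect_conj open_Collect_less continuous_intros) auto
qed (use assms dom_outer in \<open>auto intro!: holomorphic_intros\<close>)

lemma y_arc_cont:
  assumes "l \<in> IL" "\<eta> \<in> US l" "norm \<eta> < \<eta>0" "r0 < r" "r < r1" "cone_cover.admissible IJ (P l) KX s"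
  shows "arc_cont KX (\<lambda>m w. y (s m) l w \<eta>) r"
  by (rule cone_cover.arc_cont_family[OF coverP[OF assms(1)] assms(6) _ assms(4,5), where F="\<lambda>i w. y i l w \<eta>"])
     (use assms r01 y_hol_x in auto)

lemma kernel_cont: "r > 0 \<Longrightarrow> norm x \<noteq> r \<Longrightarrow> continuous_on (sphere 0 r) (\<lambda>w::complex. w / (w - x))"
  by (intro continuous_intros) auto

lemma kernel_norm: "norm w = r \<Longrightarrow> norm x \<noteq> r \<Longrightarrow> norm (w / (w - x)) \<le> r / \<bar>r - norm (x::complex)\<bar>"
proof -
  assume w: "norm w = r" and x: "norm x \<noteq> r"
  have 1: "0 < \<bar>r - norm x\<bar>" and 2: "\<bar>r - norm x\<bar> \<le> norm (w - x)"
    using norm_triangle_ineq3[of w x] w x by auto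
  have "norm w / norm (w - x) \<le> norm w / \<bar>r - norm x\<bar>"
    by (rule divide_left_mono[OF 2 norm_ge_zero mult_pos_pos[OF less_le_trans[OF 1 2] 1]])
  thus ?thesis by (simp add: norm_divide w)
qed

lemma f_bound:
  assumes l: "l \<in> IL" and \<eta>: "\<eta> \<in> US l" "norm \<eta> < \<eta>0" and r: "r0 < r" "r < r1" and x: "norm x \<noteq> r"
  shows "norm (f r l x \<eta>) \<le> Q * (r / \<bar>r - norm x\<bar>)"
proof -
  have r0: "r > 0" using r r01 by simp
  have "norm (circ_sum KX (\<lambda>m w. y (sx l m) l w \<eta> * (w / (w - x))) r) \<le> 2 * pi * (Q * (r / \<bar>r - norm x\<bar>))"
  proof (rule circ_sum_norm_le[OF KX_pos[OF l]])
    show "arc_cont KX (\<lambda>m w. y (sx l m) l w \<eta> * (w / (w - x))) r"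
      using r0 x by (intro arc_cont_mult y_arc_cont l \<eta> r sx_admissible kernel_cont) auto
    fix m t assume m: "m < KX" "t \<in> {node KX m..node KX (Suc m)}"
    let ?w = "of_real r * cis t"
    have nw: "norm ?w = r" using r0 by (simp add: norm_mult)
    have "(?w, \<eta>) \<in> dom (sx l m) l"
      using nw r by (intro dom_outer sx_in sx_arc l \<eta> m r0) auto
    hence "norm (y (sx l m) l ?w \<eta>) \<le> Q" by (intro y_bound sx_in l m)
    thus "norm (y (sx l m) l ?w \<eta> * (?w / (?w - x))) \<le> Q * (r / \<bar>r - norm x\<bar>)"
      unfolding norm_mult[of "y (sx l m) l ?w \<eta>"] using kernel_norm[OF nw x] Q by (intro mult_mono) auto
  qed
  thus ?thesis by (simp add: f_def norm_divide pos_divide_le_eq mult.commute)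
qed

text \<open>On one and the same arc the selections for l and l' may pick different j, so l and j
  change at once. Hence \<open>At\<close> and not A in the exponent.\<close>

lemma f_diff:
  assumes l: "l \<in> IL" "l' \<in> IL" and \<eta>: "\<eta> \<in> US l" "\<eta> \<in> US l'" "norm \<eta> < \<eta>0" and r: "r0 < r" "r < r1" and x: "norm x \<noteq> r"
  shows "norm (f r l x \<eta> - f r l' x \<eta>) \<le> C * (r / \<bar>r - norm x\<bar>) * exp (- (At / norm \<eta> ^ p))"
proof -
  have r0: "r > 0" using r r01 by simp
  have ac: "arc_cont KX (\<lambda>m w. y (sx l m) l w \<eta> * (w / (w - x))) r" if "l \<in> IL" "\<eta> \<in> US l" for l
    using r0 x that by (intro arc_cont_mult y_arc_cont \<eta> r sx_admissible kernel_cont) auto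
  have "f r l x \<eta> - f r l' x \<eta> = circ_sum KX (\<lambda>m w. y (sx l m) l w \<eta> * (w / (w - x)) - y (sx l' m) l' w \<eta> * (w / (w - x))) r / (2 * pi)"
    unfolding f_def diff_divide_distrib[symmetric] using l \<eta> by (subst circ_sum_diff[OF ac ac]) simp_all
  moreover have "norm (circ_sum KX (\<lambda>m w. y (sx l m) l w \<eta> * (w / (w - x)) - y (sx l' m) l' w \<eta> * (w / (w - x))) r)
     \<le> 2 * pi * (C * exp (- (At / norm \<eta> ^ p)) * (r / \<bar>r - norm x\<bar>))"
  proof (rule circ_sum_norm_le[OF KX_pos[OF l(1)]])
    show "arc_cont KX (\<lambda>m w. y (sx l m) l w \<eta> * (w / (w - x)) - y (sx l' m) l' w \<eta> * (w / (w - x))) r"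
      using l \<eta> by (intro arc_cont_diff ac) auto
    fix m t assume m: "m < KX" "t \<in> {node KX m..node KX (Suc m)}"
    let ?w = "of_real r * cis t"
    have nw: "norm ?w = r" using r0 by (simp add: norm_mult)
    have "norm (y (sx l m) l ?w \<eta> - y (sx l' m) l' ?w \<eta>) \<le> C * exp (- (At / norm \<eta> ^ p))"
      unfolding At_def using nw r by (intro diff_outer sx_in sx_arc l \<eta> m r0) auto
    hence "norm (y (sx l m) l ?w \<eta> - y (sx l' m) l' ?w \<eta>) * norm (?w / (?w - x)) \<le> C * exp (- (At / norm \<eta> ^ p)) * (r / \<bar>r - norm x\<bar>)"
      using kernel_norm[OF nw x] ABC by (intro mult_mono) auto
    thus "norm (y (sx l m) l ?w \<eta> * (?w / (?w - x)) - y (sx l' m) l' ?w \<eta> * (?w / (?w - x))) \<le> C * exp (- (At / norm \<eta> ^ p)) * (r / \<bar>r - norm x\<bar>)"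
      by (simp only: left_diff_distrib[symmetric] norm_mult)
  qed
  ultimately show ?thesis by (simp add: norm_divide pos_divide_le_eq mult_ac)
qed

text \<open>Stated along curves (\<phi> t, \<psi> t) because it is used in several ways: with x
  fixed, with \<eta> fixed, and with x = \<eta>X for fixed X.\<close>

lemma f_holomorphic:
  assumes l: "l \<in> IL" and r: "r0 < r" "r < r1" and S: "open S" and h: "\<phi> holomorphic_on S" "\<psi> holomorphic_on S"
    and d: "\<And>t. t \<in> S \<Longrightarrow> \<psi> t \<in> US l \<and> norm (\<psi> t) < \<eta>0 \<and> norm (\<phi> t) \<noteq> r"
  shows "(\<lambda>t. f r l (\<phi> t) (\<psi> t)) holomorphic_on S"
proof -
  have r0: "r > 0" using r r01 by simp
  have c: "continuous_on S \<phi>" "continuous_on S \<psi>" using h by (auto intro: holomorphic_on_imp_continuous_on)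
  have "(\<lambda>t. integral {node KX m..node KX (Suc m)} (\<lambda>\<theta>. y (sx l m) l (of_real r * cis \<theta>) (\<psi> t) * (of_real r * cis \<theta> / (of_real r * cis \<theta> - \<phi> t)))) holomorphic_on S"
    if m: "m < KX" for m
  proof (rule holomorphic_on_param_integral[OF S])
    have dm: "(of_real r * cis \<theta>, \<psi> t) \<in> dom (sx l m) l" if "t \<in> S" "\<theta> \<in> {node KX m..node KX (Suc m)}" for t \<theta>
      using that r r0 d m l by (intro dom_outer sx_in sx_arc) (auto simp: norm_mult)
    have ne: "of_real r * cis \<theta> - \<phi> t \<noteq> 0" if "t \<in> S" for t \<theta>
    proof -
      have "norm (of_real r * cis \<theta>) = r" using r0 by (simp add: norm_mult)
      thus ?thesis using d[OF that] by auto
    qed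
    show "continuous_on (S \<times> {node KX m..node KX (Suc m)})
       (\<lambda>(t, \<theta>). y (sx l m) l (of_real r * cis \<theta>) (\<psi> t) * (of_real r * cis \<theta> / (of_real r * cis \<theta> - \<phi> t)))"
      unfolding split_beta
    proof (intro continuous_on_mult continuous_on_divide continuous_on_diff)
      show "continuous_on (S \<times> {node KX m..node KX (Suc m)}) (\<lambda>x. y (sx l m) l (of_real r * cis (snd x)) (\<psi> (fst x)))"
        by (rule continuous_on_compose2[OF y_cont[OF sx_in[OF l m] l], of _ "\<lambda>x. (of_real r * cis (snd x), \<psi> (fst x))", unfolded split_beta fst_conv snd_conv])
           (use dm in \<open>auto intro!: continuous_intros continuous_on_compose2[OF c(2)]\<close>)
      show "continuous_on (S \<times> {node KX m..node KX (Suc m)}) (\<lambda>x. \<phi> (fst x))"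
        by (rule continuous_on_compose2[OF c(1)]) (auto intro!: continuous_intros)
    qed (use ne in \<open>auto intro!: continuous_intros\<close>)
    show "(\<lambda>t. y (sx l m) l (of_real r * cis \<theta>) (\<psi> t) * (of_real r * cis \<theta> / (of_real r * cis \<theta> - \<phi> t))) holomorphic_on S"
      if "\<theta> \<in> {node KX m..node KX (Suc m)}" for \<theta>
      using dm[OF _ that] ne by (intro holomorphic_intros y_hol[OF sx_in[OF l m] l S] h) auto
  qed
  thus ?thesis unfolding f_def circ_sum_def by (intro holomorphic_intros) auto
qed

text \<open>\<open>y j l\<close> on \<open>|x| = rb\<close> is, up to exponentially small terms, its Cauchy integral over the annulus
  \<open>ra < |w| < rc\<close>.\<close>
lemma f_jump:
  assumes r: "r0 < ra" "ra < rb" "rb < rc" "rc < r1"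
  obtains Kj where "Kj > 0"
   "\<And>j l X \<eta>. j \<in> IJ \<Longrightarrow> l \<in> IL \<Longrightarrow> \<eta> \<in> US l \<Longrightarrow> norm \<eta> < \<eta>0 \<Longrightarrow> X \<in> V j \<Longrightarrow> norm (\<eta> * X) = rb \<Longrightarrow>
     norm (y j l (\<eta> * X) \<eta> - f rc l (\<eta> * X) \<eta> + f ra l (\<eta> * X) \<eta>) \<le> Kj * exp (- (At / norm \<eta> ^ p))"
proof -
  define gp where "gp = sin (2 * pi / real KX)"
  define Kj where "Kj = C * (1 + rc / (rc - rb) + ra / (rb - ra)) + \<bar>real KX / gp * (C * (rc - ra) / ra)\<bar>"
  show ?thesis
  proof
    have "rc / (rc - rb) > 0" "ra / (rb - ra) > 0" using r r01 by auto
    thus "Kj > 0" unfolding Kj_def using ABC by (intro add_pos_nonneg mult_pos_pos) auto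
    fix j l X \<eta> assume j: "j \<in> IJ" and l: "l \<in> IL" and \<eta>: "\<eta> \<in> US l" "norm \<eta> < \<eta>0" and X: "X \<in> V j" and nz: "norm (\<eta> * X) = rb"
    interpret cc: cone_cover IJ "P l" KX by (rule coverP[OF l])
    define z where "z = \<eta> * X"
    have z0: "z \<noteq> 0" and nz': "norm z = rb" using nz r r01 by (auto simp: z_def)
    define e where "e = exp (- (At / norm \<eta> ^ p))"
    obtain s i0 where ad: "cc.adapted s (Arg z) i0" using cc.ex_adapted by blast
    hence s: "cc.admissible s" and i0: "i0 \<in> IJ" "cis (Arg z) \<in> P l i0" by (auto simp: cc.adapted_def)
    have zp: "z = of_real (norm z) * cis (Arg z)" using rcis_cmod_Arg[of z] by (simp add: rcis_def)
    have zP: "z \<in> P l i0" using cc.polar_in_U[OF i0, of "norm z"] zp z0 by simp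
    define c where "c = y i0 l z \<eta>"
    \<comment> \<open>The selection adapted to z uses some branch i0 at z, not necessarily j; the
      two agree there up to a flat error.\<close>
    have yc: "norm (y j l z \<eta> - c) \<le> C * e"
      unfolding c_def e_def At_def z_def
      by (rule diff_match[OF i0(1) j l \<eta> X]) (use zP nz r in \<open>auto simp: z_def\<close>)
    define fs where "fs r = circ_sum KX (\<lambda>m w. y (s m) l w \<eta> * (w / (w - z))) r / (2 * pi)" for r
    have ac: "arc_cont KX (\<lambda>m w. y (s m) l w \<eta> * (w / (w - z))) r" if "cc.admissible s" "r0 < r" "r < r1" "r \<noteq> rb" for s r
      using that nz' r01 by (intro arc_cont_mult y_arc_cont l \<eta> kernel_cont) auto
    have fs: "norm (fs r - f r l z \<eta>) \<le> C * (r / \<bar>r - rb\<bar>) * e" if r: "r0 < r" "r < r1" "r \<noteq> rb" for r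
    proof -
      have rr: "r > 0" using r r01 by simp
      have nzr: "norm z \<noteq> r" using r nz' by simp
      have "fs r - f r l z \<eta> = circ_sum KX (\<lambda>m w. y (s m) l w \<eta> * (w / (w - z)) - y (sx l m) l w \<eta> * (w / (w - z))) r / (2 * pi)"
        unfolding f_def fs_def diff_divide_distrib[symmetric] using l r s sx_admissible[OF l] by (subst circ_sum_diff[OF ac ac]) simp_all
      moreover have "norm (circ_sum KX (\<lambda>m w. y (s m) l w \<eta> * (w / (w - z)) - y (sx l m) l w \<eta> * (w / (w - z))) r)
         \<le> 2 * pi * (C * e * (r / \<bar>r - norm z\<bar>))"
      proof (rule circ_sum_norm_le[OF KX_pos[OF l(1)]])
        show "arc_cont KX (\<lambda>m w. y (s m) l w \<eta> * (w / (w - z)) - y (sx l m) l w \<eta> * (w / (w - z))) r"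
          using l r s by (intro arc_cont_diff ac) (auto intro!: sx_admissible)
        fix m t assume m: "m < KX" "t \<in> {node KX m..node KX (Suc m)}"
        let ?w = "of_real r * cis t"
        have nw: "norm ?w = r" using rr by (simp add: norm_mult)
        have "norm (y (s m) l ?w \<eta> - y (sx l m) l ?w \<eta>) \<le> C * e"
          unfolding e_def At_def using nw r s m rr
          by (intro diff_outer sx_in sx_arc l \<eta> cc.admissible_in[OF s] cc.admissible_arc[OF s]) auto
        hence "norm (y (s m) l ?w \<eta> - y (sx l m) l ?w \<eta>) * norm (?w / (?w - z)) \<le> C * e * (r / \<bar>r - norm z\<bar>)"
          using kernel_norm[OF nw nzr] ABC by (intro mult_mono) (auto simp: e_def)
        thus "norm (y (s m) l ?w \<eta> * (?w / (?w - z)) - y (sx l m) l ?w \<eta> * (?w / (?w - z))) \<le> C * e * (r / \<bar>r - norm z\<bar>)"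
          by (simp only: left_diff_distrib[symmetric] norm_mult)
      qed
      ultimately show ?thesis by (simp add: norm_divide pos_divide_le_eq mult_ac nz')
    qed
    \<comment> \<open>The case N = 0 of \<open>kernel_annulus_le\<close>, with z between the two
      circles. Since the kernel integrates to 2 pi over |w| = rc and to 0 over |w| = ra, the
      difference of the two values is 2 pi (fs rc - c - fs ra).\<close>
    define H where "H r = circ_sum KX (\<lambda>m w. y (s m) l w \<eta> * (z / w) ^ 0 * (w / (w - z)) - c * (w / (w - z))) r" for r
    have Hle: "norm (H rc - H ra) \<le> real KX / cc.gap * norm z ^ 0 * integral {ra..rc} (\<lambda>r. C * e / r ^ (0 + 1))"
      unfolding H_def
    proof (rule cc.kernel_annulus_le[OF ad zp z0, where a'=r0 and b'=r1 and F="\<lambda>i w. y i l w \<eta>" and D="\<lambda>_. C * e"])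
      show "(\<lambda>w. y i l w \<eta>) holomorphic_on P l i \<inter> {w. r0 < norm w \<and> norm w < r1}" if "i \<in> IJ" for i
        by (rule y_hol_x[OF that l \<eta>])
      show "norm (y i l u \<eta> - y j l u \<eta>) \<le> C * e" if "i \<in> IJ" "j \<in> IJ" "u \<in> P l i" "u \<in> P l j" "ra \<le> norm u" "norm u \<le> rc" for i j u
        unfolding e_def At_def using that r by (intro diff_outer l \<eta>) auto
    qed (use r r01 nz' in \<open>auto simp: c_def\<close>)
    also have "\<dots> = real KX / gp * integral {ra..rc} (\<lambda>r. C * e / r)" by (simp add: cc.gap_def gp_def)
    also have "\<dots> \<le> real KX / gp * (C * e / ra * (rc - ra))"
    proof (rule mult_left_mono)
      have "integral {ra..rc} (\<lambda>r. C * e / r) \<le> integral {ra..rc} (\<lambda>r. C * e / ra)"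
        using r r01 ABC by (intro integral_le integrable_continuous_real continuous_intros divide_left_mono) (auto simp: e_def)
      thus "integral {ra..rc} (\<lambda>r. C * e / r) \<le> C * e / ra * (rc - ra)" using r by (simp add: mult_ac)
    qed (use cc.gap_pos in \<open>auto simp: cc.gap_def gp_def\<close>)
    also have "\<dots> = (real KX / gp * (C * (rc - ra) / ra)) * e" by simp
    also have "\<dots> \<le> \<bar>real KX / gp * (C * (rc - ra) / ra)\<bar> * e" by (rule mult_right_mono[OF abs_ge_self]) (simp add: e_def)
    finally have Hle: "norm (H rc - H ra) \<le> \<bar>real KX / gp * (C * (rc - ra) / ra)\<bar> * e" .
    have Hr: "H r = 2 * pi * fs r - c * circ_sum KX (\<lambda>m w. w / (w - z)) r" if "r0 < r" "r < r1" "r \<noteq> rb" for r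
    proof -
      have "H r = circ_sum KX (\<lambda>m w. y (s m) l w \<eta> * (w / (w - z)) - c * (w / (w - z))) r" by (simp add: H_def)
      also have "\<dots> = circ_sum KX (\<lambda>m w. y (s m) l w \<eta> * (w / (w - z))) r - circ_sum KX (\<lambda>m w. c * (w / (w - z))) r"
        using that r01 nz' by (intro circ_sum_diff ac s arc_cont_cmult arc_cont_fun kernel_cont) auto
      also have "circ_sum KX (\<lambda>m w. y (s m) l w \<eta> * (w / (w - z))) r = 2 * pi * fs r" by (simp add: fs_def)
      finally show ?thesis by (simp only: circ_sum_cmult)
    qed
    have "H rc = 2 * pi * fs rc - c * (2 * pi)"
      using Hr[of rc] circ_sum_kernel(1)[OF KX_pos[OF l], of rc z] r r01 nz' by simp
    moreover have "H ra = 2 * pi * fs ra"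
      using Hr[of ra] circ_sum_kernel(2)[OF KX_pos[OF l], of ra z] r r01 nz' by simp
    ultimately have "H rc - H ra = 2 * pi * (fs rc - c - fs ra)" by (simp add: algebra_simps)
    hence "2 * pi * norm (fs rc - c - fs ra) = norm (H rc - H ra)" by (simp add: norm_mult)
    moreover have "1 * norm (fs rc - c - fs ra) \<le> 2 * pi * norm (fs rc - c - fs ra)" using pi_gt3 by (intro mult_right_mono) auto
    ultimately have X1: "norm (fs rc - c - fs ra) \<le> \<bar>real KX / gp * (C * (rc - ra) / ra)\<bar> * e" using Hle by simp
    have X2: "norm (fs rc - f rc l z \<eta>) \<le> C * (rc / (rc - rb)) * e" using fs[of rc] r r01 by simp
    have X3: "norm (fs ra - f ra l z \<eta>) \<le> C * (ra / (rb - ra)) * e" using fs[of ra] r r01 by simp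
    have "y j l z \<eta> - f rc l z \<eta> + f ra l z \<eta> = - (- (y j l z \<eta> - c)) - (fs rc - c - fs ra) + (fs rc - f rc l z \<eta>) - (fs ra - f ra l z \<eta>) + 0" by simp
    also have "norm \<dots> \<le> norm (- (y j l z \<eta> - c)) + norm (fs rc - c - fs ra) + norm (fs rc - f rc l z \<eta>) + norm (fs ra - f ra l z \<eta>) + norm (0::complex)"
      by (rule norm_sum5)
    also have "\<dots> \<le> C * e + \<bar>real KX / gp * (C * (rc - ra) / ra)\<bar> * e + C * (rc / (rc - rb)) * e + C * (ra / (rb - ra)) * e"
      using X1 X2 X3 yc by (simp add: norm_minus_commute)
    also have "\<dots> = Kj * e" by (simp add: Kj_def algebra_simps)
    finally show "norm (y j l (\<eta> * X) \<eta> - f rc l (\<eta> * X) \<eta> + f ra l (\<eta> * X) \<eta>) \<le> Kj * exp (- (At / norm \<eta> ^ p))"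
      by (simp add: z_def e_def)
  qed
qed

end

lemma cone_cover_inverse:
  assumes "cone_cover I U K"
  shows "cone_cover I (\<lambda>i. {v. inverse v \<in> U i}) K"
proof -
  interpret cone_cover I U K by fact
  show ?thesis
  proof
    fix i assume i: "i \<in> I"
    have "open (- {0} \<inter> inverse -` U i)"
      by (rule continuous_open_preimage) (auto intro!: continuous_intros open_U i)
    also have "- {0} \<inter> inverse -` U i = {v. inverse v \<in> U i}" using zero_U[OF i] by auto
    finally show "open {v. inverse v \<in> U i}" .
    show "0 \<notin> {v. inverse v \<in> U i}" using zero_U[OF i] by simp
    show "of_real r * v \<in> {v. inverse v \<in> U i}" if "v \<in> {v. inverse v \<in> U i}" "r > 0" for v r
      using cone_U[OF i, of "inverse v" "inverse r"] that by simp
  next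
    fix s
    obtain i where i: "i \<in> I" "\<forall>t\<in>{- s - 8 * pi / real K..- s - 8 * pi / real K + 8 * pi / real K}. cis t \<in> U i" using cover_U by blast
    have "inverse (cis t) \<in> U i" if "t \<in> {s..s + 8 * pi / real K}" for t
      using i(2)[rule_format, of "- t"] that by simp
    thus "\<exists>i\<in>I. \<forall>t\<in>{s..s + 8 * pi / real K}. cis t \<in> {v. inverse v \<in> U i}" using i(1) by blast
  qed (rule K4)
qed

lemma gw_antimono: "0 < A \<Longrightarrow> A \<le> A' \<Longrightarrow> gw p A' n \<le> gw p A n"
  unfolding gw_def by (intro powr_mono2') auto

lemma gw_mult_power: "0 < B \<Longrightarrow> 0 < r \<Longrightarrow> p \<ge> 1 \<Longrightarrow> gw p (B * r ^ p) n = gw p B n / r ^ n"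
  by (simp add: gw_def powr_mult powr_powr powr_minus_divide flip: powr_realpow)

section \<open>Expansions in \<eta> of the two parts of y\<close>

context coherent_family begin

lemma ex_direction: "\<exists>l\<in>IL. \<exists>\<theta>. \<forall>r>0. of_real r * cis \<theta> \<in> US l"
proof -
  obtain l where l: "l \<in> IL" "cis 0 \<in> US l"
    using cone_cover.cover_U[OF coverS, of 0] by fastforce
  show ?thesis using cone_cover.polar_in_U[OF coverS l] l(1) by blast
qed

lemma ex_eta_seq:
  assumes "e > 0"
  shows "\<exists>l\<in>IL. \<exists>\<eta>. \<eta> \<longlonglongrightarrow> 0 \<and> (\<forall>k::nat. \<eta> k \<noteq> 0 \<and> \<eta> k \<in> US l \<and> norm (\<eta> k) < e)"
proof -
  obtain l \<theta> where l: "l \<in> IL" "\<And>r. r > 0 \<Longrightarrow> of_real r * cis \<theta> \<in> US l" using ex_direction by blast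
  define s where "s k = (e / 2) / real (Suc k)" for k
  have s0: "s k > 0" for k using assms by (simp add: s_def)
  have se: "s k < e" for k
  proof -
    have "s k \<le> e / 2" using assms by (simp add: s_def field_simps)
    thus ?thesis using assms by simp
  qed
  have "s \<longlonglongrightarrow> 0" unfolding s_def by (rule LIMSEQ_Suc) (rule lim_const_over_n)
  hence "(\<lambda>k. complex_of_real (s k) * cis \<theta>) \<longlonglongrightarrow> of_real 0 * cis \<theta>" by (intro tendsto_intros)
  hence "(\<lambda>k. complex_of_real (s k) * cis \<theta>) \<longlonglongrightarrow> 0" by simp
  moreover have "complex_of_real (s k) * cis \<theta> \<noteq> 0 \<and> of_real (s k) * cis \<theta> \<in> US l \<and> norm (complex_of_real (s k) * cis \<theta>) < e" for k
    using s0[of k] se[of k] l(2) by (simp add: norm_mult)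
  ultimately show ?thesis using l(1) by blast
qed

lemma ratio_le: "t \<le> s \<Longrightarrow> s < r \<Longrightarrow> 0 < r \<Longrightarrow> r / \<bar>r - t\<bar> \<le> r / (r - s)" for r s t :: real
  by (intro divide_left_mono) auto

lemma ratio_le': "s \<le> t \<Longrightarrow> r < s \<Longrightarrow> 0 < r \<Longrightarrow> r / \<bar>r - t\<bar> \<le> r / (s - r)" for r s t :: real
  by (intro divide_left_mono) auto

text \<open>For |x| < r0 < r the kernel of the transform is bounded uniformly in x, so the
  Ramis-Sibuya theorem on one fixed disc in \<eta> applies to every x with the same constant. The
  coefficients do not depend on l since the theorem gives them for the whole family.\<close>

lemma outer_expansion:
  assumes r: "r0 < r" "r < r1"
  obtains a K where "K > 0" "\<And>n. a n holomorphic_on ball 0 r0"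
    "\<And>n x. norm x < r0 \<Longrightarrow> norm (a n x) \<le> K * (gw p At n * gev p n)"
    "\<And>x l \<eta> N. norm x < r0 \<Longrightarrow> l \<in> IL \<Longrightarrow> \<eta> \<in> US l \<Longrightarrow> norm \<eta> < \<eta>0 \<Longrightarrow>
       norm (f r l x \<eta> - (\<Sum>n<N. a n x * \<eta> ^ n)) \<le> K * (gw p At N * gev p N) * norm \<eta> ^ N"
proof -
  interpret cs: cone_cover IL US KS by (rule coverS)
  define k where "k = r / (r - r0)"
  have k0: "k > 0" using r r01 by (simp add: k_def)
  have rat: "r / \<bar>r - norm x\<bar> \<le> k" if "norm x < r0" for x :: complex
    unfolding k_def by (rule ratio_le) (use that r r01 in auto)
  have C1: "C * k \<ge> 0" and Q1: "Q * k \<ge> 0" using ABC Q k0 by auto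
  have bnd: "norm (f r l x \<eta>) \<le> Q * k" if "norm x < r0" "l \<in> IL" "\<eta> \<in> US l" "norm \<eta> < \<eta>0" for x l \<eta>
    using order_trans[OF f_bound[OF that(2-4) r] mult_left_mono[OF rat[OF that(1)] Q]] that(1) r by auto
  have R0: "\<eta>0 / 2 > 0" using \<eta>0 by simp
  have half: "(0::real) < 1/2" "1/2 < (1::real)" by auto
  obtain Kc where Kc: "Kc > 0" and RS: "\<forall>F G \<rho>. two_zone_family IL US (\<eta>0 / 2) \<rho> (\<lambda>r. C * k * exp (- (At / r ^ p))) (Q * k) F G \<longrightarrow>
      (\<exists>c. gevrey_expansion_on p At Kc IL US (1/2 * \<rho>) F c)"
    using cs.gevrey_ramis_sibuya[OF At_pos p R0 half C1 Q1] by (elim exE conjE) (rule that)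
  have "\<forall>x. \<exists>c. norm x < r0 \<longrightarrow> gevrey_expansion_on p At Kc IL US (1/2 * (\<eta>0 / 2)) (\<lambda>l. f r l x) c"
  proof
    fix x
    show "\<exists>c. norm x < r0 \<longrightarrow> gevrey_expansion_on p At Kc IL US (1/2 * (\<eta>0 / 2)) (\<lambda>l. f r l x) c"
    proof (cases "norm x < r0")
      case x: True
      have "two_zone_family IL US (\<eta>0 / 2) (\<eta>0 / 2) (\<lambda>r. C * k * exp (- (At / r ^ p))) (Q * k) (\<lambda>l. f r l x) (\<lambda>l. f r l x)"
      proof (rule two_zone_family_const)
        show "\<eta>0 / 2 < \<eta>0" using \<eta>0 by simp
        show "(\<lambda>u. f r i x u) holomorphic_on US i \<inter> {u. norm u < \<eta>0}" if "i \<in> IL" for i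
        proof (rule f_holomorphic[OF that r])
          show "open (US i \<inter> {u. norm u < \<eta>0})"
            using that by (intro open_Int open_US open_Collect_less continuous_intros)
        qed (use x r in \<open>auto intro!: holomorphic_intros\<close>)
        show "norm (f r i x u - f r j x u) \<le> C * k * exp (- (At / norm u ^ p))"
          if "i \<in> IL" "j \<in> IL" "u \<in> US i" "u \<in> US j" "norm u \<le> \<eta>0 / 2" for i j u
        proof -
          have "norm (f r i x u - f r j x u) \<le> C * (r / \<bar>r - norm x\<bar>) * exp (- (At / norm u ^ p))"
            using that x r \<eta>0 by (intro f_diff) auto
          also have "\<dots> \<le> C * k * exp (- (At / norm u ^ p))"
            using rat[OF x] ABC by (intro mult_right_mono mult_left_mono) auto
          finally show ?thesis .
        qed
        show "norm (f r i x u) \<le> Q * k" if "i \<in> IL" "u \<in> US i" "norm u \<le> \<eta>0 / 2" for i u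
          using bnd[OF x that(1,2)] that \<eta>0 by simp
      qed (use \<eta>0 in simp)
      thus ?thesis using RS by blast
    qed simp
  qed
  from choice[OF this] obtain a' where a': "\<And>x n. norm x < r0 \<Longrightarrow> norm (a' x n) \<le> Kc * (gw p At n * gev p n)"
    "\<And>x N i z. norm x < r0 \<Longrightarrow> i \<in> IL \<Longrightarrow> z \<in> US i \<Longrightarrow> norm z \<le> 1/2 * (\<eta>0 / 2) \<Longrightarrow>
            norm (f r i x z - (\<Sum>n<N. a' x n * z ^ n)) \<le> Kc * (gw p At N * gev p N) * norm z ^ N"
    unfolding gevrey_expansion_on_def by blast
  \<comment> \<open>The theorem controls |\<eta>| \<le> \<eta>0/4; the remaining \<eta> are treated
    by \<open>gevrey_tail\<close>.\<close>
  have R4: "\<eta>0 / 4 > 0" using \<eta>0 by simp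
  obtain Kt where Kt: "Kt > 0" "\<And>N n c (z :: complex) (F :: complex) W. \<lbrakk>\<And>m. norm (c m) \<le> Kc * (W * (gw p At m * gev p (m + n))); norm F \<le> Q * k * (W * gev p n); \<eta>0 / 4 \<le> norm z; W \<ge> 0\<rbrakk>
      \<Longrightarrow> norm (F - (\<Sum>m<N. c m * z ^ m)) \<le> Kt * (W * (gw p At N * gev p (N + n))) * norm z ^ N"
    using gevrey_tail[OF At_pos p R4 Q1 less_imp_le[OF Kc]] by blast
  define K where "K = Kc + Kt"
  have rem: "norm (f r l x \<eta> - (\<Sum>n<N. a' x n * \<eta> ^ n)) \<le> K * (gw p At N * gev p N) * norm \<eta> ^ N"
    if "norm x < r0" "l \<in> IL" "\<eta> \<in> US l" "norm \<eta> < \<eta>0" for x l \<eta> N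
  proof -
    have "norm (f r l x \<eta> - (\<Sum>n<N. a' x n * \<eta> ^ n)) \<le> max Kc Kt * (gw p At N * gev p N) * norm \<eta> ^ N"
    proof (cases "norm \<eta> \<le> \<eta>0 / 4")
      case True
      have "norm (f r l x \<eta> - (\<Sum>n<N. a' x n * \<eta> ^ n)) \<le> Kc * (gw p At N * gev p N) * norm \<eta> ^ N"
        using a'(2) that True by simp
      also have "\<dots> \<le> max Kc Kt * (gw p At N * gev p N) * norm \<eta> ^ N" by (intro mult_right_mono) auto
      finally show ?thesis .
    next
      case False
      have "norm (f r l x \<eta> - (\<Sum>n<N. a' x n * \<eta> ^ n)) \<le> Kt * (1 * (gw p At N * gev p (N + 0))) * norm \<eta> ^ N"
        by (rule Kt(2)) (use a'(1) bnd that False in auto)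
      also have "\<dots> \<le> max Kc Kt * (gw p At N * gev p N) * norm \<eta> ^ N" unfolding mult_1 add_0_right by (intro mult_right_mono) auto
      finally show ?thesis .
    qed
    also have "\<dots> \<le> K * (gw p At N * gev p N) * norm \<eta> ^ N"
      using Kc Kt by (intro mult_right_mono) (auto simp: K_def)
    finally show ?thesis .
  qed
  show ?thesis
  proof (rule that[of K "\<lambda>n x. a' x n"])
    show "K > 0" using Kc Kt by (simp add: K_def)
    show "norm (a' x n) \<le> K * (gw p At n * gev p n)" if "norm x < r0" for n x
      by (rule order_trans[OF a'(1)[OF that] mult_right_mono]) (use Kt in \<open>auto simp: K_def\<close>)
    show "(\<lambda>x. a' x n) holomorphic_on ball 0 r0" for n
    proof -
      obtain l \<eta> where l: "l \<in> IL" and \<eta>: "\<eta> \<longlonglongrightarrow> 0" "\<And>k::nat. \<eta> k \<noteq> 0 \<and> \<eta> k \<in> US l \<and> norm (\<eta> k) < \<eta>0"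
        using ex_eta_seq[OF \<eta>0] by blast
      show ?thesis
      proof (rule expansion_coeff_holomorphic[where \<eta>=\<eta> and \<Phi>="\<lambda>k x. f r l x (\<eta> k)" and g="\<lambda>n x. a' x n"])
        show "(\<lambda>x. f r l x (\<eta> k)) holomorphic_on ball 0 r0" for k
          by (rule f_holomorphic[OF l r]) (use \<eta>(2) r in \<open>auto intro!: holomorphic_intros\<close>)
        show "\<exists>C. \<forall>k. \<forall>x\<in>ball 0 r0. norm (f r l x (\<eta> k) - (\<Sum>n<N. a' x n * \<eta> k ^ n)) \<le> C * norm (\<eta> k) ^ N" for N
          by (rule exI[of _ "K * (gw p At N * gev p N)"]) (use rem l \<eta>(2) in auto)
      qed (use \<eta> in auto)
    qed
  qed (use rem in blast)
qed

lemma inner_expansion: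
  assumes r: "r0 < ra" "ra < rb" "rb < rc" "rc < r1"
  obtains g K where "K > 0" "\<And>j n. j \<in> IJ \<Longrightarrow> g j n holomorphic_on V j"
    "\<And>j n X. j \<in> IJ \<Longrightarrow> X \<in> V j \<Longrightarrow> norm (g j n X) \<le> K * (gw p At n * gev p n)"
    "\<And>j l X \<eta> N. j \<in> IJ \<Longrightarrow> l \<in> IL \<Longrightarrow> X \<in> V j \<Longrightarrow> \<eta> \<in> US l \<Longrightarrow> norm \<eta> < \<eta>0 \<Longrightarrow> norm (\<eta> * X) < r0 \<Longrightarrow>
       norm (y j l (\<eta> * X) \<eta> - f rc l (\<eta> * X) \<eta> - (\<Sum>n<N. g j n X * \<eta> ^ n)) \<le> K * (gw p At N * gev p N) * norm \<eta> ^ N"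
proof -
  interpret cs: cone_cover IL US KS by (rule coverS)
  define kc where "kc = rc / (rc - rb)"
  define ka where "ka = ra / (rb - ra)"
  have k0: "kc > 0" "ka > 0" using r r01 by (auto simp: kc_def ka_def)
  have pos: "0 < ra" "0 < rb" "0 < rc" using r r01 by auto
  have ratc: "rc / \<bar>rc - norm x\<bar> \<le> kc" if "norm x \<le> rb" for x :: complex
    unfolding kc_def by (rule ratio_le) (use that r pos in auto)
  have rata: "ra / \<bar>ra - norm x\<bar> \<le> ka" if "rb \<le> norm x" for x :: complex
    unfolding ka_def by (rule ratio_le') (use that r pos in auto)
  obtain Kj where Kj: "Kj > 0"
   "\<And>j l X \<eta>. j \<in> IJ \<Longrightarrow> l \<in> IL \<Longrightarrow> \<eta> \<in> US l \<Longrightarrow> norm \<eta> < \<eta>0 \<Longrightarrow> X \<in> V j \<Longrightarrow> norm (\<eta> * X) = rb \<Longrightarrow>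
     norm (y j l (\<eta> * X) \<eta> - f rc l (\<eta> * X) \<eta> + f ra l (\<eta> * X) \<eta>) \<le> Kj * exp (- (At / norm \<eta> ^ p))"
    using f_jump[OF r] by blast
  \<comment> \<open>Sum of all flat differences that occur: those of y, of the transform over rc, of
    the one over ra, and the mismatch \<open>Kj\<close> of \<open>f_jump\<close>. Likewise
    \<open>Q2\<close> for the sizes.\<close>
  define C2 where "C2 = C + C * kc + C * ka + Kj"
  define Q2 where "Q2 = Q + Q * kc + Q * ka"
  have C2: "C2 \<ge> 0" "C + C * kc \<le> C2" "C * ka \<le> C2" "Kj \<le> C2" and Q2: "Q2 \<ge> 0" "Q + Q * kc \<le> Q2" "Q * ka \<le> Q2"
    using ABC Q k0 Kj by (auto simp: C2_def Q2_def)
  define R where "R = \<eta>0 / 2"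
  have R0: "R > 0" "R < \<eta>0" using \<eta>0 by (auto simp: R_def)
  \<comment> \<open>In the second case below \<rho> = rb/|X|, so |\<eta>X| < r0 means |\<eta>| <
    (r0/rb) \<rho>; in the first case \<rho> = R and the points with |\<eta>| \<le> R/2 have to be
    reached.\<close>
  define \<kappa> where "\<kappa> = max (1/2) (r0 / rb)"
  have \<kappa>: "0 < \<kappa>" "\<kappa> < 1" using r r01 by (auto simp: \<kappa>_def)
  obtain Kc where Kc: "Kc > 0" and RS: "\<forall>F G \<rho>. two_zone_family IL US R \<rho> (\<lambda>r. C2 * exp (- (At / r ^ p))) Q2 F G \<longrightarrow>
      (\<exists>c. gevrey_expansion_on p At Kc IL US (\<kappa> * \<rho>) F c)"
    using cs.gevrey_ramis_sibuya[OF At_pos p R0(1) \<kappa> C2(1) Q2(1)] by (elim exE conjE) (rule that)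
  define F where "F j X l u = y j l (u * X) u - f rc l (u * X) u" for j X l u
  have Fhol: "F j X l holomorphic_on US l \<inter> {u. norm u < \<rho>1}"
    if "j \<in> IJ" "X \<in> V j" "l \<in> IL" "\<rho>1 \<le> \<eta>0" "\<And>u. norm u < \<rho>1 \<Longrightarrow> norm (u * X) < rc" for j X l \<rho>1
  proof -
    have op: "open (US l \<inter> {u. norm u < \<rho>1})"
      using that by (intro open_Int open_US open_Collect_less continuous_intros)
    have 1: "(\<lambda>u. y j l (u * X) u) holomorphic_on US l \<inter> {u. norm u < \<rho>1}"
      by (rule y_hol[OF that(1,3) op]) (use that r in \<open>force intro!: holomorphic_intros dom_inner\<close>)+
    have 2: "(\<lambda>u. f rc l (u * X) u) holomorphic_on US l \<inter> {u. norm u < \<rho>1}"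
    proof (rule f_holomorphic[OF that(3) _ _ op])
      show "t \<in> US l \<and> norm t < \<eta>0 \<and> norm (t * X) \<noteq> rc" if t: "t \<in> US l \<inter> {u. norm u < \<rho>1}" for t
        using t \<open>\<rho>1 \<le> \<eta>0\<close> \<open>\<And>u. norm u < \<rho>1 \<Longrightarrow> norm (u * X) < rc\<close>[of t] by auto
    qed (use r in \<open>auto intro!: holomorphic_intros\<close>)
    show ?thesis unfolding F_def by (intro holomorphic_intros 1 2)
  qed
  have Fbnd: "norm (F j X l u) \<le> Q2"
    if "j \<in> IJ" "X \<in> V j" "l \<in> IL" "u \<in> US l" "norm u < \<eta>0" "norm (u * X) \<le> rb" for j X l u
  proof -
    have "norm (y j l (u * X) u) \<le> Q"
      by (intro y_bound dom_inner) (use that r in auto)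
    moreover have "norm (f rc l (u * X) u) \<le> Q * kc"
      by (rule order_trans[OF f_bound mult_left_mono[OF ratc Q]]) (use that r in auto)
    ultimately show ?thesis using Q2(2) norm_triangle_ineq4[of "y j l (u * X) u" "f rc l (u * X) u"] unfolding F_def by linarith
  qed
  have Fdiff: "norm (F j X l u - F j X l' u) \<le> C2 * exp (- (At / norm u ^ p))"
    if "j \<in> IJ" "X \<in> V j" "l \<in> IL" "l' \<in> IL" "u \<in> US l" "u \<in> US l'" "norm u < \<eta>0" "norm (u * X) \<le> rb" for j X l l' u
  proof -
    let ?e = "exp (- (At / norm u ^ p))"
    have "norm (y j l (u * X) u - y j l' (u * X) u) \<le> C * exp (- (A / norm u ^ p))"
      by (rule diff_inner_l) (use that r in auto)
    also have "\<dots> \<le> C * ?e" using ABC by (intro mult_left_mono) (auto simp: At_def intro!: divide_right_mono)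
    finally have 1: "norm (y j l (u * X) u - y j l' (u * X) u) \<le> C * ?e" .
    have 2: "norm (f rc l (u * X) u - f rc l' (u * X) u) \<le> C * kc * ?e"
      by (rule order_trans[OF f_diff mult_right_mono[OF mult_left_mono[OF ratc]]]) (use that r ABC in auto)
    have "F j X l u - F j X l' u = (y j l (u * X) u - y j l' (u * X) u) - (f rc l (u * X) u - f rc l' (u * X) u)"
      by (simp add: F_def)
    hence "norm (F j X l u - F j X l' u) \<le> norm (y j l (u * X) u - y j l' (u * X) u) + norm (f rc l (u * X) u - f rc l' (u * X) u)"
      using norm_triangle_ineq4 by simp
    also have "\<dots> \<le> C * ?e + C * kc * ?e" by (rule add_mono[OF 1 2])
    finally have "norm (F j X l u - F j X l' u) \<le> C * ?e + C * kc * ?e" .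
    also have "\<dots> = (C + C * kc) * ?e" by (simp add: algebra_simps)
    also have "\<dots> \<le> C2 * ?e" using C2 by (intro mult_right_mono) auto
    finally show ?thesis .
  qed
  define E where "E j X c \<longleftrightarrow> (\<forall>n. norm (c n) \<le> Kc * (gw p At n * gev p n)) \<and>
         (\<forall>N l z. l \<in> IL \<longrightarrow> z \<in> US l \<longrightarrow> norm z \<le> R / 2 \<longrightarrow> norm (z * X) < r0 \<longrightarrow>
            norm (F j X l z - (\<Sum>n<N. c n * z ^ n)) \<le> Kc * (gw p At N * gev p N) * norm z ^ N)" for j X c
  \<comment> \<open>\<open>\<eta>X\<close> stays in the disc for all \<open>|\<eta>| \<le> R\<close> iff \<open>|X| \<le> rb/R\<close>; otherwise \<open>- f ra\<close> continues \<open>F\<close> beyond \<open>|\<eta>| = rb/|X|\<close>\<close>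
  have ex: "\<exists>c. E j X c"
    if j: "j \<in> IJ" and X: "X \<in> V j" for j X
  proof (cases "norm X \<le> rb / R")
    case True
    define \<rho>1 where "\<rho>1 = min \<eta>0 (R * rc / rb)"
    have uX: "norm (u * X) < rc" if "norm u < \<rho>1" for u
    proof -
      have "norm (u * X) \<le> norm u * (rb / R)" unfolding norm_mult using True by (intro mult_left_mono) auto
      also have "\<dots> < (R * rc / rb) * (rb / R)" using that pos R0 by (intro mult_strict_right_mono) (auto simp: \<rho>1_def)
      also have "\<dots> = rc" using pos R0 by simp
      finally show ?thesis .
    qed
    have uX': "norm (u * X) \<le> rb" if "norm u \<le> R" for u
    proof -
      have "norm (u * X) \<le> R * (rb / R)" unfolding norm_mult using True that R0 by (intro mult_mono) auto
      thus ?thesis using R0 by simp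
    qed
    have "R * 1 < R * (rc / rb)" using R0 pos r by (intro mult_strict_left_mono) auto
    hence \<rho>1: "R < \<rho>1" "\<rho>1 \<le> \<eta>0" using R0 by (auto simp: \<rho>1_def)
    have "two_zone_family IL US R R (\<lambda>r. C2 * exp (- (At / r ^ p))) Q2 (F j X) (F j X)"
    proof (rule two_zone_family_const[where T=\<rho>1])
      show "F j X l holomorphic_on US l \<inter> {u. norm u < \<rho>1}" if "l \<in> IL" for l
        by (rule Fhol[OF j X that \<rho>1(2) uX])
      show "norm (F j X l u - F j X l' u) \<le> C2 * exp (- (At / norm u ^ p))"
        if "l \<in> IL" "l' \<in> IL" "u \<in> US l" "u \<in> US l'" "norm u \<le> R" for l l' u
        by (rule Fdiff[OF j X that(1-4) _ uX']) (use that R0 in auto)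
      show "norm (F j X l u) \<le> Q2" if "l \<in> IL" "u \<in> US l" "norm u \<le> R" for l u
        by (rule Fbnd[OF j X that(1,2) _ uX']) (use that R0 in auto)
    qed (use R0 \<rho>1 in auto)
    then obtain c where c: "gevrey_expansion_on p At Kc IL US (\<kappa> * R) (F j X) c" using RS by blast
    moreover have "norm z \<le> \<kappa> * R" if "norm z \<le> R / 2" for z :: complex
    proof -
      have "R / 2 \<le> \<kappa> * R" using R0 mult_right_mono[of "1/2" \<kappa> R] by (simp add: \<kappa>_def)
      thus ?thesis using that by simp
    qed
    ultimately show ?thesis using c unfolding gevrey_expansion_on_def E_def by (intro exI[of _ c]) blast
  next
    case False
    have X0: "norm X > 0" using False pos R0 by (smt (verit) divide_pos_pos)
    define \<rho> where "\<rho> = rb / norm X"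
    define \<rho>1 where "\<rho>1 = min \<eta>0 (rc / norm X)"
    have \<rho>: "0 < \<rho>" "\<rho> \<le> R" using pos X0 False R0 by (auto simp: \<rho>_def field_simps)
    have "rb / norm X < rc / norm X" "ra / norm X < rb / norm X" using X0 r by (auto intro!: divide_strict_right_mono)
    hence \<rho>1: "\<rho> < \<rho>1" "\<rho>1 \<le> \<eta>0" "ra / norm X < \<rho>" using \<rho> R0 by (auto simp: \<rho>1_def \<rho>_def)
    have uX: "norm (u * X) < rc" if "norm u < \<rho>1" for u
    proof -
      have "norm u < rc / norm X" using that by (simp add: \<rho>1_def)
      thus ?thesis using X0 by (simp add: norm_mult pos_less_divide_eq)
    qed
    have uX': "norm (u * X) \<le> rb" if "norm u \<le> \<rho>" for u
      using that X0 by (simp add: norm_mult \<rho>_def pos_le_divide_eq)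
    have uX'': "rb \<le> norm (u * X)" if "\<rho> \<le> norm u" for u
      using that X0 by (simp add: norm_mult \<rho>_def pos_divide_le_eq)
    have "two_zone_family IL US R \<rho> (\<lambda>r. C2 * exp (- (At / r ^ p))) Q2 (F j X) (\<lambda>l u. - f ra l (u * X) u)"
    proof (rule two_zone_familyI[where \<sigma>="ra / norm X" and \<tau>=\<rho>1 and T=\<eta>0 and Qi=Q2])
      show "F j X l holomorphic_on US l \<inter> {u. norm u < \<rho>1}" if "l \<in> IL" for l
        by (rule Fhol[OF j X that \<rho>1(2) uX])
      show "norm (F j X l u - F j X l' u) \<le> C2 * exp (- (At / norm u ^ p))"
        if "l \<in> IL" "l' \<in> IL" "u \<in> US l" "u \<in> US l'" "norm u \<le> \<rho>" for l l' u
        by (rule Fdiff[OF j X that(1-4) _ uX']) (use that R0 \<rho> in auto)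
      show "norm (F j X l u) \<le> Q2" if "l \<in> IL" "u \<in> US l" "norm u \<le> \<rho>" for l u
        by (rule Fbnd[OF j X that(1,2) _ uX']) (use that R0 \<rho> in auto)
      show "(\<lambda>u. - f ra l (u * X) u) holomorphic_on US l \<inter> {u. ra / norm X < norm u \<and> norm u < \<eta>0}" if "l \<in> IL" for l
      proof (intro holomorphic_on_minus f_holomorphic[OF that])
        show "open (US l \<inter> {u. ra / norm X < norm u \<and> norm u < \<eta>0})"
          using that by (intro open_Int open_US open_Collect_conj open_Collect_less continuous_intros)
        show "t \<in> US l \<and> norm t < \<eta>0 \<and> norm (t * X) \<noteq> ra" if "t \<in> US l \<inter> {u. ra / norm X < norm u \<and> norm u < \<eta>0}" for t
          using that X0 by (auto simp: norm_mult pos_divide_less_eq)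
      qed (use r in \<open>auto intro!: holomorphic_intros\<close>)
      show "norm (- f ra i (u * X) u - - f ra l (u * X) u) \<le> C2 * exp (- (At / norm u ^ p))"
        if "i \<in> IL" "l \<in> IL" "u \<in> US i" "u \<in> US l" "\<rho> \<le> norm u" "norm u \<le> R" for i l u
      proof -
        have "norm (f ra i (u * X) u - f ra l (u * X) u) \<le> C * (ra / \<bar>ra - norm (u * X)\<bar>) * exp (- (At / norm u ^ p))"
          by (rule f_diff) (use that R0 r uX''[of u] in auto)
        also have "\<dots> \<le> C2 * exp (- (At / norm u ^ p))"
        proof (rule mult_right_mono)
          have "C * (ra / \<bar>ra - norm (u * X)\<bar>) \<le> C * ka" using rata[OF uX''] that ABC by (intro mult_left_mono) auto
          thus "C * (ra / \<bar>ra - norm (u * X)\<bar>) \<le> C2" using C2 by linarith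
        qed simp
        finally show ?thesis by (simp add: norm_minus_commute)
      qed
      \<comment> \<open>On |u| = \<rho> the point uX has modulus rb, exactly where
        \<open>f_jump\<close> identifies y - f rc with - f ra up to a flat error.\<close>
      show "norm (F j X l u - - f ra l (u * X) u) \<le> C2 * exp (- (At / norm u ^ p))"
        if "l \<in> IL" "u \<in> US l" "norm u = \<rho>" for l u
      proof -
        have "norm (u * X) = rb" using that uX'[of u] uX''[of u] by simp
        hence "norm (F j X l u - - f ra l (u * X) u) \<le> Kj * exp (- (At / norm u ^ p))"
          unfolding F_def using Kj(2)[OF j that(1,2) _ X] that \<rho> R0 by simp
        also have "\<dots> \<le> C2 * exp (- (At / norm u ^ p))" using C2 by (intro mult_right_mono) auto
        finally show ?thesis .
      qed
      show "norm (- f ra l (u * X) u) \<le> Q2" if "l \<in> IL" "u \<in> US l" "norm u = R" for l u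
      proof -
        have u: "rb \<le> norm (u * X)" using uX''[of u] that \<rho> by simp
        have "norm (f ra l (u * X) u) \<le> Q * (ra / \<bar>ra - norm (u * X)\<bar>)"
          by (rule f_bound) (use that R0 r u in auto)
        also have "\<dots> \<le> Q * ka" using rata[OF u] Q by (intro mult_left_mono) auto
        finally show ?thesis using Q2 by simp
      qed
    qed (use R0 \<rho> \<rho>1 pos X0 in auto)
    then obtain c where c: "gevrey_expansion_on p At Kc IL US (\<kappa> * \<rho>) (F j X) c" using RS by blast
    moreover have "norm z \<le> \<kappa> * \<rho>" if "norm (z * X) < r0" for z :: complex
    proof -
      have "norm z \<le> r0 / norm X" using that X0 by (simp add: norm_mult pos_le_divide_eq)
      also have "\<dots> = (r0 / rb) * \<rho>" using pos by (simp add: \<rho>_def)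
      also have "\<dots> \<le> \<kappa> * \<rho>" using \<rho> by (intro mult_right_mono) (auto simp: \<kappa>_def)
      finally show ?thesis .
    qed
    ultimately show ?thesis using c unfolding gevrey_expansion_on_def E_def by (intro exI[of _ c]) blast
  qed
  have "\<forall>j X. \<exists>c. j \<in> IJ \<and> X \<in> V j \<longrightarrow> E j X c"
    using ex by blast
  then obtain g' where "\<forall>j X. j \<in> IJ \<and> X \<in> V j \<longrightarrow> E j X (g' j X)"
    unfolding choice_iff by blast
  hence g': "\<And>j X n. j \<in> IJ \<Longrightarrow> X \<in> V j \<Longrightarrow> norm (g' j X n) \<le> Kc * (gw p At n * gev p n)"
    "\<And>j X N l z. j \<in> IJ \<Longrightarrow> X \<in> V j \<Longrightarrow> l \<in> IL \<Longrightarrow> z \<in> US l \<Longrightarrow> norm z \<le> R / 2 \<Longrightarrow> norm (z * X) < r0 \<Longrightarrow>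
            norm (F j X l z - (\<Sum>n<N. g' j X n * z ^ n)) \<le> Kc * (gw p At N * gev p N) * norm z ^ N"
    unfolding E_def by blast+
  have R4: "R / 2 > 0" using R0 by simp
  obtain Kt where Kt: "Kt > 0" "\<And>N n c (z :: complex) (F :: complex) W. \<lbrakk>\<And>m. norm (c m) \<le> Kc * (W * (gw p At m * gev p (m + n))); norm F \<le> Q2 * (W * gev p n); R / 2 \<le> norm z; W \<ge> 0\<rbrakk>
      \<Longrightarrow> norm (F - (\<Sum>m<N. c m * z ^ m)) \<le> Kt * (W * (gw p At N * gev p (N + n))) * norm z ^ N"
    using gevrey_tail[OF At_pos p R4 Q2(1) less_imp_le[OF Kc]] by blast
  define K where "K = Kc + Kt"
  have rem: "norm (F j X l \<eta> - (\<Sum>n<N. g' j X n * \<eta> ^ n)) \<le> K * (gw p At N * gev p N) * norm \<eta> ^ N"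
    if "j \<in> IJ" "l \<in> IL" "X \<in> V j" "\<eta> \<in> US l" "norm \<eta> < \<eta>0" "norm (\<eta> * X) < r0" for j l X \<eta> N
  proof -
    have "norm (F j X l \<eta> - (\<Sum>n<N. g' j X n * \<eta> ^ n)) \<le> max Kc Kt * (gw p At N * gev p N) * norm \<eta> ^ N"
    proof (cases "norm \<eta> \<le> R / 2")
      case True
      have "norm (F j X l \<eta> - (\<Sum>n<N. g' j X n * \<eta> ^ n)) \<le> Kc * (gw p At N * gev p N) * norm \<eta> ^ N"
        using g'(2) that True by blast
      also have "\<dots> \<le> max Kc Kt * (gw p At N * gev p N) * norm \<eta> ^ N" by (intro mult_right_mono) auto
      finally show ?thesis .
    next
      case False
      have "norm (F j X l \<eta>) \<le> Q2" using that r by (intro Fbnd) auto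
      hence "norm (F j X l \<eta> - (\<Sum>n<N. g' j X n * \<eta> ^ n)) \<le> Kt * (1 * (gw p At N * gev p (N + 0))) * norm \<eta> ^ N"
        by (intro Kt(2)) (use g'(1) that False in auto)
      also have "\<dots> \<le> max Kc Kt * (gw p At N * gev p N) * norm \<eta> ^ N" unfolding mult_1 add_0_right by (intro mult_right_mono) auto
      finally show ?thesis .
    qed
    also have "\<dots> \<le> K * (gw p At N * gev p N) * norm \<eta> ^ N"
      using Kc Kt by (intro mult_right_mono) (auto simp: K_def)
    finally show ?thesis .
  qed
  show ?thesis
  proof (rule that[of K "\<lambda>j n X. g' j X n"])
    show "K > 0" using Kc Kt by (simp add: K_def)
    show "norm (g' j X n) \<le> K * (gw p At n * gev p n)" if "j \<in> IJ" "X \<in> V j" for j n X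
      by (rule order_trans[OF g'(1)[OF that] mult_right_mono]) (use Kt in \<open>auto simp: K_def\<close>)
    show "(\<lambda>X. g' j X n) holomorphic_on V j" if j: "j \<in> IJ" for j n
    proof -
      \<comment> \<open>A sequence \<eta>_k with |\<eta>_k X| < r0 for all k can be chosen uniformly
        only for bounded X, hence the exhaustion by balls.\<close>
      have "(\<lambda>X. g' j X n) holomorphic_on V j \<inter> ball 0 T" if T: "T > 0" for T
      proof -
        have e: "min \<eta>0 (r0 / T) > 0" using \<eta>0 r01 T by simp
        obtain l \<eta> where l: "l \<in> IL" and \<eta>: "\<eta> \<longlonglongrightarrow> 0" "\<And>k::nat. \<eta> k \<noteq> 0 \<and> \<eta> k \<in> US l \<and> norm (\<eta> k) < min \<eta>0 (r0 / T)"
          using ex_eta_seq[OF e] by blast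
        have \<eta>X: "norm (\<eta> k * X) < r0" if "X \<in> ball 0 T" for k X
        proof -
          have "norm (\<eta> k * X) \<le> norm (\<eta> k) * T" unfolding norm_mult using that by (intro mult_left_mono) auto
          also have "\<dots> < r0" using \<eta>(2)[of k] T by (simp add: pos_less_divide_eq)
          finally show ?thesis .
        qed
        have op: "open (V j \<inter> ball 0 T)" using open_V[OF j] by auto
        show ?thesis
        proof (rule expansion_coeff_holomorphic[OF op, where \<eta>=\<eta> and \<Phi>="\<lambda>k X. F j X l (\<eta> k)" and g="\<lambda>n X. g' j X n"])
          show "(\<lambda>X. F j X l (\<eta> k)) holomorphic_on V j \<inter> ball 0 T" for k
            unfolding F_def
          proof (rule holomorphic_on_diff)
            show "(\<lambda>X. y j l (\<eta> k * X) (\<eta> k)) holomorphic_on V j \<inter> ball 0 T"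
              by (rule y_hol[OF j l op, of "\<lambda>X. \<eta> k * X" "\<lambda>X. \<eta> k"])
                 (use \<eta>(2)[of k] \<eta>X[of _ k] r01 in \<open>auto intro!: holomorphic_intros dom_inner j l dest: less_trans\<close>)
            show "(\<lambda>X. f rc l (\<eta> k * X) (\<eta> k)) holomorphic_on V j \<inter> ball 0 T"
            proof (rule f_holomorphic[OF l _ _ op, of rc "\<lambda>X. \<eta> k * X" "\<lambda>X. \<eta> k"])
              show "\<eta> k \<in> US l \<and> norm (\<eta> k) < \<eta>0 \<and> norm (\<eta> k * X) \<noteq> rc" if "X \<in> V j \<inter> ball 0 T" for X
                using \<eta>(2)[of k] \<eta>X[of X k] that r by auto
            qed (use r in \<open>auto intro!: holomorphic_intros\<close>)
          qed
          show "\<exists>C. \<forall>k. \<forall>X\<in>V j \<inter> ball 0 T. norm (F j X l (\<eta> k) - (\<Sum>n<N. g' j X n * \<eta> k ^ n)) \<le> C * norm (\<eta> k) ^ N" for N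
            by (rule exI[of _ "K * (gw p At N * gev p N)"]) (use rem[OF j l] \<eta>(2) \<eta>X in auto)
        qed (use \<eta> in auto)
      qed
      hence "(\<lambda>X. g' j X n) holomorphic_on (\<Union>T\<in>{0<..}. V j \<inter> ball 0 T)"
        by (intro holomorphic_on_UN_open open_Int open_V j) auto
      moreover have "(\<Union>T\<in>{0<..}. V j \<inter> ball 0 T) = V j"
      proof -
        have "\<exists>T>0. X \<in> ball 0 T" for X :: complex by (intro exI[of _ "norm X + 1"]) (auto simp: add_nonneg_pos)
        thus ?thesis by fastforce
      qed
      ultimately show ?thesis by simp
    qed
  qed (use rem in \<open>auto simp: F_def\<close>)
qed

end

section \<open>Differences in j and expansions at infinity\<close>

context coherent_family begin

text \<open>The function h, common to all j, cancels in the difference, so y i - y j is expanded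
  directly on the disc |\<eta>| \<le> rb/|X|. There it is O(exp(-B|X|^p)), and its differences in l
  are in addition O(exp(-A'/|\<eta>|^p)); the smaller of the two bounds is the \<open>D\<close>
  below. Its integrals are those of \<open>gevrey_max_integral\<close> with \<tau> = B|X|^p.\<close>

lemma inner_difference:
  assumes rb: "r0 < rb" "rb < r1" and K: "K > 0"
    and rem: "\<And>j l X \<eta> N. j \<in> IJ \<Longrightarrow> l \<in> IL \<Longrightarrow> X \<in> V j \<Longrightarrow> \<eta> \<in> US l \<Longrightarrow> norm \<eta> < \<eta>0 \<Longrightarrow> norm (\<eta> * X) < r0 \<Longrightarrow>
       norm (y j l (\<eta> * X) \<eta> - h l (\<eta> * X) \<eta> - (\<Sum>n<N. g j n X * \<eta> ^ n)) \<le> K * (gw p At N * gev p N) * norm \<eta> ^ N"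
  obtains K3 T where "K3 > 0" "T \<ge> T0" "T > 0"
    "\<And>i j X n. i \<in> IJ \<Longrightarrow> j \<in> IJ \<Longrightarrow> X \<in> V i \<Longrightarrow> X \<in> V j \<Longrightarrow> T < norm X \<Longrightarrow>
       norm (g i n X - g j n X) \<le> K3 * (gw p At n * dgev p B n (1 / norm X))"
proof -
  interpret cs: cone_cover IL US KS by (rule coverS)
  \<comment> \<open>Beyond T the bound in j is available (\<open>T0\<close>) and the disc of radius
    rb/|X| lies in |\<eta>| < \<eta>0.\<close>
  define T where "T = max T0 (2 * rb / \<eta>0)"
  define K3 where "K3 = 3 * C + real KS * (2 * C)"
  show ?thesis
  proof (rule that[of K3 T])
    show "K3 > 0" using ABC cs.K_pos by (simp add: K3_def add_pos_pos)
    show "T \<ge> T0" "T > 0" using T0 by (auto simp: T_def)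
    fix i j X n assume i: "i \<in> IJ" "X \<in> V i" and j: "j \<in> IJ" "X \<in> V j" and X: "T < norm X"
    have XT: "T0 < norm X" "0 < norm X" "2 * rb / \<eta>0 < norm X" using X T0 by (auto simp: T_def)
    define \<tau> where "\<tau> = B * norm X ^ p"
    have \<tau>0: "\<tau> > 0" using XT ABC by (simp add: \<tau>_def)
    define R where "R = rb / norm X"
    have R0: "R > 0" using rb r01 XT by (simp add: R_def)
    have R\<eta>: "R < \<eta>0"
    proof -
      have "2 * rb < norm X * \<eta>0" using XT(3) \<eta>0 by (simp add: pos_divide_less_eq)
      hence "rb < \<eta>0 * norm X" using rb r01 by (simp add: mult.commute)
      thus ?thesis using XT by (simp add: R_def pos_divide_less_eq)
    qed
    define T1 where "T1 = min \<eta>0 (r1 / norm X)"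
    have RT1: "R < T1" using R\<eta> rb XT by (simp add: T1_def R_def divide_strict_right_mono)
    have uX: "norm (u * X) < r1" if "norm u < T1" for u
      using that XT by (simp add: T1_def norm_mult pos_less_divide_eq)
    define F where "F l u = y i l (u * X) u - y j l (u * X) u" for l u
    define D where "D r = 2 * C * exp (- max (At / r ^ p) \<tau>)" for r
    define e where "e = exp (- \<tau>)"
    have Fb: "norm (F l u) \<le> C * e" if "l \<in> IL" "u \<in> US l" "norm u \<le> R" for l u
      unfolding F_def e_def \<tau>_def using that R\<eta> RT1 uX[of u] XT i j by (intro diff_inner_j) auto
    have tz: "two_zone_family IL US R R D (C * e) F F"
    proof (rule two_zone_family_const[OF R0 RT1])
      show "F l holomorphic_on US l \<inter> {u. norm u < T1}" if l: "l \<in> IL" for l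
      proof -
        have op: "open (US l \<inter> {u. norm u < T1})"
          using l by (intro open_Int open_US open_Collect_less continuous_intros)
        have "(\<lambda>u. y k l (u * X) u) holomorphic_on US l \<inter> {u. norm u < T1}" if "k \<in> IJ" "X \<in> V k" for k
        proof (rule y_hol[OF that(1) l op])
          show "(t * X, t) \<in> dom k l" if "t \<in> US l \<inter> {u. norm u < T1}" for t
            using that uX[of t] \<open>k \<in> IJ\<close> \<open>X \<in> V k\<close> l by (intro dom_inner) (auto simp: T1_def)
        qed (auto intro!: holomorphic_intros)
        thus ?thesis unfolding F_def using i j by (intro holomorphic_on_diff)
      qed
      show "norm (F l u - F l' u) \<le> D (norm u)" if "l \<in> IL" "l' \<in> IL" "u \<in> US l" "u \<in> US l'" "norm u \<le> R" for l l' u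
      proof -
        have u: "norm u < \<eta>0" "norm (u * X) < r1" using that R\<eta> RT1 uX[of u] by auto
        have "norm (y k l (u * X) u - y k l' (u * X) u) \<le> C * exp (- (At / norm u ^ p))" if k: "k \<in> IJ" "X \<in> V k" for k
        proof -
          have "norm (y k l (u * X) u - y k l' (u * X) u) \<le> C * exp (- (A / norm u ^ p))"
            by (rule diff_inner_l) (use k that u \<open>l \<in> IL\<close> \<open>l' \<in> IL\<close> \<open>u \<in> US l\<close> \<open>u \<in> US l'\<close> in auto)
          also have "\<dots> \<le> C * exp (- (At / norm u ^ p))"
            using ABC by (intro mult_left_mono) (auto simp: At_def intro!: divide_right_mono)
          finally show ?thesis .
        qed
        from add_mono[OF this[OF i] this[OF j]]
        have 1: "norm (F l u - F l' u) \<le> 2 * C * exp (- (At / norm u ^ p))"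
          using norm_triangle_ineq4[of "y i l (u * X) u - y i l' (u * X) u" "y j l (u * X) u - y j l' (u * X) u"]
          by (simp add: F_def algebra_simps)
        have 2: "norm (F l u - F l' u) \<le> 2 * C * exp (- \<tau>)"
          using norm_triangle_ineq4[of "F l u" "F l' u"] Fb[of l u] Fb[of l' u] that by (simp add: e_def)
        show ?thesis unfolding D_def using 1 2 by (cases "At / norm u ^ p \<le> \<tau>") (auto simp: max_def)
      qed
    qed (use Fb in auto)
    have cD: "continuous_on {0<..R} D" unfolding D_def by (intro continuous_intros) auto
    have pt: "D r \<le> (2 * C * (gw p At N * gev p N)) * r ^ N" if "r \<in> {0<..R}" for r N
    proof -
      have "D r \<le> 2 * C * exp (- (At / r ^ p))" unfolding D_def using ABC by (intro mult_left_mono) auto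
      also have "\<dots> \<le> 2 * C * (gw p At N * gev p N * r ^ N)"
        using that ABC by (intro mult_left_mono gevrey_pointwise At_pos p) auto
      finally show ?thesis by (simp add: mult_ac)
    qed
    obtain c where c: "\<And>n J. (\<forall>e\<in>{0<..<R}. integral {e..R} (\<lambda>r. D r / r ^ (n + 1)) \<le> J) \<Longrightarrow>
              norm (c n) \<le> C * e / R ^ n + real KS * J + D R / R ^ n"
      and crem: "\<And>N J s \<kappa> i z. (\<forall>e\<in>{0<..<R}. integral {e..R} (\<lambda>r. D r / r ^ (N + 1)) \<le> J) \<Longrightarrow>
              (\<forall>r\<in>{0<..R}. D r \<le> s * r ^ N) \<Longrightarrow> 0 < \<kappa> \<Longrightarrow> \<kappa> < 1 \<Longrightarrow> i \<in> IL \<Longrightarrow> z \<in> US i \<Longrightarrow> norm z \<le> \<kappa> * R \<Longrightarrow>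
              norm (F i z - (\<Sum>n<N. c n * z ^ n)) \<le> (C * e / R ^ N / (1 - \<kappa>) + real KS / cs.gap * J + 2 * s / (1 - \<kappa>)) * norm z ^ N"
      using cs.ramis_sibuya_two_zone[OF tz cD] pt by blast
    have crem': "\<exists>b. \<forall>l\<in>IL. \<forall>z\<in>US l. norm z \<le> R / 2 \<longrightarrow> norm (F l z - (\<Sum>n<N. c n * z ^ n)) \<le> b * norm z ^ N" for N
    proof -
      define E1 where "E1 = 2 * C * (gw p At (N + 1) * gev p (N + 1))"
      have E1: "E1 \<ge> 0" using ABC by (simp add: E1_def)
      have J: "integral {d..R} (\<lambda>r. D r / r ^ (N + 1)) \<le> E1 * R" if d: "d \<in> {0<..<R}" for d
      proof -
        have "integral {d..R} (\<lambda>r. D r / r ^ (N + 1)) \<le> integral {d..R} (\<lambda>r. E1)"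
        proof (rule integral_le)
          show "(\<lambda>r. D r / r ^ (N + 1)) integrable_on {d..R}"
            using d by (intro integrable_continuous_real continuous_intros continuous_on_subset[OF cD]) auto
          show "D r / r ^ (N + 1) \<le> E1" if "r \<in> {d..R}" for r
            using pt[of r "N + 1"] that d by (simp add: pos_divide_le_eq E1_def del: power_Suc)
        qed auto
        also have "\<dots> = E1 * (R - d)" using d by simp
        also have "\<dots> \<le> E1 * R" using d E1 by (intro mult_left_mono) auto
        finally show ?thesis .
      qed
      show ?thesis
      proof (intro exI ballI impI)
        fix l z assume "l \<in> IL" "z \<in> US l" "norm z \<le> R / 2"
        thus "norm (F l z - (\<Sum>n<N. c n * z ^ n)) \<le> (C * e / R ^ N / (1 - 1/2) + real KS / cs.gap * (E1 * R)
            + 2 * (2 * C * (gw p At N * gev p N)) / (1 - 1/2)) * norm z ^ N"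
          using J pt[of _ N] by (intro crem) auto
      qed
    qed
    \<comment> \<open>The coefficients produced for the difference on the small disc and the
      differences of the g_n expand the same function, so they coincide by uniqueness. For this any
      constant in the remainder will do, as in \<open>crem'\<close>.\<close>
    have ceq: "c m = g i m X - g j m X" for m
    proof -
      obtain l \<theta> where l: "l \<in> IL" "\<And>r. r > 0 \<Longrightarrow> of_real r * cis \<theta> \<in> US l" using ex_direction by blast
      define e0 where "e0 = min (R / 2) (r0 / (2 * norm X))"
      have e0: "e0 > 0" using R0 r01 XT by (simp add: e0_def)
      show ?thesis
      proof (rule expansion_coeffs_unique[OF e0, where d="\<lambda>m. g i m X - g j m X"])
        fix N
        obtain b where b: "\<And>z. z \<in> US l \<Longrightarrow> norm z \<le> R / 2 \<Longrightarrow> norm (F l z - (\<Sum>n<N. c n * z ^ n)) \<le> b * norm z ^ N"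
          using crem'[of N] l(1) by blast
        let ?k = "K * (gw p At N * gev p N)"
        show "\<exists>C. \<forall>r\<in>{0<..e0}. \<exists>z. norm z = r \<and> norm (\<Sum>n<N. (c n - (g i n X - g j n X)) * z ^ n) \<le> C * r ^ N"
        proof (intro exI[of _ "b + 2 * ?k"] ballI)
          fix r assume r: "r \<in> {0<..e0}"
          define z where "z = of_real r * cis \<theta>"
          have z: "norm z = r" "z \<in> US l" using r l(2)[of r] by (auto simp: z_def norm_mult)
          have "r \<le> r0 / (2 * norm X)" "r \<le> R / 2" using r by (auto simp: e0_def)
          hence "r * norm X \<le> r0 / 2" using XT by (simp add: field_simps)
          hence zX: "norm (z * X) < r0" using r01 z by (simp add: norm_mult)
          have z\<eta>: "norm z < \<eta>0" using z \<open>r \<le> R / 2\<close> R\<eta> R0 by simp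
          define Sc where "Sc = (\<Sum>n<N. c n * z ^ n)"
          define Si where "Si = (\<Sum>n<N. g i n X * z ^ n)"
          define Sj where "Sj = (\<Sum>n<N. g j n X * z ^ n)"
          have b': "norm (F l z - Sc) \<le> b * r ^ N" using b[OF z(2)] z \<open>r \<le> R / 2\<close> by (simp add: Sc_def)
          have ri: "norm (y i l (z * X) z - h l (z * X) z - Si) \<le> ?k * r ^ N"
            using rem[OF i(1) l(1) i(2) z(2) z\<eta> zX, of N] z by (simp add: Si_def)
          have rj: "norm (y j l (z * X) z - h l (z * X) z - Sj) \<le> ?k * r ^ N"
            using rem[OF j(1) l(1) j(2) z(2) z\<eta> zX, of N] z by (simp add: Sj_def)
          have "(\<Sum>n<N. (c n - (g i n X - g j n X)) * z ^ n) = Sc - Si + Sj"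
            by (simp add: Sc_def Si_def Sj_def left_diff_distrib sum_subtractf)
          also have "\<dots> = - (F l z - Sc) - (- (y i l (z * X) z - h l (z * X) z - Si)) + 0 - (y j l (z * X) z - h l (z * X) z - Sj) + 0"
            by (simp add: F_def)
          also have "norm \<dots> \<le> norm (F l z - Sc) + norm (- (y i l (z * X) z - h l (z * X) z - Si)) + norm (0::complex)
              + norm (y j l (z * X) z - h l (z * X) z - Sj) + norm (0::complex)" by (rule norm_sum5)
          also have "\<dots> \<le> (b + 2 * ?k) * r ^ N" using b' ri rj unfolding norm_minus_cancel by (simp add: algebra_simps)
          finally show "\<exists>z. norm z = r \<and> norm (\<Sum>n<N. (c n - (g i n X - g j n X)) * z ^ n) \<le> (b + 2 * ?k) * r ^ N"
            using z(1) by blast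
        qed
      qed
    qed
    have \<tau>': "B / (1 / norm X) ^ p = \<tau>" by (simp add: \<tau>_def power_divide)
    have K3C: "C \<le> K3" using ABC by (simp add: K3_def add_increasing2)
    show "norm (g i n X - g j n X) \<le> K3 * (gw p At n * dgev p B n (1 / norm X))"
    \<comment> \<open>For n = 0 the coefficient is the limit of the difference as \<eta> tends to 0
      and inherits its bound C exp(-\<tau>); the integral estimate is made for n \<ge> 1.\<close>
    proof (cases "n = 0")
      case True
      obtain l \<theta> where l: "l \<in> IL" "\<And>r. r > 0 \<Longrightarrow> of_real r * cis \<theta> \<in> US l" using ex_direction by blast
      obtain b where b: "\<And>z. z \<in> US l \<Longrightarrow> norm z \<le> R / 2 \<Longrightarrow> norm (F l z - (\<Sum>n<1. c n * z ^ n)) \<le> b * norm z ^ 1"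
        using crem'[of 1] l(1) by blast
      have "norm (c 0) \<le> C * e"
      proof (rule expansion_coeff_le[OF half_gt_zero[OF R0], where F="F l" and b'=b])
        fix r assume r: "r \<in> {0<..R / 2}"
        define z where "z = of_real r * cis \<theta>"
        have z: "norm z = r" "z \<in> US l" using r l(2)[of r] by (auto simp: z_def norm_mult)
        show "\<exists>z. norm z = r \<and> norm (F l z - (\<Sum>n<0. c n * z ^ n)) \<le> C * e * r ^ 0 \<and> norm (F l z - (\<Sum>n<Suc 0. c n * z ^ n)) \<le> b * r ^ Suc 0"
          using z b[OF z(2)] Fb[OF l(1) z(2)] r R0 by (intro exI[of _ z]) auto
      qed
      also have "\<dots> \<le> K3 * e" using K3C by (intro mult_right_mono) (auto simp: e_def)
      also have "\<dots> = K3 * (gw p At n * dgev p B n (1 / norm X))"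
        using True At_pos \<tau>0 unfolding dgev_def \<tau>' by (simp add: e_def)
      finally show ?thesis using True ceq by simp
    next
      case False
      define a where "a = real n / real p"
      have n1: "n \<ge> 1" using False by simp
      define G where "G = e * \<tau> powr a + igam a \<tau>"
      have dg: "dgev p B n (1 / norm X) = G" using False unfolding dgev_def \<tau>' by (simp add: G_def e_def a_def)
      have ig: "igam a \<tau> \<ge> 0" using \<tau>0 n1 p by (intro igam_nonneg) (auto simp: a_def)
      have J: "integral {d..R} (\<lambda>r. D r / r ^ (n + 1)) \<le> 2 * C * (gw p At n * G)" if d: "d \<in> {0<..<R}" for d
      proof -
        have "integral {d..R} (\<lambda>r. D r / r ^ (n + 1)) = 2 * C * integral {d..R} (\<lambda>r. exp (- max (At / r ^ p) \<tau>) / r ^ (n + 1))"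
          unfolding integral_mult_right[symmetric] by (simp add: D_def)
        also have "\<dots> \<le> 2 * C * (gw p At n * G)"
          using gevrey_max_integral[OF At_pos \<tau>0 p n1, of d R] d ABC unfolding G_def e_def a_def by (intro mult_left_mono) auto
        finally show ?thesis .
      qed
      \<comment> \<open>The loss R^(-n) of the small disc, about |X|^n, is paid by exp(-\<tau>): in
        terms of \<tau> it is (B rb^p)^(-n/p) \<tau>^(n/p), and At \<le> B r0^p \<le> B rb^p makes
        its type no worse than that of \<open>At\<close>.\<close>
      have eR: "e / R ^ n \<le> gw p At n * G"
      proof -
        have "1 / R ^ n = gw p (B * rb ^ p) n * \<tau> powr a"
        proof -
          have "\<tau> powr a = 1 / (gw p B n * (1 / norm X) ^ n)"
            using tau_powr[OF ABC(2) _ p, of "1 / norm X" n] XT unfolding \<tau>' a_def by simp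
          thus ?thesis using gw_mult_power[OF ABC(2) _ p, of rb n] rb r01 ABC by (simp add: R_def power_divide)
        qed
        also have "\<dots> \<le> gw p At n * \<tau> powr a"
        proof (intro mult_right_mono gw_antimono At_pos)
          have "r0 ^ p \<le> rb ^ p" using rb r01 by (intro power_mono) auto
          hence "B * r0 ^ p \<le> B * rb ^ p" using ABC by (intro mult_left_mono) auto
          thus "At \<le> B * rb ^ p" by (simp add: At_def)
        qed simp
        finally have "e * (1 / R ^ n) \<le> e * (gw p At n * \<tau> powr a)" by (intro mult_left_mono) (auto simp: e_def)
        also have "\<dots> = gw p At n * (e * \<tau> powr a)" by (simp only: mult_ac)
        also have "\<dots> \<le> gw p At n * G" using ig by (intro mult_left_mono) (auto simp: G_def)
        finally show ?thesis by simp
      qed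
      have "D R \<le> 2 * C * e" unfolding D_def e_def using ABC by (intro mult_left_mono) auto
      hence DR: "D R / R ^ n \<le> 2 * C * (e / R ^ n)" using R0 by (simp add: divide_right_mono)
      have "norm (c n) \<le> C * e / R ^ n + real KS * (2 * C * (gw p At n * G)) + D R / R ^ n"
        using J by (intro c) auto
      also have "\<dots> \<le> 3 * C * (e / R ^ n) + real KS * (2 * C * (gw p At n * G))" using DR by simp
      also have "\<dots> \<le> 3 * C * (gw p At n * G) + real KS * (2 * C * (gw p At n * G))"
        using eR ABC by (intro add_right_mono mult_left_mono) auto
      also have "\<dots> = K3 * (gw p At n * G)" by (simp add: K3_def algebra_simps)
      finally show ?thesis using ceq dg by simp
    qed
  qed
qed

text \<open>Ramis-Sibuya once more, for each n, in v = 1/X and over j instead of l. The differences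
  \<open>dgev\<close> already combine both decays, so the weights in n and M come out jointly, with
  a single Gamma((M + n)/p + 1) and a constant independent of n.\<close>

lemma expansion_at_infinity:
  assumes K2: "K2 > 0" and K3: "K3 > 0" and T: "T \<ge> T0" "T > 0"
    and hol: "\<And>j n. j \<in> IJ \<Longrightarrow> g j n holomorphic_on V j"
    and bnd: "\<And>j n X. j \<in> IJ \<Longrightarrow> X \<in> V j \<Longrightarrow> norm (g j n X) \<le> K2 * (gw p At n * gev p n)"
    and diff: "\<And>i j X n. i \<in> IJ \<Longrightarrow> j \<in> IJ \<Longrightarrow> X \<in> V i \<Longrightarrow> X \<in> V j \<Longrightarrow> T < norm X \<Longrightarrow>
       norm (g i n X - g j n X) \<le> K3 * (gw p At n * dgev p B n (1 / norm X))"
  obtains c K where "K > 0" "\<And>n m. norm (c n m) \<le> K * (gw p At n * (gw p B m * gev p (m + n)))"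
    "\<And>j n M X. j \<in> IJ \<Longrightarrow> X \<in> V j \<Longrightarrow> M \<ge> 1 \<Longrightarrow>
       norm X ^ M * norm (g j n X - (\<Sum>m<M. c n m / X ^ m)) \<le> K * (gw p At n * (gw p B M * gev p (M + n)))"
proof -
  define UI where "UI i = {v. inverse v \<in> UV i}" for i
  interpret ci: cone_cover IJ UI KV unfolding UI_def by (rule cone_cover_inverse[OF coverV])
  define R where "R = 1 / (2 * T)"
  have R0: "R > 0" "R < 1 / T" using T by (auto simp: R_def field_simps)
  have vV: "inverse v \<in> V j \<and> T < norm (inverse v)" if "j \<in> IJ" "v \<in> UI j" "norm v < 1 / T" for j v
  proof -
    have "v \<noteq> 0" using ci.zero_U that by auto
    have "norm v * T < 1" using that T by (simp add: pos_less_divide_eq)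
    hence "T < 1 / norm v" using \<open>v \<noteq> 0\<close> by (simp add: pos_less_divide_eq mult.commute)
    hence "T < norm (inverse v)" by (simp add: norm_inverse norm_divide inverse_eq_divide)
    thus ?thesis using that V_UV[OF that(1), of "inverse v"] T by (auto simp: UI_def)
  qed
  define F where "F n j v = g j n (inverse v)" for n j v
  define w where "w n N = gw p At n * (gw p B N * gev p (N + n))" for n N
  have w0: "w n N \<ge> 0" for n N by (simp add: w_def)
  define D where "D n r = K3 * (gw p At n * dgev p B n r)" for n r
  have tz: "two_zone_family IJ UI R R (D n) (K2 * (gw p At n * gev p n)) (F n) (F n)" for n
  proof (rule two_zone_family_const[OF R0])
    show "F n j holomorphic_on UI j \<inter> {u. norm u < 1 / T}" if "j \<in> IJ" for j
    proof -
      have "(g j n \<circ> inverse) holomorphic_on UI j \<inter> {u. norm u < 1 / T}"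
        by (rule holomorphic_on_compose_gen[OF _ hol[OF that, of n]])
           (use vV[OF that] ci.zero_U[OF that] in \<open>auto intro!: holomorphic_intros\<close>)
      thus ?thesis by (simp add: F_def[abs_def] o_def)
    qed
    show "norm (F n i u - F n j u) \<le> D n (norm u)" if "i \<in> IJ" "j \<in> IJ" "u \<in> UI i" "u \<in> UI j" "norm u \<le> R" for i j u
      using diff[OF that(1,2), of "inverse u" n] vV[OF that(1,3)] vV[OF that(2,4)] that R0
      by (simp add: F_def D_def norm_inverse norm_divide inverse_eq_divide)
    show "norm (F n j u) \<le> K2 * (gw p At n * gev p n)" if "j \<in> IJ" "u \<in> UI j" "norm u \<le> R" for j u
      unfolding F_def using that vV[OF that(1,2)] R0 by (intro bnd) auto
  qed
  have cD: "continuous_on {0<..R} (D n)" for n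
    unfolding D_def by (intro continuous_intros dgev_continuous ABC p)
  have pt: "D n r \<le> (K3 * (1 + real p) * w n N) * r ^ N" if "r > 0" for n r N
  proof -
    have "D n r \<le> K3 * (gw p At n * ((1 + real p) * (gw p B N * gev p (N + n)) * r ^ N))"
      unfolding D_def using K3 that by (intro mult_left_mono dgev_pointwise ABC p) auto
    thus ?thesis by (simp add: w_def mult_ac)
  qed
  have J: "integral {e..R} (\<lambda>r. D n r / r ^ (N + 1)) \<le> K3 * (1 + 2 * real p) * w n N" if "e \<in> {0<..<R}" "N \<ge> 1" for e n N
  proof -
    have "integral {e..R} (\<lambda>r. D n r / r ^ (N + 1)) = K3 * gw p At n * integral {e..R} (\<lambda>r. dgev p B n r / r ^ (N + 1))"
      unfolding integral_mult_right[symmetric] by (simp add: D_def mult_ac)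
    also have "\<dots> \<le> K3 * gw p At n * ((1 + 2 * real p) * (gw p B N * gev p (N + n)))"
      using K3 that by (intro mult_left_mono dgev_integral ABC p) auto
    finally show ?thesis by (simp add: w_def mult_ac)
  qed
  obtain K5 where K5: "K5 > 0" "\<And>N n. (1/R) ^ N * gev p n \<le> K5 * (gw p B N * gev p (N + n))"
    using power_le_gev[OF ABC(2) p, of "1/R"] R0 by auto
  have QR: "K2 * (gw p At n * gev p n) / R ^ N \<le> K2 * K5 * w n N" for n N
  proof -
    have "K2 * (gw p At n * gev p n) / R ^ N = K2 * gw p At n * ((1/R) ^ N * gev p n)" by (simp add: power_divide)
    also have "\<dots> \<le> K2 * gw p At n * (K5 * (gw p B N * gev p (N + n)))" using K2 by (intro mult_left_mono K5) auto
    finally show ?thesis by (simp add: w_def mult_ac)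
  qed
  define KA where "KA = 2 * (K2 * K5) + real KV / ci.gap * (K3 * (1 + 2 * real p)) + 4 * (K3 * (1 + real p)) + K2"
  have KA: "KA > 0" "K2 \<le> KA" unfolding KA_def using K2 K3 K5 ci.gap_pos
    by (auto intro!: add_nonneg_pos add_nonneg_nonneg)
  have "\<exists>c. \<forall>N. \<forall>j\<in>IJ. \<forall>z\<in>UI j. norm z \<le> R / 2 \<longrightarrow> norm (F n j z - (\<Sum>m<N. c m * z ^ m)) \<le> KA * w n N * norm z ^ N" for n
  proof -
    have "\<exists>E. \<forall>r\<in>{0<..R}. D n r \<le> E * r ^ N" for N using pt by (intro exI[of _ "K3 * (1 + real p) * w n N"]) auto
    from ci.ramis_sibuya_two_zone[OF tz cD this] obtain c where
      crem: "\<And>N J s \<kappa> i z. (\<forall>e\<in>{0<..<R}. integral {e..R} (\<lambda>r. D n r / r ^ (N + 1)) \<le> J) \<Longrightarrow>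
              (\<forall>r\<in>{0<..R}. D n r \<le> s * r ^ N) \<Longrightarrow> 0 < \<kappa> \<Longrightarrow> \<kappa> < 1 \<Longrightarrow> i \<in> IJ \<Longrightarrow> z \<in> UI i \<Longrightarrow> norm z \<le> \<kappa> * R \<Longrightarrow>
              norm (F n i z - (\<Sum>n<N. c n * z ^ n)) \<le> (K2 * (gw p At n * gev p n) / R ^ N / (1 - \<kappa>) + real KV / ci.gap * J + 2 * s / (1 - \<kappa>)) * norm z ^ N"
      by blast
    show ?thesis
    proof (intro exI[of _ c] allI ballI impI)
      fix N j z assume j: "j \<in> IJ" and z: "z \<in> UI j" "norm z \<le> R / 2"
      show "norm (F n j z - (\<Sum>m<N. c m * z ^ m)) \<le> KA * w n N * norm z ^ N"
      \<comment> \<open>\<open>dgev_integral\<close> covers N \<ge> 1; for N = 0 the claim is the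
        bound of g itself.\<close>
      proof (cases "N = 0")
        case True
        have "norm (F n j z) \<le> K2 * (gw p At n * gev p n)"
          unfolding F_def using vV[OF j z(1)] z R0 by (intro bnd j) auto
        also have "\<dots> \<le> KA * (gw p At n * gev p n)" using KA by (intro mult_right_mono) auto
        finally show ?thesis using True ABC by (simp add: w_def)
      next
        case False
        have "norm (F n j z - (\<Sum>m<N. c m * z ^ m)) \<le> (K2 * (gw p At n * gev p n) / R ^ N / (1 - 1/2) + real KV / ci.gap * (K3 * (1 + 2 * real p) * w n N)
            + 2 * (K3 * (1 + real p) * w n N) / (1 - 1/2)) * norm z ^ N"
          by (rule crem) (use J[of _ N n] pt[of _ n N] False j z in auto)
        also have "\<dots> \<le> (KA * w n N) * norm z ^ N"
        proof (rule mult_right_mono)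
          have "K2 * (gw p At n * gev p n) / R ^ N / (1 - 1/2) + real KV / ci.gap * (K3 * (1 + 2 * real p) * w n N)
            + 2 * (K3 * (1 + real p) * w n N) / (1 - 1/2) \<le> 2 * (K2 * K5 * w n N) + real KV / ci.gap * (K3 * (1 + 2 * real p) * w n N) + 4 * (K3 * (1 + real p) * w n N)"
          proof -
            have half: "x / (1 - 1/2) = 2 * x" for x :: real by simp
            show ?thesis unfolding half using QR[of n N] by linarith
          qed
          also have "\<dots> \<le> 2 * (K2 * K5 * w n N) + real KV / ci.gap * (K3 * (1 + 2 * real p) * w n N) + 4 * (K3 * (1 + real p) * w n N) + K2 * w n N"
            using K2 w0 by simp
          also have "\<dots> = KA * w n N" by (simp add: KA_def algebra_simps)
          finally show "K2 * (gw p At n * gev p n) / R ^ N / (1 - 1/2) + real KV / ci.gap * (K3 * (1 + 2 * real p) * w n N)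
            + 2 * (K3 * (1 + real p) * w n N) / (1 - 1/2) \<le> KA * w n N" .
        qed simp
        finally show ?thesis .
      qed
    qed
  qed
  then obtain c where c: "\<And>n N j z. j \<in> IJ \<Longrightarrow> z \<in> UI j \<Longrightarrow> norm z \<le> R / 2 \<Longrightarrow> norm (F n j z - (\<Sum>m<N. c n m * z ^ m)) \<le> KA * w n N * norm z ^ N"
    by metis
  \<comment> \<open>Read off from two consecutive remainders, which covers m = 0 as well; the
    coefficient bound of the Ramis-Sibuya theorem would require the integral for m = 0.\<close>
  have cb: "norm (c n m) \<le> KA * w n m" for n m
  proof -
    obtain j where j: "j \<in> IJ" "cis 0 \<in> UI j" using ci.cover_U[of 0] by fastforce
    show ?thesis
    proof (rule expansion_coeff_le[OF half_gt_zero[OF R0(1)], where F="F n j" and b'="KA * w n (Suc m)"])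
      fix r assume r: "r \<in> {0<..R / 2}"
      have z: "of_real r * cis 0 \<in> UI j" "norm (complex_of_real r * cis 0) = r" using ci.polar_in_U[OF j, of r] r by auto
      show "\<exists>z. norm z = r \<and> norm (F n j z - (\<Sum>k<m. c n k * z ^ k)) \<le> KA * w n m * r ^ m \<and>
          norm (F n j z - (\<Sum>k<Suc m. c n k * z ^ k)) \<le> KA * w n (Suc m) * r ^ Suc m"
        using c[OF j(1) z(1), of n m] c[OF j(1) z(1), of n "Suc m"] r unfolding z(2) by (intro exI[of _ "of_real r * cis 0"] conjI z(2)) auto
    qed
  qed
  have R2: "R / 2 > 0" using R0 by simp
  obtain Kt where Kt: "Kt > 0" "\<And>N n c (z :: complex) (F :: complex) W. \<lbrakk>\<And>m. norm (c m) \<le> KA * (W * (gw p B m * gev p (m + n))); norm F \<le> K2 * (W * gev p n); R / 2 \<le> norm z; W \<ge> 0\<rbrakk>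
      \<Longrightarrow> norm (F - (\<Sum>m<N. c m * z ^ m)) \<le> Kt * (W * (gw p B N * gev p (N + n))) * norm z ^ N"
    using gevrey_tail[OF ABC(2) p R2 less_imp_le[OF K2] less_imp_le[OF KA(1)]] by blast
  define K where "K = KA + Kt"
  have all: "norm (g j n X - (\<Sum>m<M. c n m * inverse X ^ m)) \<le> K * w n M * norm (inverse X) ^ M"
    if j: "j \<in> IJ" and X: "X \<in> V j" "X \<noteq> 0" for j n M X
  proof (cases "norm (inverse X) \<le> R / 2")
    case True
    have "inverse (norm X) \<le> R / 2" using True by (simp add: norm_inverse)
    hence "1 \<le> R / 2 * norm X" using X by (simp add: field_simps)
    hence "4 * T \<le> norm X" using T by (simp add: R_def field_simps)
    hence "X \<in> UV j" using V_UV[OF j, of X] X T by auto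
    hence "norm (F n j (inverse X) - (\<Sum>m<M. c n m * inverse X ^ m)) \<le> KA * w n M * norm (inverse X) ^ M"
      using True by (intro c j) (auto simp: UI_def)
    also have "\<dots> \<le> K * w n M * norm (inverse X) ^ M" using Kt w0 by (intro mult_right_mono) (auto simp: K_def)
    finally show ?thesis by (simp add: F_def)
  next
    case False
    have "norm (g j n X - (\<Sum>m<M. c n m * inverse X ^ m)) \<le> Kt * (gw p At n * (gw p B M * gev p (M + n))) * norm (inverse X) ^ M"
      by (rule Kt(2)) (use False cb bnd[OF j X(1)] in \<open>auto simp: w_def\<close>)
    also have "\<dots> = Kt * w n M * norm (inverse X) ^ M" by (simp add: w_def)
    also have "\<dots> \<le> K * w n M * norm (inverse X) ^ M" using KA w0 by (intro mult_right_mono) (auto simp: K_def)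
    finally show ?thesis .
  qed
  show ?thesis
  proof (rule that[of K c])
    show "K > 0" using KA Kt by (simp add: K_def)
    show "norm (c n m) \<le> K * (gw p At n * (gw p B m * gev p (m + n)))" for n m
      using order_trans[OF cb mult_right_mono[of KA K "w n m"]] Kt w0 by (simp add: K_def w_def)
    show "norm X ^ M * norm (g j n X - (\<Sum>m<M. c n m / X ^ m)) \<le> K * (gw p At n * (gw p B M * gev p (M + n)))"
      if "j \<in> IJ" "X \<in> V j" "M \<ge> 1" for j n M X
    \<comment> \<open>X = 0 occurs if V j contains a disc around 0; then |X|^M = 0 since M \<ge>
      1.\<close>
    proof (cases "X = 0")
      case True
      thus ?thesis using that KA Kt by (simp add: K_def zero_power)
    next
      case False
      have "(\<Sum>m<M. c n m / X ^ m) = (\<Sum>m<M. c n m * inverse X ^ m)" by (simp add: divide_inverse power_inverse)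
      hence "norm X ^ M * norm (g j n X - (\<Sum>m<M. c n m / X ^ m)) \<le> norm X ^ M * (K * w n M * norm (inverse X) ^ M)"
        using all[OF that(1,2) False, of n M] by (intro mult_left_mono) auto
      also have "\<dots> = K * w n M" using False by (simp add: norm_inverse power_inverse)
      finally show ?thesis by (simp add: w_def)
    qed
  qed
qed

theorem combined_expansion:
  obtains a g c K where "K > 0" "\<And>n. a n holomorphic_on ball 0 r0"
    "\<And>n x. norm x < r0 \<Longrightarrow> norm (a n x) \<le> K * (gw p At n * gev p n)"
    "\<And>j n. j \<in> IJ \<Longrightarrow> g j n holomorphic_on V j"
    "\<And>j n M X. j \<in> IJ \<Longrightarrow> X \<in> V j \<Longrightarrow>
       norm X ^ M * norm (g j n X - (\<Sum>m\<in>{1..<M}. c n m / X ^ m)) \<le> K * (gw p At n * (gw p B M * gev p (M + n)))"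
    "\<And>j l X \<eta> N. j \<in> IJ \<Longrightarrow> l \<in> IL \<Longrightarrow> X \<in> V j \<Longrightarrow> \<eta> \<in> US l \<Longrightarrow> norm \<eta> < \<eta>0 \<Longrightarrow> norm (\<eta> * X) < r0 \<Longrightarrow>
       norm (y j l (\<eta> * X) \<eta> - (\<Sum>n<N. (a n (\<eta> * X) + g j n X) * \<eta> ^ n)) \<le> K * (gw p At N * gev p N) * norm \<eta> ^ N"
proof -
  \<comment> \<open>Three circles strictly between r0 and r1: rc carries the transform that is
    subtracted, ra the one that continues the difference, and rb, halfway between them, is the
    radius of the changeover.\<close>
  define ra where "ra = r0 + (r1 - r0) / 4"
  define rb where "rb = r0 + (r1 - r0) / 2"
  define rc where "rc = r0 + 3 * (r1 - r0) / 4"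
  have r: "r0 < ra" "ra < rb" "rb < rc" "rc < r1" using r01 by (simp_all add: ra_def rb_def rc_def field_simps)
  have r': "r0 < rc" "r0 < rb" "rb < r1" using r by auto
  show ?thesis
  proof (rule outer_expansion[OF r'(1) r(4)])
    fix a K1
    assume K1: "K1 > 0" and aH: "\<And>n. a n holomorphic_on ball 0 r0"
      and aB: "\<And>n x. norm x < r0 \<Longrightarrow> norm (a n x) \<le> K1 * (gw p At n * gev p n)"
      and aR: "\<And>x l \<eta> N. norm x < r0 \<Longrightarrow> l \<in> IL \<Longrightarrow> \<eta> \<in> US l \<Longrightarrow> norm \<eta> < \<eta>0 \<Longrightarrow>
         norm (f rc l x \<eta> - (\<Sum>n<N. a n x * \<eta> ^ n)) \<le> K1 * (gw p At N * gev p N) * norm \<eta> ^ N"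
    show ?thesis
    proof (rule inner_expansion[OF r])
      fix g K2
      assume K2: "K2 > 0" and gH: "\<And>j n. j \<in> IJ \<Longrightarrow> g j n holomorphic_on V j"
        and gB: "\<And>j n X. j \<in> IJ \<Longrightarrow> X \<in> V j \<Longrightarrow> norm (g j n X) \<le> K2 * (gw p At n * gev p n)"
        and gR: "\<And>j l X \<eta> N. j \<in> IJ \<Longrightarrow> l \<in> IL \<Longrightarrow> X \<in> V j \<Longrightarrow> \<eta> \<in> US l \<Longrightarrow> norm \<eta> < \<eta>0 \<Longrightarrow> norm (\<eta> * X) < r0 \<Longrightarrow>
           norm (y j l (\<eta> * X) \<eta> - f rc l (\<eta> * X) \<eta> - (\<Sum>n<N. g j n X * \<eta> ^ n)) \<le> K2 * (gw p At N * gev p N) * norm \<eta> ^ N"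
      show ?thesis
      proof (rule inner_difference[OF r'(2,3) K2 gR])
        fix K3 T
        assume K3: "K3 > 0" and T: "T \<ge> T0" "T > 0"
          and gD: "\<And>i j X n. i \<in> IJ \<Longrightarrow> j \<in> IJ \<Longrightarrow> X \<in> V i \<Longrightarrow> X \<in> V j \<Longrightarrow> T < norm X \<Longrightarrow>
             norm (g i n X - g j n X) \<le> K3 * (gw p At n * dgev p B n (1 / norm X))"
        show ?thesis
        proof (rule expansion_at_infinity[OF K2 K3 T gH gB gD])
          fix c K4
          assume K4: "K4 > 0" and cB: "\<And>n m. norm (c n m) \<le> K4 * (gw p At n * (gw p B m * gev p (m + n)))"
            and cR: "\<And>j n M X. j \<in> IJ \<Longrightarrow> X \<in> V j \<Longrightarrow> M \<ge> 1 \<Longrightarrow>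
               norm X ^ M * norm (g j n X - (\<Sum>m<M. c n m / X ^ m)) \<le> K4 * (gw p At n * (gw p B M * gev p (M + n)))"
          define K where "K = K1 + K2 + K4"
          have Kle: "K1 + K4 \<le> K" "K2 + K4 \<le> K" "K4 \<le> K" "K1 + K2 \<le> K" using K1 K2 K4 by (auto simp: K_def)
          have c0: "norm (c n 0) \<le> K4 * (gw p At n * gev p n)" for n using cB[of n 0] ABC by simp
          show ?thesis
          \<comment> \<open>The sums at infinity start at m = 1. The constant term
            \<open>c n 0\<close> can be moved because it is the same for all j, so a single a n
            still serves every j.\<close>
          proof (rule that[of K "\<lambda>n x. a n x + c n 0" "\<lambda>j n X. g j n X - c n 0" c])
            show "K > 0" using K1 K2 K4 by (simp add: K_def)
            show "(\<lambda>x. a n x + c n 0) holomorphic_on ball 0 r0" for n by (intro holomorphic_intros aH)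
            show "(\<lambda>X. g j n X - c n 0) holomorphic_on V j" if "j \<in> IJ" for j n by (intro holomorphic_intros gH that)
            show "norm (a n x + c n 0) \<le> K * (gw p At n * gev p n)" if "norm x < r0" for n x
            proof -
              have "norm (a n x + c n 0) \<le> (K1 + K4) * (gw p At n * gev p n)"
                using norm_triangle_ineq[of "a n x" "c n 0"] aB[OF that, of n] c0[of n] by (simp add: distrib_right)
              also have "\<dots> \<le> K * (gw p At n * gev p n)" using Kle by (intro mult_right_mono) auto
              finally show ?thesis .
            qed
            show "norm X ^ M * norm (g j n X - c n 0 - (\<Sum>m\<in>{1..<M}. c n m / X ^ m)) \<le> K * (gw p At n * (gw p B M * gev p (M + n)))"
              if "j \<in> IJ" "X \<in> V j" for j n M X
            \<comment> \<open>For M = 0 there is no remainder of the full sum to rely on, so the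
              bound is that of g plus that of the constant term.\<close>
            proof (cases "M = 0")
              case True
              have "norm (g j n X - c n 0) \<le> (K2 + K4) * (gw p At n * gev p n)"
                using norm_triangle_ineq4[of "g j n X" "c n 0"] gB[OF that, of n] c0[of n] by (simp add: distrib_right)
              also have "\<dots> \<le> K * (gw p At n * gev p n)" using Kle by (intro mult_right_mono) auto
              finally show ?thesis using True ABC by simp
            next
              case False
              hence "{..<M} = insert 0 {1..<M}" by auto
              hence "(\<Sum>m<M. c n m / X ^ m) = c n 0 + (\<Sum>m\<in>{1..<M}. c n m / X ^ m)" by simp
              hence "norm X ^ M * norm (g j n X - c n 0 - (\<Sum>m\<in>{1..<M}. c n m / X ^ m)) \<le> K4 * (gw p At n * (gw p B M * gev p (M + n)))"
                using cR[OF that, of M n] False by (simp add: diff_diff_eq)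
              also have "\<dots> \<le> K * (gw p At n * (gw p B M * gev p (M + n)))" using Kle by (intro mult_right_mono) auto
              finally show ?thesis .
            qed
            show "norm (y j l (\<eta> * X) \<eta> - (\<Sum>n<N. (a n (\<eta> * X) + c n 0 + (g j n X - c n 0)) * \<eta> ^ n)) \<le> K * (gw p At N * gev p N) * norm \<eta> ^ N"
              if h: "j \<in> IJ" "l \<in> IL" "X \<in> V j" "\<eta> \<in> US l" "norm \<eta> < \<eta>0" "norm (\<eta> * X) < r0" for j l X \<eta> N
            proof -
              define Sa where "Sa = (\<Sum>n<N. a n (\<eta> * X) * \<eta> ^ n)"
              define Sg where "Sg = (\<Sum>n<N. g j n X * \<eta> ^ n)"
              have "(\<Sum>n<N. (a n (\<eta> * X) + c n 0 + (g j n X - c n 0)) * \<eta> ^ n) = Sa + Sg"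
                by (simp add: Sa_def Sg_def distrib_right sum.distrib)
              hence "norm (y j l (\<eta> * X) \<eta> - (\<Sum>n<N. (a n (\<eta> * X) + c n 0 + (g j n X - c n 0)) * \<eta> ^ n))
                  = norm ((y j l (\<eta> * X) \<eta> - f rc l (\<eta> * X) \<eta> - Sg) + (f rc l (\<eta> * X) \<eta> - Sa))"
                by (simp add: algebra_simps)
              also have "\<dots> \<le> norm (y j l (\<eta> * X) \<eta> - f rc l (\<eta> * X) \<eta> - Sg) + norm (f rc l (\<eta> * X) \<eta> - Sa)" by (rule norm_triangle_ineq)
              also have "\<dots> \<le> K2 * (gw p At N * gev p N) * norm \<eta> ^ N + K1 * (gw p At N * gev p N) * norm \<eta> ^ N"
                unfolding Sa_def Sg_def by (intro add_mono aR gR h)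
              also have "\<dots> = (K1 + K2) * (gw p At N * gev p N) * norm \<eta> ^ N" by (simp add: algebra_simps)
              also have "\<dots> \<le> K * (gw p At N * gev p N) * norm \<eta> ^ N" using Kle by (intro mult_right_mono) auto
              finally show ?thesis .
            qed
          qed
        qed (assumption | rule K2 K3 T gR gH gB gD)+
      qed (assumption | rule K2 gR)+
    qed
  qed
qed

end

section \<open>Sectors and good coverings\<close>

definition asec :: "real \<Rightarrow> real \<Rightarrow> complex set" where
  "asec \<alpha> \<beta> = {x. x \<noteq> 0 \<and> arg_between \<alpha> \<beta> x}"

lemma asecE:
  assumes "x \<in> asec \<alpha> \<beta>"
  obtains \<theta> where "\<alpha> < \<theta>" "\<theta> < \<beta>" "x = of_real (norm x) * cis \<theta>" "norm x > 0"
  using assms by (auto simp: asec_def arg_between_def)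

lemma asecI:
  assumes "r > 0" "\<alpha> < \<theta>" "\<theta> < \<beta>" shows "of_real r * cis \<theta> \<in> asec \<alpha> \<beta>"
  using assms by (auto simp: asec_def arg_between_def norm_mult)

lemma zero_asec [simp]: "0 \<notin> asec \<alpha> \<beta>" by (simp add: asec_def)

lemma cis_asec: "\<alpha> < \<theta> + 2 * pi * of_int k \<Longrightarrow> \<theta> + 2 * pi * of_int k < \<beta> \<Longrightarrow> cis \<theta> \<in> asec \<alpha> \<beta>"
  using asecI[of 1 \<alpha> "\<theta> + 2 * pi * of_int k" \<beta>] cis_add_2pi_int[of \<theta> k] by simp

lemma asec_mono: "x \<in> asec \<alpha> \<beta> \<Longrightarrow> \<alpha>' \<le> \<alpha> \<Longrightarrow> \<beta> \<le> \<beta>' \<Longrightarrow> x \<in> asec \<alpha>' \<beta>'"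
  unfolding asec_def arg_between_def by (auto intro: le_less_trans less_le_trans)

lemma asec_cone: "x \<in> asec \<alpha> \<beta> \<Longrightarrow> r > 0 \<Longrightarrow> of_real r * x \<in> asec \<alpha> \<beta>"
  using asecI[of "r * norm x" \<alpha> _ \<beta>] by (elim asecE) (metis mult.assoc mult_pos_pos of_real_mult)

lemma asec_mult:
  assumes "x \<in> asec \<alpha> \<beta>" "y \<in> asec \<gamma> \<delta>" shows "x * y \<in> asec (\<alpha> + \<gamma>) (\<beta> + \<delta>)"
proof -
  obtain \<theta> where x: "\<alpha> < \<theta>" "\<theta> < \<beta>" "x = of_real (norm x) * cis \<theta>" "norm x > 0" using assms(1) by (rule asecE)
  obtain \<psi> where y: "\<gamma> < \<psi>" "\<psi> < \<delta>" "y = of_real (norm y) * cis \<psi>" "norm y > 0" using assms(2) by (rule asecE)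
  have "x * y = of_real (norm x * norm y) * cis (\<theta> + \<psi>)"
    by (subst x(3), subst y(3)) (simp add: cis_mult[symmetric])
  thus ?thesis using asecI[of "norm x * norm y" "\<alpha> + \<gamma>" "\<theta> + \<psi>" "\<beta> + \<delta>"] x y by simp
qed

lemma asec_divide:
  assumes "x \<in> asec \<alpha> \<beta>" "y \<in> asec \<gamma> \<delta>" shows "x / y \<in> asec (\<alpha> - \<delta>) (\<beta> - \<gamma>)"
proof -
  obtain \<psi> where y: "\<gamma> < \<psi>" "\<psi> < \<delta>" "y = of_real (norm y) * cis \<psi>" "norm y > 0" using assms(2) by (rule asecE)
  have "inverse y = of_real (inverse (norm y)) * cis (- \<psi>)" by (subst y(3)) (simp add: cis_inverse)
  hence "inverse y \<in> asec (- \<delta>) (- \<gamma>)" using asecI[of "inverse (norm y)" "- \<delta>" "- \<psi>" "- \<gamma>"] y by simp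
  from asec_mult[OF assms(1) this] show ?thesis by (simp add: divide_inverse)
qed

lemma asec_rotate: "x * cis (- \<phi>) \<in> asec \<alpha> \<beta> \<longleftrightarrow> x \<in> asec (\<alpha> + \<phi>) (\<beta> + \<phi>)"
proof -
  have rot: "x * cis \<phi> \<in> asec (\<alpha> + \<phi>) (\<beta> + \<phi>)" if "x \<in> asec \<alpha> \<beta>" for x \<alpha> \<beta> \<phi>
  proof -
    obtain \<theta> where x: "\<alpha> < \<theta>" "\<theta> < \<beta>" "x = of_real (norm x) * cis \<theta>" "norm x > 0" using \<open>x \<in> asec \<alpha> \<beta>\<close> by (rule asecE)
    have "x * cis \<phi> = of_real (norm x) * cis (\<theta> + \<phi>)" by (subst x(3)) (simp add: cis_mult[symmetric])
    thus ?thesis using asecI[of "norm x" "\<alpha> + \<phi>" "\<theta> + \<phi>" "\<beta> + \<phi>"] x by simp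
  qed
  show ?thesis
  proof
    assume "x * cis (- \<phi>) \<in> asec \<alpha> \<beta>"
    from rot[OF this, of \<phi>] show "x \<in> asec (\<alpha> + \<phi>) (\<beta> + \<phi>)" by (simp add: mult.assoc cis_mult)
  next
    assume "x \<in> asec (\<alpha> + \<phi>) (\<beta> + \<phi>)"
    from rot[OF this, of "- \<phi>"] show "x * cis (- \<phi>) \<in> asec \<alpha> \<beta>" by simp
  qed
qed

text \<open>The sector is the image of a horizontal strip under exp, hence open by the open mapping
  theorem. This treats openings beyond 2 pi, where the image overlaps itself, without choosing a
  branch of the argument.\<close>

lemma open_asec: "open (asec \<alpha> \<beta>)"
proof -
  have "asec \<alpha> \<beta> = exp ` {z. \<alpha> < Im z \<and> Im z < \<beta>}"
  proof (intro equalityI subsetI)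
    fix x assume "x \<in> asec \<alpha> \<beta>"
    then obtain \<theta> where x: "\<alpha> < \<theta>" "\<theta> < \<beta>" "x = of_real (norm x) * cis \<theta>" "norm x > 0" by (rule asecE)
    have "exp (Complex (ln (norm x)) \<theta>) = x" using x by (simp add: exp_eq_polar)
    thus "x \<in> exp ` {z. \<alpha> < Im z \<and> Im z < \<beta>}" using x by (intro image_eqI[of _ _ "Complex (ln (norm x)) \<theta>"]) auto
  next
    fix x assume "x \<in> exp ` {z. \<alpha> < Im z \<and> Im z < \<beta>}"
    thus "x \<in> asec \<alpha> \<beta>" by (auto simp: exp_eq_polar intro!: asecI)
  qed
  moreover have "open (exp ` {z::complex. \<alpha> < Im z \<and> Im z < \<beta>})"
  proof (rule open_mapping_thm[of exp UNIV])
    show "open {z. \<alpha> < Im z \<and> Im z < \<beta>}"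
      by (intro open_Collect_conj open_Collect_less continuous_intros)
    show "\<not> (exp :: complex \<Rightarrow> complex) constant_on UNIV"
    proof
      assume "(exp :: complex \<Rightarrow> complex) constant_on UNIV"
      then obtain c where "\<And>z::complex. exp z = c" unfolding constant_on_def by auto
      from this[of 0] this[of "\<i> * pi"] show False by simp
    qed
  qed (auto intro!: holomorphic_intros)
  ultimately show ?thesis by simp
qed

text \<open>Bridges the congruence in the coverings and the cyclic successor in the exponential
  hypotheses: for indices in 1..J the multiple of J in the congruence can only be -J, 0 or
  J.\<close>

lemma cyc_near_cases:
  assumes "cyc_near J i j" "i \<in> {1..J}" "j \<in> {1..J}"
  shows "i = j \<or> i = cyc_succ J j \<or> j = cyc_succ J i"
proof (cases "J = 1")
  case False
  obtain d where d: "d \<in> {-1, 0, 1}" "[int i = int j + d] (mod int J)" using assms(1) unfolding cyc_near_def by blast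
  then obtain q where q: "int i = int j + d + int J * q" by (metis cong_iff_lin cong_sym)
  have m: "int J * q = int i - int j - d" using q by simp
  have "int i \<le> int J" "1 \<le> int i" "int j \<le> int J" "1 \<le> int j" "d \<le> 1" "- 1 \<le> d" using d(1) assms(2,3) by auto
  hence b: "int J * q \<le> int J" "- int J \<le> int J * q" unfolding m by linarith+
  have J0: "int J > 0" using assms(2) by auto
  have "q < 2" "- 2 < q"
    using b mult_left_mono[of 2 q "int J"] mult_left_mono[of q "-2" "int J"] J0 by linarith+
  hence q1: "q \<in> {-1, 0, 1}" by auto
  have J: "j mod J = (if j = J then 0 else j)" "i mod J = (if i = J then 0 else i)" using assms by auto
  show ?thesis using q q1 d(1) assms unfolding cyc_succ_def J by auto
qed (use assms in auto)

text \<open>Move t by full turns to s in the half-open interval (\<alpha> 1 + \<delta>, \<alpha> 1 +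
  \<delta> + 2 pi]. The least j with s \<le> \<alpha> (j+1) + \<delta> has s > \<alpha> j + \<delta>
  by minimality, and s < \<beta> j - \<delta> because consecutive sectors overlap by more than 2
  \<delta>.\<close>

lemma good_covering_shrink:
  assumes J: "J \<ge> 1" and \<delta>: "\<And>j. j \<in> {1..J} \<Longrightarrow> 2 * \<delta> < \<beta> j - angle_ext J \<alpha> (j + 1)"
  shows "\<exists>j\<in>{1..J}. cis t \<in> asec (\<alpha> j + \<delta>) (\<beta> j - \<delta>)"
proof -
  have ext: "angle_ext J \<alpha> j = \<alpha> j" if "j \<in> {1..J}" for j
    using that by (auto simp: angle_ext_def)
  have extJ: "angle_ext J \<alpha> (J + 1) = \<alpha> 1 + 2 * pi" using J by (simp add: angle_ext_def)
  define k where "k = \<lceil>(t - \<alpha> 1 - \<delta>) / (2 * pi)\<rceil> - 1"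
  define s where "s = t + 2 * pi * of_int (- k)"
  have k: "of_int k < (t - \<alpha> 1 - \<delta>) / (2 * pi)" "(t - \<alpha> 1 - \<delta>) / (2 * pi) \<le> of_int k + 1" unfolding k_def by linarith+
  have "of_int k * (2 * pi) < t - \<alpha> 1 - \<delta>" using k(1) by (subst (asm) pos_less_divide_eq) auto
  moreover have "t - \<alpha> 1 - \<delta> \<le> (of_int k + 1) * (2 * pi)" using k(2) by (subst (asm) pos_divide_le_eq) auto
  ultimately have s: "\<alpha> 1 + \<delta> < s" "s \<le> \<alpha> 1 + 2 * pi + \<delta>" by (auto simp: s_def algebra_simps)
  define P where "P j \<longleftrightarrow> j \<ge> 1 \<and> s \<le> angle_ext J \<alpha> (j + 1) + \<delta>" for j
  define j where "j = (LEAST j. P j)"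
  have PJ: "P J" using s J extJ by (simp add: P_def)
  have Pj: "P j" unfolding j_def by (rule LeastI[of P, OF PJ])
  have "j \<le> J" unfolding j_def by (rule Least_le[of P, OF PJ])
  hence j: "j \<in> {1..J}" using Pj by (auto simp: P_def)
  have "\<alpha> j + \<delta> < s"
  proof (cases "j = 1")
    case False
    hence "\<not> P (j - 1)" unfolding j_def using j by (intro not_less_Least) (auto simp: j_def[symmetric])
    hence "angle_ext J \<alpha> j + \<delta> < s" using False j by (auto simp: P_def)
    thus ?thesis using ext[OF j] by simp
  qed (use s in simp)
  moreover have "s < \<beta> j - \<delta>" using \<delta>[OF j] Pj by (simp add: P_def)
  ultimately have "cis t \<in> asec (\<alpha> j + \<delta>) (\<beta> j - \<delta>)" unfolding s_def by (rule cis_asec)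
  thus ?thesis using j by blast
qed

text \<open>The derivative of f is one within D, and the curve stays in D, so it restricts to the
  image of the curve and the chain rule within sets applies.\<close>

lemma holomorphic2_on_compose:
  assumes f: "f holomorphic2_on D" and S: "open S" and h: "\<phi> holomorphic_on S" "\<psi> holomorphic_on S"
    and D: "\<And>t. t \<in> S \<Longrightarrow> (\<phi> t, \<psi> t) \<in> D"
  shows "(\<lambda>t. f (\<phi> t, \<psi> t)) holomorphic_on S"
  unfolding holomorphic_on_def
proof
  fix t assume t: "t \<in> S"
  obtain a b where ab: "(f has_derivative (\<lambda>(h, k). a * h + b * k)) (at (\<phi> t, \<psi> t) within D)"
    using f D[OF t] unfolding holomorphic2_on_def by blast
  have d: "(\<phi> has_derivative (*) (deriv \<phi> t)) (at t within S)" "(\<psi> has_derivative (*) (deriv \<psi> t)) (at t within S)"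
    using holomorphic_derivI[OF h(1) S t] holomorphic_derivI[OF h(2) S t]
    by (auto simp: has_field_derivative_def intro: has_derivative_at_withinI)
  have "((\<lambda>t. (\<phi> t, \<psi> t)) has_derivative (\<lambda>h. (deriv \<phi> t * h, deriv \<psi> t * h))) (at t within S)"
    by (intro has_derivative_Pair d)
  moreover have "(f has_derivative (\<lambda>(h, k). a * h + b * k)) (at (\<phi> t, \<psi> t) within (\<lambda>t. (\<phi> t, \<psi> t)) ` S)"
    by (rule has_derivative_subset[OF ab]) (use D in auto)
  ultimately have c: "((f \<circ> (\<lambda>t. (\<phi> t, \<psi> t))) has_derivative (\<lambda>(h, k). a * h + b * k) \<circ> (\<lambda>h. (deriv \<phi> t * h, deriv \<psi> t * h))) (at t within S)"
    by (rule diff_chain_within)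
  have "(*) (a * deriv \<phi> t + b * deriv \<psi> t) = (\<lambda>h. a * (deriv \<phi> t * h) + b * (deriv \<psi> t * h))"
    by (simp add: fun_eq_iff algebra_simps)
  hence "((\<lambda>t. f (\<phi> t, \<psi> t)) has_derivative (*) (a * deriv \<phi> t + b * deriv \<psi> t)) (at t within S)"
    using c by (simp add: o_def)
  thus "(\<lambda>t. f (\<phi> t, \<psi> t)) field_differentiable at t within S"
    unfolding field_differentiable_def has_field_derivative_def by blast
qed

lemma holomorphic2_on_imp_continuous: "f holomorphic2_on D \<Longrightarrow> continuous_on D f"
  unfolding holomorphic2_on_def continuous_on_eq_continuous_within
  by (metis has_derivative_continuous)

lemma holomorphic2_on_subset: "f holomorphic2_on D \<Longrightarrow> E \<subseteq> D \<Longrightarrow> f holomorphic2_on E"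
  unfolding holomorphic2_on_def by (meson has_derivative_subset subsetD)

text \<open>The case \<mu> = 0 merges with \<mu> < 0, since 0 < |x| holds throughout
  \<open>asec\<close>.\<close>

lemma quasi_sector_eq:
  "quasi_sector \<alpha> \<beta> r \<mu> = (if \<mu> > 0 then (asec \<alpha> \<beta> \<inter> {x. ereal (norm x) < r}) \<union> ball 0 \<mu>
     else asec \<alpha> \<beta> \<inter> {x. ereal (norm x) < r \<and> - \<mu> < norm x})"
  unfolding quasi_sector_def sector_def asec_def by auto

theorem mainTheorem1:
  fixes p J L :: nat
    and \<mu> \<mu>' r0 r0' \<eta>0 \<delta> A B C A' :: real
    and \<alpha>V \<beta>V \<alpha>S \<beta>S :: "nat \<Rightarrow> real"
    and V :: "nat \<Rightarrow> complex set"
    and S :: "nat \<Rightarrow> complex set"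
    and W W' :: "nat \<Rightarrow> nat \<Rightarrow> complex \<Rightarrow> complex set"
    and y :: "nat \<Rightarrow> nat \<Rightarrow> complex \<Rightarrow> complex \<Rightarrow> complex"
  assumes "p \<ge> 1" and "J \<ge> 1" and "L \<ge> 1"
    and "r0 > 0" and "\<eta>0 > 0"
    and "good_coherent_covering J L \<alpha>V \<beta>V \<alpha>S \<beta>S \<mu> \<eta>0 \<delta>"
    and "\<delta> = fineness L \<alpha>S \<beta>S"
    and "r0' > r0" and "\<mu>' > \<mu>"
    and "\<bar>\<mu>\<bar> * \<eta>0 < r0" and "\<bar>\<mu>'\<bar> * \<eta>0 < r0'"
    and V_def: "\<And>j. V j = quasi_sector (\<alpha>V j) (\<beta>V j) \<infinity> \<mu>"
    and S_def: "\<And>l. S l = sector (\<alpha>S l) (\<beta>S l) \<eta>0"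
    and W_def: "\<And>j l \<eta>. W j l \<eta> = quasi_sector (alpha_jl \<alpha>V \<alpha>S \<beta>S \<delta> j l)
                  (beta_jl \<beta>V \<alpha>S \<beta>S \<delta> j l) r0 (\<mu> * cmod \<eta>)"
    and W'_def: "\<And>j l \<eta>. W' j l \<eta> = quasi_sector (alpha_jl \<alpha>V \<alpha>S \<beta>S \<delta> j l - 2 * \<delta>)
                  (beta_jl \<beta>V \<alpha>S \<beta>S \<delta> j l + 2 * \<delta>) r0' (\<mu>' * cmod \<eta>)"
    and hol: "\<And>j l. j \<in> {1..J} \<Longrightarrow> l \<in> {1..L} \<Longrightarrow>
                (\<lambda>(x, \<eta>). y j l x \<eta>) holomorphic2_on fibred (S l) (W' j l)"
    and bdd: "\<And>j l. j \<in> {1..J} \<Longrightarrow> l \<in> {1..L} \<Longrightarrow>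
                bounded ((\<lambda>(x, \<eta>). y j l x \<eta>) ` fibred (S l) (W' j l))"
    and "A > 0" and "B > 0" and "C > 0"
    and "\<And>j l \<eta> x. j \<in> {1..J} \<Longrightarrow> l \<in> {1..L} \<Longrightarrow> \<eta> \<in> S l \<inter> S (cyc_succ L l) \<Longrightarrow>
           x \<in> W' j l \<eta> \<inter> W' j (cyc_succ L l) \<eta> \<Longrightarrow>
           cmod (y j (cyc_succ L l) x \<eta> - y j l x \<eta>) \<le> C * exp (- (A / cmod \<eta> ^ p))"
    and "\<And>j l \<eta> x. j \<in> {1..J} \<Longrightarrow> l \<in> {1..L} \<Longrightarrow> \<eta> \<in> S l \<Longrightarrow>
           x \<in> W' j l \<eta> \<inter> W' (cyc_succ J j) l \<eta> \<Longrightarrow>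
           cmod (y (cyc_succ J j) l x \<eta> - y j l x \<eta>) \<le> C * exp (- (B * cmod (x / \<eta>) ^ p))"
    and A'_def: "A' = min A (B * r0 ^ p)"
  shows "\<exists>(a :: nat \<Rightarrow> complex \<Rightarrow> complex) (g :: nat \<Rightarrow> nat \<Rightarrow> complex \<Rightarrow> complex).
           (\<forall>j\<in>{1..J}. \<forall>l\<in>{1..L}.
              gevrey_combined_expansion p r0 (V j) (S l) (W j l) (y j l) a (g j)) \<and>
           (\<forall>n. a n \<in> H_space r0) \<and>
           (\<forall>j\<in>{1..J}. \<forall>n. g j n \<in> G_space (V j)) \<and>
           (\<exists>K. \<forall>j\<in>{1..J}. \<forall>l\<in>{1..L}. \<forall>\<eta>\<in>S l. \<forall>x\<in>W j l \<eta>. \<forall>N>0.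
              cmod (y j l x \<eta> - (\<Sum>n<N. (a n x + g j n (x / \<eta>)) * \<eta> ^ n))
                \<le> K * A' powr (- real N / real p) * Gamma (real N / real p + 1) * cmod \<eta> ^ N) \<and>
           (\<exists>(c :: nat \<Rightarrow> nat \<Rightarrow> complex) K. \<forall>M n. \<forall>j\<in>{1..J}. \<forall>X\<in>V j.
              cmod X ^ M * cmod (g j n X - (\<Sum>m\<in>{1..<M}. c n m / X ^ m))
                \<le> K * A' powr (- real n / real p) * B powr (- real M / real p)
                    * Gamma (real (M + n) / real p + 1))"
proof -
  note adj_l = assms(21) and adj_j = assms(22)
  note J1 = assms(2) and L1 = assms(3) and r0 = assms(4) and \<eta>0 = assms(5) and cov = assms(6) and fin = assms(7)
    and r0' = assms(8) and \<mu>' = assms(9) and \<mu>\<eta> = assms(10) and \<mu>\<eta>' = assms(11) and A0 = assms(18) and B0 = assms(19) and C0 = assms(20)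
  define IJ where "IJ = {1..J}"
  define IL where "IL = {1..L}"
  define \<phi> where "\<phi> l = bisecting_angle \<alpha>S \<beta>S l" for l
  define US where "US l = asec (\<alpha>S l) (\<beta>S l)" for l
  define UV where "UV j = asec (\<alpha>V j) (\<beta>V j)" for j
  \<comment> \<open>Rotated by \<phi> l, \<open>Om j\<close> is the infinite sector with the angles
    of V_l^j. The shrinking by \<delta> leaves room for arg \<eta> to vary around \<phi> l, and the
    overlaps larger than 2 \<delta> make the shrunken sectors still cover.\<close>
  define Om where "Om j = asec (\<alpha>V j + \<delta>) (\<beta>V j - \<delta>)" for j
  define P where "P l j = {w. w * cis (- \<phi> l) \<in> Om j}" for l j
  define dom where "dom j l = fibred (S l) (W' j l)" for j l
  have covV: "good_covering_V J \<alpha>V \<beta>V \<mu>" and covS: "good_covering_S L \<alpha>S \<beta>S \<eta>0"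
    and fine: "\<delta> < 1 / 2 * Min ((\<lambda>j. \<beta>V j - angle_ext J \<alpha>V (j + 1)) ` {1..J})"
    using cov unfolding good_coherent_covering_def by auto
  have width: "\<beta>S l - \<alpha>S l \<le> \<delta>" if "l \<in> IL" for l
    unfolding fin fineness_def using that by (intro Max_ge) (auto simp: IL_def)
  have "1 \<in> IL" using L1 by (simp add: IL_def)
  have \<delta>0: "\<delta> > 0"
    using width[OF \<open>1 \<in> IL\<close>] covS \<open>1 \<in> IL\<close> unfolding good_covering_S_def IL_def by fastforce
  have overlap: "2 * \<delta> < \<beta>V j - angle_ext J \<alpha>V (j + 1)" if "j \<in> {1..J}" for j
  proof -
    have "Min ((\<lambda>j. \<beta>V j - angle_ext J \<alpha>V (j + 1)) ` {1..J}) \<le> \<beta>V j - angle_ext J \<alpha>V (j + 1)"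
      using that by (intro Min_le) auto
    thus ?thesis using fine by linarith
  qed
  have S_eq: "S l = US l \<inter> ball 0 \<eta>0" for l
    unfolding S_def US_def sector_def asec_def by auto
  have V_eq: "V j = (if \<mu> > 0 then UV j \<union> ball 0 \<mu> else UV j \<inter> {x. - \<mu> < norm x})" for j
    unfolding V_def UV_def quasi_sector_eq by auto
  \<comment> \<open>An opening of at most \<delta> keeps arg \<eta> within \<delta>/2 of the
    bisecting angle. Compared with V^j turned by \<phi> l, the sectors of W are narrower and those
    of W' wider by \<delta> on each side, so this \<delta>/2 can be spent in quotients and
    products.\<close>
  have US_\<phi>: "\<eta> \<in> asec (\<phi> l - \<delta> / 2) (\<phi> l + \<delta> / 2)" if "l \<in> IL" "\<eta> \<in> US l" for l \<eta>
    using that(2) width[OF that(1)] unfolding US_def \<phi>_def bisecting_angle_def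
    by (elim asec_mono) (auto simp: field_simps)
  have US0: "\<eta> \<noteq> 0" if "\<eta> \<in> US l" for l \<eta> using that by (auto simp: US_def)
  have UV_V: "X \<in> V j \<longleftrightarrow> X \<in> UV j" if "norm X \<ge> \<bar>\<mu>\<bar>" "norm X > - \<mu>" for X j
    using that by (auto simp: V_eq)
  have coverS: "\<exists>K. cone_cover IL US K"
  proof (rule ex_cone_cover)
    fix t
    have "of_real (\<eta>0 / 2) * cis t \<in> ball 0 \<eta>0 - {0}" using \<eta>0 by (simp add: norm_mult)
    then obtain l where l: "l \<in> IL" "of_real (\<eta>0 / 2) * cis t \<in> US l"
      using covS unfolding good_covering_S_def S_def[symmetric] S_eq IL_def by blast
    have "of_real (2 / \<eta>0) * (of_real (\<eta>0 / 2) * cis t) \<in> US l"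
      unfolding US_def by (rule asec_cone[OF l(2)[unfolded US_def]]) (use \<eta>0 in simp)
    also have "of_real (2 / \<eta>0) * (of_real (\<eta>0 / 2) * cis t) = cis t" using \<eta>0 by simp
    finally show "\<exists>l\<in>IL. cis t \<in> US l" using l(1) by blast
  qed (auto simp: US_def open_asec intro: asec_cone)
  have coverO: "\<exists>K. cone_cover IJ Om K"
    by (rule ex_cone_cover) (use good_covering_shrink[OF J1 overlap] in \<open>auto simp: Om_def IJ_def open_asec intro: asec_cone\<close>)
  have Om_UV: "Om j \<subseteq> UV j" for j unfolding Om_def UV_def using \<delta>0 by (auto elim!: asec_mono)
  have coverV: "\<exists>K. cone_cover IJ UV K"
    by (rule ex_cone_cover)
       (use good_covering_shrink[OF J1 overlap] Om_UV in \<open>fastforce simp: UV_def Om_def IJ_def open_asec intro: asec_cone\<close>)+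
  obtain KS where KS: "cone_cover IL US KS" using coverS by blast
  obtain KX where KX: "cone_cover IJ Om KX" using coverO by blast
  obtain KV where KV: "cone_cover IJ UV KV" using coverV by blast
  have nearS: "cyc_near L l l'" if "l \<in> IL" "l' \<in> IL" "\<eta> \<in> US l" "\<eta> \<in> US l'" "norm \<eta> < \<eta>0" for l l' \<eta>
  proof -
    have "\<eta> \<in> S l \<inter> S l'" using that by (auto simp: S_eq)
    thus ?thesis using covS that(1,2) unfolding good_covering_S_def S_def[symmetric] IL_def by blast
  qed
  have nearV: "cyc_near J i j" if ij: "i \<in> IJ" "j \<in> IJ" and X: "X \<in> UV i" "X \<in> UV j" for i j X
  proof (rule ccontr)
    assume "\<not> cyc_near J i j"
    hence "bounded (V i \<inter> V j)"
      using covV ij unfolding good_covering_V_def V_def[symmetric] IJ_def by blast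
    then obtain b where b: "\<And>x. x \<in> V i \<inter> V j \<Longrightarrow> norm x \<le> b" unfolding bounded_iff by blast
    have X0: "norm X > 0" using X by (auto simp: UV_def)
    \<comment> \<open>Membership in a cone survives dilation: scaled far out, X lies in both V i and
      V j, against the boundedness of their intersection.\<close>
    define r where "r = (\<bar>b\<bar> + \<bar>\<mu>\<bar> + 1) / norm X"
    have r: "r > 0" using X0 by (simp add: r_def add_nonneg_pos)
    have nX: "norm (of_real r * X) = \<bar>b\<bar> + \<bar>\<mu>\<bar> + 1"
    proof -
      have "norm (of_real r * X) = r * norm X" using r by (simp add: norm_mult)
      thus ?thesis using X0 by (simp add: r_def)
    qed
    have "of_real r * X \<in> UV i" "of_real r * X \<in> UV j" using X r unfolding UV_def by (auto intro: asec_cone)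
    hence "of_real r * X \<in> V i \<inter> V j" using UV_V[of "of_real r * X"] nX by auto
    from b[OF this] nX show False by linarith
  qed
  have W'I: "x \<in> W' j l \<eta>" if "x \<in> asec (\<alpha>V j + \<phi> l - \<delta>) (\<beta>V j + \<phi> l + \<delta>)" "norm x < r0'" "- (\<mu>' * norm \<eta>) < norm x" for x j l \<eta>
  proof -
    have ab: "alpha_jl \<alpha>V \<alpha>S \<beta>S \<delta> j l - 2 * \<delta> = \<alpha>V j + \<phi> l - \<delta>" "beta_jl \<beta>V \<alpha>S \<beta>S \<delta> j l + 2 * \<delta> = \<beta>V j + \<phi> l + \<delta>"
      by (simp_all add: alpha_jl_def beta_jl_def \<phi>_def)
    show ?thesis using that unfolding W'_def quasi_sector_eq ab by auto
  qed
  have W'I2: "x \<in> W' j l \<eta>" if "norm x < \<mu>' * norm \<eta>" for x j l \<eta>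
  proof -
    have "0 < \<mu>' * norm \<eta>" using that norm_ge_zero[of x] by linarith
    thus ?thesis using that unfolding W'_def quasi_sector_eq by auto
  qed
  have quot: "w / \<eta> \<in> UV j" if "l \<in> IL" "\<eta> \<in> US l" "w \<in> P l j" for l \<eta> w j
  proof -
    have "w \<in> asec (\<alpha>V j + \<delta> + \<phi> l) (\<beta>V j - \<delta> + \<phi> l)" using that(3) unfolding P_def Om_def mem_Collect_eq asec_rotate .
    from asec_divide[OF this US_\<phi>[OF that(1,2)]] show ?thesis unfolding UV_def by (rule asec_mono) (use \<delta>0 in auto)
  qed
  have prod: "\<eta> * X \<in> asec (\<alpha>V j + \<phi> l - \<delta>) (\<beta>V j + \<phi> l + \<delta>)" if "l \<in> IL" "\<eta> \<in> US l" "X \<in> UV j" for l \<eta> X j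
    using asec_mult[OF US_\<phi>[OF that(1,2)] that(3)[unfolded UV_def]] by (rule asec_mono) (use \<delta>0 in auto)
  \<comment> \<open>If \<mu>' < 0 then \<mu> < \<mu>' gives |\<mu>'| |\<eta>| \<le> |\<mu>| \<eta>0
    < r0, so the hole of W' lies inside |x| < r0.\<close>
  have small: "- (\<mu>' * norm \<eta>) < norm x" if "norm \<eta> < \<eta>0" "r0 \<le> norm x" for \<eta> x :: complex
  proof (cases "\<mu>' < 0")
    case True
    have "- \<mu>' * norm \<eta> \<le> \<bar>\<mu>\<bar> * \<eta>0" using True \<mu>' that \<eta>0 by (intro mult_mono) auto
    thus ?thesis using \<mu>\<eta> that by simp
  next
    case False
    have "0 \<le> \<mu>' * norm \<eta>" using False by simp
    thus ?thesis using that r0 by linarith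
  qed
  \<comment> \<open>For \<mu> > 0 the disc |X| < \<mu> goes into the core |x| < \<mu>'|\<eta>| of
    W'; for the other X the inequality \<mu>' > \<mu> keeps \<eta>X off a possible hole.\<close>
  have inner: "\<eta> * X \<in> W' j l \<eta>" if "l \<in> IL" "\<eta> \<in> US l" "norm \<eta> < \<eta>0" "X \<in> V j" "norm (\<eta> * X) < r0'" for l \<eta> X j
  proof (cases "\<mu> > 0 \<and> norm X < \<mu>")
    case True
    have "norm (\<eta> * X) < norm \<eta> * \<mu>'" unfolding norm_mult using True \<mu>' US0[OF that(2)] by (intro mult_strict_left_mono) auto
    thus ?thesis by (intro W'I2) (simp add: mult.commute)
  next
    case False
    hence X: "X \<in> UV j" and X\<mu>: "- \<mu> < norm X" using that(4) by (auto simp: V_eq UV_def split: if_splits)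
    have "- (\<mu>' * norm \<eta>) < norm (\<eta> * X)"
    proof -
      have "norm \<eta> > 0" "norm X > 0" using US0[OF that(2)] X by (auto simp: UV_def)
      moreover have "- \<mu>' < norm X" using X\<mu> \<mu>' by simp
      ultimately have "norm \<eta> * (- \<mu>') < norm \<eta> * norm X" by (intro mult_strict_left_mono)
      thus ?thesis by (simp add: norm_mult mult.commute)
    qed
    thus ?thesis by (intro W'I prod that X)
  qed
  have inS: "\<eta> \<in> S l" if "\<eta> \<in> US l" "norm \<eta> < \<eta>0" for \<eta> l using that by (auto simp: S_eq)
  \<comment> \<open>w is given in the sector for l', but membership for l is wanted. Dividing by
    \<eta>, seen near \<phi> l', and multiplying by it again, now seen near \<phi> l, changes the
    reference angle.\<close>
  have outer: "w \<in> W' j l \<eta>" if "l \<in> IL" "l' \<in> IL" "\<eta> \<in> US l" "\<eta> \<in> US l'" "norm \<eta> < \<eta>0" "w \<in> P l' j" "r0 \<le> norm w" "norm w < r0'" for l l' \<eta> w j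
  proof -
    have "\<eta> * (w / \<eta>) \<in> asec (\<alpha>V j + \<phi> l - \<delta>) (\<beta>V j + \<phi> l + \<delta>)"
      by (intro prod that quot[of l'])
    thus ?thesis using small[of \<eta> w] that US0[OF that(3)] by (intro W'I) auto
  qed
  have y_l: "norm (y j l x \<eta> - y j l' x \<eta>) \<le> C * exp (- (A / norm \<eta> ^ p))"
    if "j \<in> IJ" "l \<in> IL" "l' \<in> IL" "\<eta> \<in> US l" "\<eta> \<in> US l'" "norm \<eta> < \<eta>0" "x \<in> W' j l \<eta>" "x \<in> W' j l' \<eta>" for j l l' x \<eta>
    using cyc_near_cases[OF nearS[OF that(2-6)]] that C0 adj_l[of j l \<eta> x] adj_l[of j l' \<eta> x] inS[OF that(4,6)] inS[OF that(5,6)]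
    by (auto simp: IJ_def IL_def norm_minus_commute)
  have y_j: "norm (y i l x \<eta> - y j l x \<eta>) \<le> C * exp (- (B * norm (x / \<eta>) ^ p))"
    if "i \<in> IJ" "j \<in> IJ" "l \<in> IL" "\<eta> \<in> US l" "norm \<eta> < \<eta>0" "x \<in> W' i l \<eta>" "x \<in> W' j l \<eta>" "x / \<eta> \<in> UV i" "x / \<eta> \<in> UV j" for i j l x \<eta>
    using cyc_near_cases[OF nearV[OF that(1,2,8,9)]] that C0 adj_j[of i l \<eta> x] adj_j[of j l \<eta> x] inS[OF that(4,5)]
    by (auto simp: IJ_def IL_def norm_minus_commute)
  have y_j': "norm (y i l x \<eta> - y j l x \<eta>) \<le> C * exp (- (min A (B * r0 ^ p) / norm \<eta> ^ p))"
    if "i \<in> IJ" "j \<in> IJ" "l \<in> IL" "\<eta> \<in> US l" "norm \<eta> < \<eta>0" "x \<in> W' i l \<eta>" "x \<in> W' j l \<eta>" "x / \<eta> \<in> UV i" "x / \<eta> \<in> UV j" "r0 \<le> norm x" for i j l x \<eta>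
  proof -
    have "r0 ^ p \<le> norm x ^ p" using that r0 by (intro power_mono) auto
    hence "B * r0 ^ p \<le> B * norm x ^ p" using B0 by (intro mult_left_mono) auto
    hence "min A (B * r0 ^ p) / norm \<eta> ^ p \<le> B * norm x ^ p / norm \<eta> ^ p" by (intro divide_right_mono) auto
    also have "\<dots> = B * norm (x / \<eta>) ^ p" by (simp add: norm_divide power_divide)
    finally have "C * exp (- (B * norm (x / \<eta>) ^ p)) \<le> C * exp (- (min A (B * r0 ^ p) / norm \<eta> ^ p))"
      using C0 by (intro mult_left_mono) auto
    thus ?thesis using y_j[OF that(1-9)] by linarith
  qed
  obtain Q where Q: "Q \<ge> 0" "\<And>j l x \<eta>. j \<in> IJ \<Longrightarrow> l \<in> IL \<Longrightarrow> (x, \<eta>) \<in> dom j l \<Longrightarrow> norm (y j l x \<eta>) \<le> Q"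
  proof -
    have "bounded (\<Union>j\<in>IJ. \<Union>l\<in>IL. (\<lambda>(x, \<eta>). y j l x \<eta>) ` dom j l)"
      unfolding IJ_def IL_def dom_def by (intro bounded_UN finite_atLeastAtMost ballI bdd)
    then obtain b where b: "\<forall>z\<in>(\<Union>j\<in>IJ. \<Union>l\<in>IL. (\<lambda>(x, \<eta>). y j l x \<eta>) ` dom j l). norm z \<le> b" unfolding bounded_iff by blast
    have "norm (y j l x \<eta>) \<le> \<bar>b\<bar>" if "j \<in> IJ" "l \<in> IL" "(x, \<eta>) \<in> dom j l" for j l x \<eta>
    proof -
      have "y j l x \<eta> \<in> (\<Union>j\<in>IJ. \<Union>l\<in>IL. (\<lambda>(x, \<eta>). y j l x \<eta>) ` dom j l)" using that by force
      thus ?thesis using b by fastforce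
    qed
    thus ?thesis using that[of "\<bar>b\<bar>"] by simp
  qed
  \<comment> \<open>Since |\<mu>| \<eta>0 < r0, a point with |\<eta>X| \<ge> r0 has |X| > |\<mu>|,
    where V j and its cone agree.\<close>
  have big: "norm X \<ge> \<bar>\<mu>\<bar> \<and> norm X > - \<mu>" if "norm \<eta> < \<eta>0" "r0 \<le> norm (\<eta> * X)" for \<eta> X :: complex
  proof -
    have "norm \<eta> * norm X \<le> \<eta>0 * norm X" using that by (intro mult_right_mono) auto
    hence "\<bar>\<mu>\<bar> * \<eta>0 < norm X * \<eta>0" using \<mu>\<eta> that by (simp add: norm_mult mult.commute)
    hence "\<bar>\<mu>\<bar> < norm X" using \<eta>0 by simp
    thus ?thesis by linarith
  qed
  \<comment> \<open>The constant is 2C because \<open>diff_outer\<close> changes l and j in two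
    steps, each costing C.\<close>
  interpret coherent_family p IJ IL US P UV V KS KX KV r0 r0' \<eta>0 A B "2 * C" Q "\<bar>\<mu>\<bar> + 1" y dom
  proof (rule coherent_family.intro)
    show "cone_cover IL US KS" "cone_cover IJ UV KV" by fact+
    show "cone_cover IJ (P l) KX" for l unfolding P_def by (rule cone_cover_rotate[OF KX])
    show "open (V j)" for j unfolding V_eq UV_def
      by (auto intro!: open_Un open_Int open_asec open_Collect_less continuous_intros)
    show "X \<in> V j \<longleftrightarrow> X \<in> UV j" if "\<bar>\<mu>\<bar> + 1 < norm X" for j X by (rule UV_V) (use that in auto)
    show "continuous_on (dom j l) (\<lambda>(x, \<eta>). y j l x \<eta>)" if "j \<in> IJ" "l \<in> IL" for j l
      unfolding dom_def by (rule holomorphic2_on_imp_continuous[OF hol]) (use that in \<open>auto simp: IJ_def IL_def\<close>)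
    show "(\<lambda>t. y j l (\<phi> t) (\<psi> t)) holomorphic_on S" if "j \<in> IJ" "l \<in> IL" "open S" "\<phi> holomorphic_on S" "\<psi> holomorphic_on S"
        "\<And>t. t \<in> S \<Longrightarrow> (\<phi> t, \<psi> t) \<in> dom j l" for j l \<phi> \<psi> S
      using holomorphic2_on_compose[OF hol[of j l] that(3-5)] that unfolding IJ_def IL_def dom_def by auto
    show "(w, \<eta>) \<in> dom j l" if "l \<in> IL" "\<eta> \<in> US l" "norm \<eta> < \<eta>0" "w \<in> P l j" "r0 \<le> norm w" "norm w < r0'" for j l w \<eta>
      using outer[OF that(1,1,2,2) that(3-6)] inS[OF that(2,3)] by (simp add: dom_def fibred_def)
    show "norm (y j l w \<eta> - y i l' w \<eta>) \<le> 2 * C * exp (- (min A (B * r0 ^ p) / norm \<eta> ^ p))"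
      if h: "i \<in> IJ" "j \<in> IJ" "l \<in> IL" "l' \<in> IL" "\<eta> \<in> US l" "\<eta> \<in> US l'" "norm \<eta> < \<eta>0" "w \<in> P l j" "w \<in> P l' i" "r0 \<le> norm w" "norm w < r0'" for i j l l' w \<eta>
    proof -
      have "norm (y j l w \<eta> - y j l' w \<eta>) \<le> C * exp (- (A / norm \<eta> ^ p))"
        by (rule y_l) (use outer[OF h(3,3,5,5,7,8,10,11)] outer[OF h(4,3,6,5,7,8,10,11)] h in auto)
      also have "\<dots> \<le> C * exp (- (min A (B * r0 ^ p) / norm \<eta> ^ p))"
        using C0 by (intro mult_left_mono) (auto intro!: divide_right_mono)
      finally have 1: "norm (y j l w \<eta> - y j l' w \<eta>) \<le> C * exp (- (min A (B * r0 ^ p) / norm \<eta> ^ p))" .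
      have 2: "norm (y j l' w \<eta> - y i l' w \<eta>) \<le> C * exp (- (min A (B * r0 ^ p) / norm \<eta> ^ p))"
        by (rule y_j') (use outer[OF h(4,3,6,5,7,8,10,11)] outer[OF h(4,4,6,6,7,9,10,11)] quot[OF h(3,5,8)] quot[OF h(4,6,9)] h in auto)
      show ?thesis using 1 2 norm_triangle_ineq[of "y j l w \<eta> - y j l' w \<eta>" "y j l' w \<eta> - y i l' w \<eta>"] by simp
    qed
    show "(\<eta> * X, \<eta>) \<in> dom j l" if "l \<in> IL" "\<eta> \<in> US l" "norm \<eta> < \<eta>0" "X \<in> V j" "norm (\<eta> * X) < r0'" for j l X \<eta>
      using inner[OF that] inS[OF that(2,3)] by (simp add: dom_def fibred_def)
    show "norm (y j l (\<eta> * X) \<eta> - y j l' (\<eta> * X) \<eta>) \<le> 2 * C * exp (- (A / norm \<eta> ^ p))"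
      if h: "j \<in> IJ" "l \<in> IL" "l' \<in> IL" "\<eta> \<in> US l" "\<eta> \<in> US l'" "norm \<eta> < \<eta>0" "X \<in> V j" "norm (\<eta> * X) < r0'" for j l l' X \<eta>
    proof -
      have "norm (y j l (\<eta> * X) \<eta> - y j l' (\<eta> * X) \<eta>) \<le> C * exp (- (A / norm \<eta> ^ p))"
        by (intro y_l h inner)
      also have "\<dots> \<le> 2 * C * exp (- (A / norm \<eta> ^ p))" using C0 by (intro mult_right_mono) auto
      finally show ?thesis .
    qed
    show "norm (y i l (\<eta> * X) \<eta> - y j l (\<eta> * X) \<eta>) \<le> 2 * C * exp (- (B * norm X ^ p))"
      if h: "i \<in> IJ" "j \<in> IJ" "l \<in> IL" "\<eta> \<in> US l" "norm \<eta> < \<eta>0" "X \<in> V i" "X \<in> V j" "\<bar>\<mu>\<bar> + 1 < norm X" "norm (\<eta> * X) < r0'" for i j l X \<eta>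
    proof -
      have X: "\<eta> * X / \<eta> = X" using US0[OF h(4)] by simp
      have "X \<in> UV i" "X \<in> UV j" using h UV_V[of X] by auto
      hence "norm (y i l (\<eta> * X) \<eta> - y j l (\<eta> * X) \<eta>) \<le> C * exp (- (B * norm (\<eta> * X / \<eta>) ^ p))"
        using y_j[OF h(1-5) inner[OF h(3-6,9)] inner[OF h(3-5,7,9)]] X by simp
      also have "\<dots> \<le> 2 * C * exp (- (B * norm X ^ p))" unfolding X using C0 by (intro mult_right_mono) auto
      finally show ?thesis .
    qed
    show "norm (y j l (\<eta> * X) \<eta> - y i l (\<eta> * X) \<eta>) \<le> 2 * C * exp (- (min A (B * r0 ^ p) / norm \<eta> ^ p))"
      if h: "i \<in> IJ" "j \<in> IJ" "l \<in> IL" "\<eta> \<in> US l" "norm \<eta> < \<eta>0" "X \<in> V j" "\<eta> * X \<in> P l i" "r0 \<le> norm (\<eta> * X)" "norm (\<eta> * X) < r0'" for i j l X \<eta>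
    proof -
      have X: "\<eta> * X / \<eta> = X" using US0[OF h(4)] by simp
      have "X \<in> UV j" using h UV_V[of X] big[OF h(5,8)] by auto
      hence "norm (y j l (\<eta> * X) \<eta> - y i l (\<eta> * X) \<eta>) \<le> C * exp (- (min A (B * r0 ^ p) / norm \<eta> ^ p))"
        using y_j'[OF h(2,1,3,4,5) inner[OF h(3-6,9)] outer[OF h(3,3,4,4,5,7,8,9)]] X quot[OF h(3,4,7)] h(8) by simp
      also have "\<dots> \<le> 2 * C * exp (- (min A (B * r0 ^ p) / norm \<eta> ^ p))" using C0 by (intro mult_right_mono) auto
      finally show ?thesis .
    qed
  qed (use assms(1) r0 r0' \<eta>0 A0 B0 C0 Q in auto)
  have At_eq: "At = A'" by (simp add: At_def A'_def)
  have A'0: "A' > 0" using At_pos At_eq by simp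
  \<comment> \<open>Returns from (X, \<eta>) to (x, \<eta>): the shrunken angles of V_l^j ensure
    that g_n is evaluated at x/\<eta> inside its domain V^j.\<close>
  have WX: "x / \<eta> \<in> V j \<and> norm x < r0" if l: "l \<in> IL" and \<eta>: "\<eta> \<in> S l" and x: "x \<in> W j l \<eta>" for j l x \<eta>
  proof -
    have \<eta>': "\<eta> \<in> US l" "norm \<eta> < \<eta>0" "norm \<eta> > 0" using \<eta> US0[of \<eta> l] by (auto simp: S_eq)
    have ab: "alpha_jl \<alpha>V \<alpha>S \<beta>S \<delta> j l = \<alpha>V j + \<delta> + \<phi> l" "beta_jl \<beta>V \<alpha>S \<beta>S \<delta> j l = \<beta>V j - \<delta> + \<phi> l"
      by (simp_all add: alpha_jl_def beta_jl_def \<phi>_def)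
    have sgn: "(\<mu> * norm \<eta> > 0) = (\<mu> > 0)" using \<eta>' by (simp add: zero_less_mult_iff)
    consider "\<mu> > 0" "norm x < \<mu> * norm \<eta>" | "x \<in> asec (\<alpha>V j + \<delta> + \<phi> l) (\<beta>V j - \<delta> + \<phi> l)" "norm x < r0" "\<mu> > 0 \<or> - (\<mu> * norm \<eta>) < norm x"
      using x unfolding W_def quasi_sector_eq ab sgn by (auto split: if_splits)
    thus ?thesis
    proof cases
      case 1
      have "\<mu> * norm \<eta> \<le> \<bar>\<mu>\<bar> * \<eta>0" using \<eta>' by (intro mult_mono) auto
      moreover have "norm (x / \<eta>) < \<mu>" using 1 \<eta>' by (simp add: norm_divide pos_divide_less_eq)
      moreover have "norm x < r0" using calculation(1) 1 \<mu>\<eta> by linarith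
      ultimately show ?thesis using 1 by (auto simp: V_eq)
    next
      case 2
      have "x \<in> P l j" using 2(1) unfolding P_def Om_def mem_Collect_eq asec_rotate .
      hence "x / \<eta> \<in> UV j" by (intro quot[OF l \<eta>'(1)])
      moreover have "\<mu> > 0 \<or> - \<mu> < norm (x / \<eta>)" using 2(3) \<eta>' by (auto simp: norm_divide pos_less_divide_eq)
      ultimately show ?thesis using 2 by (auto simp: V_eq)
    qed
  qed
  show ?thesis
  proof (rule combined_expansion)
    fix a g c K
    assume K: "K > 0" and aH: "\<And>n. a n holomorphic_on ball 0 r0"
      and aB: "\<And>n x. norm x < r0 \<Longrightarrow> norm (a n x) \<le> K * (gw p At n * gev p n)"
      and gH: "\<And>j n. j \<in> IJ \<Longrightarrow> g j n holomorphic_on V j"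
      and gB: "\<And>j n M X. j \<in> IJ \<Longrightarrow> X \<in> V j \<Longrightarrow>
         norm X ^ M * norm (g j n X - (\<Sum>m\<in>{1..<M}. c n m / X ^ m)) \<le> K * (gw p At n * (gw p B M * gev p (M + n)))"
      and rem: "\<And>j l X \<eta> N. j \<in> IJ \<Longrightarrow> l \<in> IL \<Longrightarrow> X \<in> V j \<Longrightarrow> \<eta> \<in> US l \<Longrightarrow> norm \<eta> < \<eta>0 \<Longrightarrow> norm (\<eta> * X) < r0 \<Longrightarrow>
         norm (y j l (\<eta> * X) \<eta> - (\<Sum>n<N. (a n (\<eta> * X) + g j n X) * \<eta> ^ n)) \<le> K * (gw p At N * gev p N) * norm \<eta> ^ N"
    have rem': "norm (y j l x \<eta> - (\<Sum>n<N. (a n x + g j n (x / \<eta>)) * \<eta> ^ n)) \<le> K * (gw p At N * gev p N) * norm \<eta> ^ N"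
      if "j \<in> IJ" "l \<in> IL" "\<eta> \<in> S l" "x \<in> W j l \<eta>" for j l x \<eta> N
    proof -
      have \<eta>: "\<eta> \<in> US l" "norm \<eta> < \<eta>0" using that by (auto simp: S_eq)
      have "\<eta> * (x / \<eta>) = x" using US0[OF \<eta>(1)] by simp
      thus ?thesis using rem[OF that(1,2) _ \<eta>, of "x / \<eta>" N] WX[OF that(2-4)] by simp
    qed
    have aS: "a n \<in> H_space r0" for n
    proof -
      have "bounded (a n ` ball 0 r0)" unfolding bounded_iff
        by (intro exI[of _ "K * (gw p At n * gev p n)"]) (auto intro: aB)
      thus ?thesis using aH by (simp add: H_space_def)
    qed
    have gE: "has_expansion_at_infinity (g j n) (V j) (c n)" if "j \<in> IJ" for j n
      unfolding has_expansion_at_infinity_def using gB[OF that] by blast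
    have gS: "g j n \<in> G_space (V j)" if "j \<in> IJ" for j n
    proof -
      have "bounded (g j n ` V j)" unfolding bounded_iff
        using gB[OF that, of _ 0 n] by (intro exI[of _ "K * (gw p At n * (gw p B 0 * gev p (0 + n)))"]) auto
      thus ?thesis using gH[OF that] gE[OF that] by (auto simp: G_space_def)
    qed
    have gwA: "gw p At n = (A' powr (- 1 / real p)) ^ n" for n unfolding At_eq by (rule gw_power[OF A'0])
    have gwB: "gw p B n = (B powr (- 1 / real p)) ^ n" for n by (rule gw_power[OF B0])
    have GCE: "gevrey_combined_expansion p r0 (V j) (S l) (W j l) (y j l) a (g j)" if jl: "j \<in> IJ" "l \<in> IL" for j l
      unfolding gevrey_combined_expansion_def
    proof (intro conjI allI)
      show "(\<lambda>(x, \<eta>). y j l x \<eta>) holomorphic2_on fibred (S l) (W j l)"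
      proof (rule holomorphic2_on_subset[OF hol])
        show "fibred (S l) (W j l) \<subseteq> fibred (S l) (W' j l)"
        proof
          fix z assume "z \<in> fibred (S l) (W j l)"
          then obtain x \<eta> where z: "z = (x, \<eta>)" "\<eta> \<in> S l" "x \<in> W j l \<eta>" by (auto simp: fibred_def)
          have \<eta>: "\<eta> \<in> US l" "norm \<eta> < \<eta>0" using z by (auto simp: S_eq)
          have "\<eta> * (x / \<eta>) \<in> W' j l \<eta>"
            by (rule inner) (use WX[OF jl(2) z(2,3)] \<eta> jl r0' US0[OF \<eta>(1)] in auto)
          thus "z \<in> fibred (S l) (W' j l)" using z US0[OF \<eta>(1)] by (simp add: fibred_def)
        qed
      qed (use jl in \<open>auto simp: IJ_def IL_def\<close>)
      show "\<exists>c. (\<forall>n. has_expansion_at_infinity (g j n) (V j) (c n)) \<and>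
       (\<exists>C>0. \<exists>L1>0. \<exists>L2>0.
         (\<forall>n. \<forall>x\<in>ball 0 r0. cmod (a n x) \<le> C * L1 ^ n * Gamma (real n / real p + 1)) \<and>
         (\<forall>n M. \<forall>X\<in>V j. cmod X ^ M * cmod (g j n X - (\<Sum>m\<in>{1..<M}. c n m / X ^ m))
            \<le> C * L1 ^ n * L2 ^ M * Gamma (real (M + n) / real p + 1)) \<and>
         (\<forall>N. \<forall>\<eta>\<in>S l. \<forall>x\<in>W j l \<eta>. cmod (y j l x \<eta> - (\<Sum>n<N. (a n x + g j n (x / \<eta>)) * \<eta> ^ n))
            \<le> C * L1 ^ N * Gamma (real N / real p + 1) * cmod \<eta> ^ N))"
      proof (rule exI[of _ c], rule conjI, (use gE jl in blast), rule exI[of _ K], rule conjI, rule K,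
          rule exI[of _ "A' powr (- 1 / real p)"], rule conjI, (use A'0 in simp),
          rule exI[of _ "B powr (- 1 / real p)"], rule conjI, (use B0 in simp), intro conjI allI ballI)
        show "cmod (a n x) \<le> K * (A' powr (- 1 / real p)) ^ n * Gamma (real n / real p + 1)" if "x \<in> ball 0 r0" for n x
          using aB[of x n] that by (simp add: gwA gev_def mult.assoc)
        show "cmod X ^ M * cmod (g j n X - (\<Sum>m\<in>{1..<M}. c n m / X ^ m))
            \<le> K * (A' powr (- 1 / real p)) ^ n * (B powr (- 1 / real p)) ^ M * Gamma (real (M + n) / real p + 1)" if "X \<in> V j" for n M X
          using gB[OF jl(1) that, of M n] unfolding gwA gwB gev_def by (simp only: mult.assoc)
        show "cmod (y j l x \<eta> - (\<Sum>n<N. (a n x + g j n (x / \<eta>)) * \<eta> ^ n))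
            \<le> K * (A' powr (- 1 / real p)) ^ N * Gamma (real N / real p + 1) * cmod \<eta> ^ N" if "\<eta> \<in> S l" "x \<in> W j l \<eta>" for N \<eta> x
          using rem'[OF jl that, of N] unfolding gwA gev_def by (simp only: mult.assoc)
      qed
    qed (use aS gS jl in auto)
    show ?thesis
    proof (intro exI[of _ a] exI[of _ g] conjI)
      show "\<exists>K. \<forall>j\<in>{1..J}. \<forall>l\<in>{1..L}. \<forall>\<eta>\<in>S l. \<forall>x\<in>W j l \<eta>. \<forall>N>0.
              cmod (y j l x \<eta> - (\<Sum>n<N. (a n x + g j n (x / \<eta>)) * \<eta> ^ n))
                \<le> K * A' powr (- real N / real p) * Gamma (real N / real p + 1) * cmod \<eta> ^ N"
        using rem' unfolding gw_def gev_def At_eq IJ_def IL_def by (intro exI[of _ K]) (auto simp: mult.assoc)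
      show "\<exists>(c :: nat \<Rightarrow> nat \<Rightarrow> complex) K. \<forall>M n. \<forall>j\<in>{1..J}. \<forall>X\<in>V j.
              cmod X ^ M * cmod (g j n X - (\<Sum>m\<in>{1..<M}. c n m / X ^ m))
                \<le> K * A' powr (- real n / real p) * B powr (- real M / real p)
                    * Gamma (real (M + n) / real p + 1)"
      proof (intro exI[of _ c] exI[of _ K] allI ballI)
        fix M n j X assume "j \<in> {1..J}" "X \<in> V j"
        thus "cmod X ^ M * cmod (g j n X - (\<Sum>m\<in>{1..<M}. c n m / X ^ m))
                \<le> K * A' powr (- real n / real p) * B powr (- real M / real p) * Gamma (real (M + n) / real p + 1)"
          using gB[of j X M n] unfolding gw_def gev_def At_eq IJ_def by (simp only: mult.assoc)
      qed
    qed (use GCE aS gS in \<open>auto simp: IJ_def IL_def\<close>)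
  qed
qed

end
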